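(* Any two shift-invariant operators $S,T\in\mathbb S(\mathcal P(\mathcal D'))$ commute, i.e. $ST=TS$.
   Context: Fix $d\in\mathbb N$; $\mathbb N_0=\mathbb N\cup\{0\}$. For $\tau=(l,\varphi)$ with $l\in\mathbb N_0$, $\varphi\in C^\infty(\mathbb R^d)$, $\varphi\ge1$, let $\mathcal H_\tau$ be the real Sobolev space $W^{l,2}(\mathbb R^d,\varphi(x)\,dx)$. $\mathcal D=C_0^\infty(\mathbb R^d)$ is the space of real-valued smooth compactly supported functions, with the projective limit topology of the $\mathcal H_\tau$ (a nuclear space). $\mathcal D'$ is its dual, the pairing $\langle\omega,\xi\rangle$ being the continuous extension of the $L^2(\mathbb R^d,dx)$ inner product. $\mathcal D^{\odot n}$ ($n$-th symmetric tensor power) is the projective limit of the $\mathcal H_\tau^{\odot n}$; it consists of the functions in $C_0^\infty((\mathbb R^d)^n)$ symmetric in the $n$ variables; $\mathcal D'^{\odot n}$ is its dual with respect to $L^2(\mathbb R^d,dx)^{\odot n}$; $\mathcal D^{\odot0}=\mathcal D'^{\odot0}=\mathbb R$. A polynomial on $\mathcal D'$ is a function $P(\omega)=\sum_{k=0}^n\langle\omega^{\otimes k},f^{(k)}\rangle$ with $n\in\mathbb N_0$, $f^{(k)}\in\mathcal D^{\odot k}$, $\omega^{\otimes0}=1$. $\mathcal P(\mathcal D')$ is the space of all polynomials, with the topology transported from the topological direct sum $\bigoplus_{k\ge0}\mathcal D^{\odot k}$ via $(f^{(k)})_k\mapsto P$. $\mathcal L(\mathcal P(\mathcal D'))$ is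 the space of continuous linear operators on $\mathcal P(\mathcal D')$. For $\zeta\in\mathcal D'$, $(E(\zeta)P)(\omega)=P(\omega+\zeta)$. An operator $T\in\mathcal L(\mathcal P(\mathcal D'))$ is shift-invariant if $TE(\zeta)=E(\zeta)T$ for all $\zeta\in\mathcal D'$; $\mathbb S(\mathcal P(\mathcal D'))$ is the set of all shift-invariant operators. *)

theory Defs
  imports "HOL-Analysis.Analysis" "HOL-Library.Function_Algebras" "HOL-Combinatorics.Permutations"
begin

text \<open>
  All function spaces below are subspaces of full function types with the pointwise
  vector space structure. Functions that mathematically live on a carrier set
  (functions on \<open>(\<real>\<^sup>d)\<^sup>k\<close>, functionals on the test functions, polynomials
  on \<open>\<D>'\<close>) are required to vanish off that carrier, so that equality in HOL
  is equality on the carrier.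
\<close>

instantiation "fun" :: (type, real_vector) real_vector
begin

definition scaleR_fun :: "real \<Rightarrow> ('a \<Rightarrow> 'b) \<Rightarrow> 'a \<Rightarrow> 'b" where
  "scaleR_fun c f = (\<lambda>x. c *\<^sub>R f x)"

instance
proof
  fix a b :: real and f g :: "'a \<Rightarrow> 'b"
  show "a *\<^sub>R (f + g) = a *\<^sub>R f + a *\<^sub>R g"
    by (rule ext) (simp only: scaleR_fun_def plus_fun_apply scaleR_add_right)
  show "(a + b) *\<^sub>R f = a *\<^sub>R f + b *\<^sub>R f"
    by (rule ext) (simp only: scaleR_fun_def plus_fun_apply scaleR_add_left)
  show "a *\<^sub>R b *\<^sub>R f = (a * b) *\<^sub>R f"
    by (rule ext) (simp only: scaleR_fun_def scaleR_scaleR)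
  show "1 *\<^sub>R f = f"
    by (rule ext) (simp only: scaleR_fun_def scaleR_one)
qed

end

definition linear_map_on :: "'a::real_vector set \<Rightarrow> ('a \<Rightarrow> 'b::real_vector) \<Rightarrow> bool" where
  "linear_map_on V F \<longleftrightarrow>
     (\<forall>f\<in>V. \<forall>g\<in>V. F (f + g) = F f + F g) \<and> (\<forall>f\<in>V. \<forall>c. F (c *\<^sub>R f) = c *\<^sub>R F f)"

definition seminorm_on :: "'a::real_vector set \<Rightarrow> ('a \<Rightarrow> real) \<Rightarrow> bool" where
  "seminorm_on V p \<longleftrightarrow>
     (\<forall>f\<in>V. 0 \<le> p f) \<and>
     (\<forall>f\<in>V. \<forall>g\<in>V. p (f + g) \<le> p f + p g) \<and>
     (\<forall>f\<in>V. \<forall>c. p (c *\<^sub>R f) = \<bar>c\<bar> * p f)"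

definition seminorm_topology :: "'a::real_vector set \<Rightarrow> ('a \<Rightarrow> real) set \<Rightarrow> 'a topology" where
  "seminorm_topology V N =
     topology_generated_by {{g \<in> V. p (g - f) < e} | p f e. p \<in> N \<and> f \<in> V \<and> 0 < e}"

lemma topspace_seminorm_topology:
  assumes "p \<in> N" and "p 0 = 0"
  shows "topspace (seminorm_topology V N) = V"
  unfolding seminorm_topology_def topology_generated_by_topspace
proof (intro equalityI subsetI)
  fix f assume "f \<in> V"
  show "f \<in> \<Union>{{g \<in> V. p (g - f) < e} | p f e. p \<in> N \<and> f \<in> V \<and> 0 < e}"
  proof (rule UnionI)
    show "{g \<in> V. p (g - f) < 1} \<in> {{g \<in> V. p (g - f) < e} | p f e. p \<in> N \<and> f \<in> V \<and> 0 < e}"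
      by (rule CollectI, rule exI[of _ p], rule exI[of _ f], rule exI[of _ 1])
         (simp add: assms(1) \<open>f \<in> V\<close>)
    show "f \<in> {g \<in> V. p (g - f) < 1}"
      by (simp add: assms(2) \<open>f \<in> V\<close>)
  qed
qed auto

definition topological_dual :: "'a::real_vector set \<Rightarrow> 'a topology \<Rightarrow> ('a \<Rightarrow> real) set" where
  "topological_dual V X =
     {F. linear_map_on V F \<and> continuous_map X euclideanreal F \<and> (\<forall>f. f \<notin> V \<longrightarrow> F f = 0)}"


section \<open>Test functions on \<open>\<real>\<^sup>d\<close> and distributions\<close>

definition pdiff :: "'d \<Rightarrow> (real^'d \<Rightarrow> real) \<Rightarrow> real^'d \<Rightarrow> real" where
  "pdiff j f x = deriv (\<lambda>t. f (x + t *\<^sub>R axis j 1)) 0"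

definition smooth :: "(real^'d \<Rightarrow> real) \<Rightarrow> bool" where
  "smooth f \<longleftrightarrow>
     (\<forall>js. continuous_on UNIV (foldr pdiff js f) \<and>
           (\<forall>j x. (\<lambda>t. foldr pdiff js f (x + t *\<^sub>R axis j 1)) field_differentiable at 0))"

definition test_fun :: "(real^'d \<Rightarrow> real) set" where
  "test_fun = {f. smooth f \<and> compact (closure {x. f x \<noteq> 0})}"

definition weights :: "(nat \<times> (real^'d \<Rightarrow> real)) set" where
  "weights = {(l, \<phi>). smooth \<phi> \<and> (\<forall>x. 1 \<le> \<phi> x)}"

text \<open>
  The norm of \<open>W\<^sup>l\<^sup>,\<^sup>2(\<real>\<^sup>d, \<phi> dx)\<close>: the sum of
  the squared weighted norms of the full derivatives of order at most \<open>l\<close>, i.e. over all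
  words \<open>js\<close> of at most \<open>l\<close> coordinate directions. Summing over multi-indices
  instead would only change the positive coefficients, hence give an equivalent norm.
\<close>

definition sobolev_norm :: "nat \<times> (real^'d \<Rightarrow> real) \<Rightarrow> (real^'d \<Rightarrow> real) \<Rightarrow> real" where
  "sobolev_norm \<tau> f =
     sqrt (\<Sum>js | length js \<le> fst \<tau>. LINT x|lborel. (foldr pdiff js f x)\<^sup>2 * snd \<tau> x)"

definition test_fun_topology :: "(real^'d \<Rightarrow> real) topology" where
  "test_fun_topology = seminorm_topology test_fun (sobolev_norm ` weights)"

definition distributions :: "((real^'d \<Rightarrow> real) \<Rightarrow> real) set" where
  "distributions = topological_dual test_fun test_fun_topology"


section \<open>Symmetric tensor powers\<close>

text \<open>
  Points of \<open>(\<real>\<^sup>d)\<^sup>k\<close> are the extensional functions in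
  \<open>points k\<close>; the topology of the function type (product topology) and the measure
  \<open>PiM\<close> induce on them the usual topology and Lebesgue measure. For \<open>k = 0\<close>
  there is exactly one point, so that the zeroth tensor power is a copy of \<open>\<real>\<close>.
\<close>

definition points :: "nat \<Rightarrow> (nat \<Rightarrow> real^'d) set" where
  "points k = PiE {..<k} (\<lambda>_. UNIV)"

definition pdiff_at :: "nat \<Rightarrow> 'd \<Rightarrow> ((nat \<Rightarrow> real^'d) \<Rightarrow> real) \<Rightarrow> (nat \<Rightarrow> real^'d) \<Rightarrow> real" where
  "pdiff_at i j f x = deriv (\<lambda>t. f (x(i := x i + t *\<^sub>R axis j 1))) 0"

definition smooth_pow :: "nat \<Rightarrow> ((nat \<Rightarrow> real^'d) \<Rightarrow> real) \<Rightarrow> bool" where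
  "smooth_pow k f \<longleftrightarrow>
     (\<forall>ps \<in> lists ({..<k} \<times> UNIV).
        continuous_on (points k) (foldr (\<lambda>(i, j). pdiff_at i j) ps f) \<and>
        (\<forall>i<k. \<forall>j. \<forall>x\<in>points k.
           (\<lambda>t. foldr (\<lambda>(i, j). pdiff_at i j) ps f (x(i := x i + t *\<^sub>R axis j 1)))
             field_differentiable at 0))"

definition sym_test_fun :: "nat \<Rightarrow> ((nat \<Rightarrow> real^'d) \<Rightarrow> real) set" where
  "sym_test_fun k =
     {f. smooth_pow k f \<and> compact (closure {x. f x \<noteq> 0}) \<and>
         (\<forall>x. x \<notin> points k \<longrightarrow> f x = 0) \<and>
         (\<forall>\<pi>. \<pi> permutes {..<k} \<longrightarrow> (\<forall>x\<in>points k. f (x \<circ> \<pi>) = f x))}"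

text \<open>
  The norm of the Hilbert space tensor power of \<open>W\<^sup>l\<^sup>,\<^sup>2(\<real>\<^sup>d, \<phi> dx)\<close>:
  derivatives of order at most \<open>l\<close> are taken in each of the \<open>k\<close> variables separately
  (\<open>J i\<close> lists the directions used in the \<open>i\<close>-th variable) and the weight is
  \<open>\<phi>(x\<^sub>0) \<dots> \<phi>(x\<^sub>k\<^sub>-\<^sub>1)\<close>. The associated inner product is the one
  determined by multiplicativity on elementary tensors.
\<close>

definition sobolev_norm_pow ::
    "nat \<Rightarrow> nat \<times> (real^'d \<Rightarrow> real) \<Rightarrow> ((nat \<Rightarrow> real^'d) \<Rightarrow> real) \<Rightarrow> real" where
  "sobolev_norm_pow k \<tau> f =
     sqrt (\<Sum>J \<in> PiE {..<k} (\<lambda>_. {js. length js \<le> fst \<tau>}).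
       LINT x|PiM {..<k} (\<lambda>_. lborel).
         (foldr (\<lambda>i. foldr (pdiff_at i) (J i)) [0..<k] f x)\<^sup>2 * (\<Prod>i<k. snd \<tau> (x i)))"

definition sym_topology :: "nat \<Rightarrow> ((nat \<Rightarrow> real^'d) \<Rightarrow> real) topology" where
  "sym_topology k = seminorm_topology (sym_test_fun k) (sobolev_norm_pow k ` weights)"

definition tensor_pow :: "nat \<Rightarrow> (real^'d \<Rightarrow> real) \<Rightarrow> (nat \<Rightarrow> real^'d) \<Rightarrow> real" where
  "tensor_pow k \<xi> x = (if x \<in> points k then \<Prod>i<k. \<xi> (x i) else 0)"

text \<open>
  \<open>\<omega>\<^sup>\<otimes>\<^sup>k\<close> is the element of the dual of the \<open>k\<close>-th symmetric tensor power with
  \<open>\<langle>\<omega>\<^sup>\<otimes>\<^sup>k, \<xi>\<^sup>\<otimes>\<^sup>k\<rangle> = \<langle>\<omega>, \<xi>\<rangle>\<^sup>k\<close>; it is unique because the \<open>\<xi>\<^sup>\<otimes>\<^sup>k\<close> span a dense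
  subspace. The pairing is evaluation.
\<close>

definition distr_pow ::
    "nat \<Rightarrow> ((real^'d \<Rightarrow> real) \<Rightarrow> real) \<Rightarrow> ((nat \<Rightarrow> real^'d) \<Rightarrow> real) \<Rightarrow> real" where
  "distr_pow k \<omega> =
     (THE F. F \<in> topological_dual (sym_test_fun k) (sym_topology k) \<and>
             (\<forall>\<xi>\<in>test_fun. F (tensor_pow k \<xi>) = \<omega> \<xi> ^ k))"


section \<open>Polynomials on distributions\<close>

definition coeff_seqs :: "(nat \<Rightarrow> (nat \<Rightarrow> real^'d) \<Rightarrow> real) set" where
  "coeff_seqs = {f. (\<forall>k. f k \<in> sym_test_fun k) \<and> finite {k. f k \<noteq> 0}}"

definition single_coeff ::
    "nat \<Rightarrow> ((nat \<Rightarrow> real^'d) \<Rightarrow> real) \<Rightarrow> nat \<Rightarrow> (nat \<Rightarrow> real^'d) \<Rightarrow> real" where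
  "single_coeff k g = (\<lambda>m. if m = k then g else 0)"

text \<open>
  The locally convex direct sum topology, i.e. the finest locally convex topology for which all
  inclusions of the summands are continuous.
\<close>

definition coeff_topology :: "(nat \<Rightarrow> (nat \<Rightarrow> real^'d) \<Rightarrow> real) topology" where
  "coeff_topology = seminorm_topology coeff_seqs
     {p. seminorm_on coeff_seqs p \<and>
         (\<forall>k. continuous_map (sym_topology k) euclideanreal (\<lambda>g. p (single_coeff k g)))}"

definition poly_of_coeffs ::
    "(nat \<Rightarrow> (nat \<Rightarrow> real^'d) \<Rightarrow> real) \<Rightarrow> ((real^'d \<Rightarrow> real) \<Rightarrow> real) \<Rightarrow> real" where
  "poly_of_coeffs f \<omega> =
     (if \<omega> \<in> distributions then \<Sum>k | f k \<noteq> 0. distr_pow k \<omega> (f k) else 0)"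

definition polynomials :: "(((real^'d \<Rightarrow> real) \<Rightarrow> real) \<Rightarrow> real) set" where
  "polynomials = poly_of_coeffs ` coeff_seqs"

text \<open>
  Transport of the topology along the bijection \<open>poly_of_coeffs\<close> from
  \<open>coeff_seqs\<close> to \<open>polynomials\<close>.
\<close>

definition polynomial_topology :: "(((real^'d \<Rightarrow> real) \<Rightarrow> real) \<Rightarrow> real) topology" where
  "polynomial_topology =
     topology (\<lambda>U. U \<subseteq> polynomials \<and>
                   openin coeff_topology {f \<in> coeff_seqs. poly_of_coeffs f \<in> U})"

lemma openin_polynomial_topology:
  fixes U :: "(((real^'d \<Rightarrow> real) \<Rightarrow> real) \<Rightarrow> real) set"
  shows "openin polynomial_topology U \<longleftrightarrow>
     U \<subseteq> polynomials \<and> openin coeff_topology {f \<in> coeff_seqs. poly_of_coeffs f \<in> U}"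
proof -
  let ?pre = "\<lambda>U :: (((real^'d \<Rightarrow> real) \<Rightarrow> real) \<Rightarrow> real) set. {f \<in> coeff_seqs. poly_of_coeffs f \<in> U}"
  have "istopology (\<lambda>U. U \<subseteq> polynomials \<and> openin coeff_topology (?pre U))"
    unfolding istopology_def
  proof (intro conjI allI impI)
    fix A B assume "A \<subseteq> polynomials \<and> openin coeff_topology (?pre A)"
      "B \<subseteq> polynomials \<and> openin coeff_topology (?pre B)"
    moreover have "?pre (A \<inter> B) = ?pre A \<inter> ?pre B" by auto
    ultimately show "A \<inter> B \<subseteq> polynomials" "openin coeff_topology (?pre (A \<inter> B))" by auto
  next
    fix \<K> assume K: "\<forall>A\<in>\<K>. A \<subseteq> polynomials \<and> openin coeff_topology (?pre A)"
    have "?pre (\<Union>\<K>) = \<Union>(?pre ` \<K>)" by auto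
    then show "\<Union>\<K> \<subseteq> polynomials" "openin coeff_topology (?pre (\<Union>\<K>))"
      using K by (auto intro!: openin_Union)
  qed
  then show ?thesis
    by (simp add: polynomial_topology_def topology_inverse')
qed


section \<open>Shift-invariant operators\<close>

definition polynomial_operators ::
    "((((real^'d \<Rightarrow> real) \<Rightarrow> real) \<Rightarrow> real) \<Rightarrow> (((real^'d \<Rightarrow> real) \<Rightarrow> real) \<Rightarrow> real)) set" where
  "polynomial_operators =
     {T. T ` polynomials \<subseteq> polynomials \<and> linear_map_on polynomials T \<and>
         continuous_map polynomial_topology polynomial_topology T}"

definition shift ::
    "((real^'d \<Rightarrow> real) \<Rightarrow> real) \<Rightarrow>
     (((real^'d \<Rightarrow> real) \<Rightarrow> real) \<Rightarrow> real) \<Rightarrow> ((real^'d \<Rightarrow> real) \<Rightarrow> real) \<Rightarrow> real" where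
  "shift \<zeta> P = (\<lambda>\<omega>. if \<omega> \<in> distributions then P (\<omega> + \<zeta>) else 0)"

definition shift_invariant ::
    "((((real^'d \<Rightarrow> real) \<Rightarrow> real) \<Rightarrow> real) \<Rightarrow> (((real^'d \<Rightarrow> real) \<Rightarrow> real) \<Rightarrow> real)) set" where
  "shift_invariant =
     {T \<in> polynomial_operators.
        \<forall>\<zeta>\<in>distributions. \<forall>P\<in>polynomials. T (shift \<zeta> P) = shift \<zeta> (T P)}"

end

theory Submission
  imports Defs
begin

text \<open>
  Let \<open>S\<close> and \<open>T\<close> be shift-invariant. On a power \<open>\<langle>\<omega>, \<xi>\<rangle>\<^sup>n\<close> of a linear functional, the binomial
  theorem turns a shift into a combination of lower powers, and shift-invariance then gives
  \<open>T \<langle>\<cdot>, \<xi>\<rangle>\<^sup>n = \<Sum>\<^sub>i (n choose i) \<lambda>\<^sub>i \<langle>\<cdot>, \<xi>\<rangle>\<^sup>n\<^sup>-\<^sup>i\<close>, where \<open>\<lambda>\<^sub>i\<close> is the value of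
  \<open>T \<langle>\<cdot>, \<xi>\<rangle>\<^sup>i\<close> at \<open>0\<close>. Two operators of this form commute on these powers
  (\<open>shift_invariant_commute_power_poly\<close>). The rest follows by continuity: for fixed \<open>\<omega>\<close> and \<open>k\<close>,
  the difference of \<open>S T\<close> and \<open>T S\<close> at \<open>\<langle>\<cdot>\<^sup>\<otimes>\<^sup>k, f\<rangle>\<close>, evaluated at \<open>\<omega>\<close>, is a continuous linear functional
  of \<open>f\<close> that vanishes at all \<open>\<xi>\<^sup>\<otimes>\<^sup>k\<close>, and such a functional is zero (\<open>dual_sym_eq_0\<close>) because
  these tensor powers span a dense subspace (\<open>tensor_pow_dense\<close>). Injectivity of the passage from
  coefficients to polynomials is not needed.
  
  The density is proved one scalar coordinate at a time. A smooth function of one variable with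
  support in a bounded interval is approximated, with finitely many derivatives, by Riemann sums
  of its convolution with a mollifier (\<open>smooth1_approx\<close>). These sums use only point values of the
  function, so that they can be formed in one coordinate with the others as parameters
  (\<open>approx_one_coordinate\<close>). After all coordinates have been treated, the approximants are
  combinations of elementary tensors; symmetrization and the polarization formula for the
  permanent (\<open>permanent_polarization\<close>) turn these into combinations of tensor powers.
  
  The continuity argument needs that evaluation at \<open>\<omega>\<close> is continuous on polynomials, hence that
  \<open>\<omega>\<^sup>\<otimes>\<^sup>k\<close> is well defined (\<open>distr_pow\<close>). Uniqueness is the density. For existence, a bound
  \<open>\<bar>\<langle>\<omega>, \<xi>\<rangle>\<bar> \<le> C \<parallel>\<xi>\<parallel>\<^sub>\<tau>\<close> implies the bound with constant \<open>C\<^sup>k\<close> on combinations of tensor powers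
  (\<open>tensor_power_bound\<close>), so that \<open>\<xi>\<^sup>\<otimes>\<^sup>k \<mapsto> \<langle>\<omega>, \<xi>\<rangle>\<^sup>k\<close> extends by density
  (\<open>linear_extension_by_density\<close>).
\<close>

section \<open>Smooth functions of one real variable\<close>

text \<open>
  Smoothness on the real line, stated with the iterated derivative of the library.
\<close>

definition smooth1 :: "(real \<Rightarrow> real) \<Rightarrow> bool" where
  "smooth1 f \<longleftrightarrow> (\<forall>n x. (deriv ^^ n) f field_differentiable at x)"

lemma smooth1_has_deriv:
  assumes "smooth1 f"
  shows "((deriv ^^ n) f has_real_derivative (deriv ^^ Suc n) f x) (at x)"
  using assms by (simp add: smooth1_def DERIV_deriv_iff_field_differentiable)

lemma smooth1_has_deriv0:
  assumes "smooth1 f"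
  shows "(f has_real_derivative deriv f x) (at x)"
  using smooth1_has_deriv[OF assms, of 0] by simp

lemma smooth1_higher: "smooth1 f \<Longrightarrow> smooth1 ((deriv ^^ m) f)"
  unfolding smooth1_def by (metis comp_apply funpow_add)

lemma smooth1_deriv: "smooth1 f \<Longrightarrow> smooth1 (deriv f)"
  using smooth1_higher[of f 1] by simp

lemma smooth1_continuous:
  assumes "smooth1 f" shows "continuous_on A ((deriv ^^ n) f)"
  by (rule continuous_at_imp_continuous_on)
     (use smooth1_has_deriv[OF assms] in \<open>blast intro: DERIV_isCont\<close>)

text \<open>
  A sequence of functions, each the derivative of its predecessor, witnesses smoothness and
  consists of the higher derivatives of its first member.
\<close>

lemma smooth1_iterated:
  assumes "g 0 = f" and "\<And>n x. (g n has_real_derivative g (Suc n) x) (at x)"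
  shows "(deriv ^^ n) f = g n" and "smooth1 f"
proof -
  show *: "(deriv ^^ n) f = g n" for n
  proof (induction n)
    case (Suc n)
    then show ?case using assms(2) by (auto intro!: ext DERIV_imp_deriv)
  qed (simp add: assms)
  show "smooth1 f" using assms(2) by (auto simp: smooth1_def * field_differentiable_def)
qed

lemma smooth1_mult:
  assumes "smooth1 f" "smooth1 g"
  shows "smooth1 (\<lambda>x. f x * g x)"
proof (rule smooth1_iterated(2))
  let ?h = "\<lambda>n x. \<Sum>k\<le>n. real (n choose k) * ((deriv ^^ k) f x * (deriv ^^ (n - k)) g x)"
  show "?h 0 = (\<lambda>x. f x * g x)" by simp
  fix n x
  let ?F = "\<lambda>k. (deriv ^^ k) f x" let ?G = "\<lambda>k. (deriv ^^ k) g x"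
  have "(?h n has_real_derivative (\<Sum>k\<le>n. real (n choose k) * (?F (Suc k) * ?G (n - k) + ?G (Suc (n - k)) * ?F k))) (at x)"
    by (intro DERIV_sum DERIV_cmult DERIV_mult smooth1_has_deriv assms)
  also have "(\<Sum>k\<le>n. real (n choose k) * (?F (Suc k) * ?G (n - k) + ?G (Suc (n - k)) * ?F k))
     = (\<Sum>k\<le>n. real (n choose k) * (?F (Suc k) * ?G (n - k)))
       + (\<Sum>k\<le>n. real (n choose k) * (?F k * ?G (Suc n - k)))"
    by (simp add: sum.distrib[symmetric] algebra_simps Suc_diff_le)
  also have "(\<Sum>k\<le>n. real (n choose k) * (?F k * ?G (Suc n - k)))
      = (\<Sum>k\<le>Suc n. real (n choose k) * (?F k * ?G (Suc n - k)))"
    by simp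
  also have "(\<Sum>k\<le>n. real (n choose k) * (?F (Suc k) * ?G (n - k)))
     + (\<Sum>k\<le>Suc n. real (n choose k) * (?F k * ?G (Suc n - k))) = ?h (Suc n) x"
    by (simp add: sum.atMost_Suc_shift algebra_simps sum.distrib[symmetric] del: sum.atMost_Suc funpow.simps)
  finally show "(?h n has_real_derivative ?h (Suc n) x) (at x)" .
qed

lemma smooth1_affine:
  assumes "smooth1 f"
  shows "(deriv ^^ n) (\<lambda>x. c * f (b - x)) = (\<lambda>x. c * (-1) ^ n * (deriv ^^ n) f (b - x))"
    and "smooth1 (\<lambda>x. c * f (b - x))"
proof -
  have "((\<lambda>x. c * (-1) ^ n * (deriv ^^ n) f (b - x)) has_real_derivative
      c * (-1) ^ Suc n * (deriv ^^ Suc n) f (b - x)) (at x)" for n x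
  proof -
    have "((\<lambda>x. b - x) has_real_derivative -1) (at x)"
      by (auto intro!: derivative_eq_intros)
    from DERIV_cmult[OF DERIV_chain2[OF smooth1_has_deriv[OF assms] this], of "c * (-1) ^ n" n]
    show ?thesis by (simp add: mult_ac)
  qed
  from smooth1_iterated[of "\<lambda>n x. c * (-1) ^ n * (deriv ^^ n) f (b - x)", OF _ this]
  show "(deriv ^^ n) (\<lambda>x. c * f (b - x)) = (\<lambda>x. c * (-1) ^ n * (deriv ^^ n) f (b - x))"
    "smooth1 (\<lambda>x. c * f (b - x))" by simp_all
qed

lemma smooth1_translate:
  assumes "smooth1 f"
  shows "(deriv ^^ n) (\<lambda>x. c * f (x - b)) = (\<lambda>x. c * (deriv ^^ n) f (x - b))"
    and "smooth1 (\<lambda>x. c * f (x - b))"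
proof -
  have "((\<lambda>x. c * (deriv ^^ n) f (x - b)) has_real_derivative
      c * (deriv ^^ Suc n) f (x - b)) (at x)" for n x
  proof -
    have "((\<lambda>x. x - b) has_real_derivative 1) (at x)"
      by (auto intro!: derivative_eq_intros)
    from DERIV_cmult[OF DERIV_chain2[OF smooth1_has_deriv[OF assms] this], of c n]
    show ?thesis by simp
  qed
  from smooth1_iterated[of "\<lambda>n x. c * (deriv ^^ n) f (x - b)", OF _ this]
  show "(deriv ^^ n) (\<lambda>x. c * f (x - b)) = (\<lambda>x. c * (deriv ^^ n) f (x - b))"
    "smooth1 (\<lambda>x. c * f (x - b))" by simp_all
qed

lemma deriv_cong_open:
  fixes f g :: "real \<Rightarrow> real"
  assumes "open A" "x \<in> A" "\<And>y. y \<in> A \<Longrightarrow> f y = g y"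
  shows "deriv f x = deriv g x"
  by (rule deriv_cong_ev) (use assms eventually_nhds in blast)+

lemma higher_deriv_zero_open:
  fixes f :: "real \<Rightarrow> real"
  assumes "open A" "\<And>y. y \<in> A \<Longrightarrow> f y = 0" "x \<in> A"
  shows "(deriv ^^ n) f x = 0"
  using assms(3)
proof (induction n arbitrary: x)
  case (Suc n)
  have "deriv ((deriv ^^ n) f) x = deriv (\<lambda>_. 0) x"
    by (rule deriv_cong_open[OF assms(1) Suc.prems]) (use Suc in auto)
  then show ?case by simp
qed (use assms in auto)

text \<open>
  The functions \<open>p (1/x) exp (-1/x)\<close>, extended by \<open>0\<close> to \<open>x \<le> 0\<close>, for polynomials \<open>p\<close>. The family
  is closed under differentiation, which makes its members smooth; a product of translates and
  reflections of \<open>flat 1\<close> is the bump function below.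
\<close>

definition flat :: "real poly \<Rightarrow> real \<Rightarrow> real" where
  "flat p x = (if 0 < x then poly p (1 / x) * exp (- 1 / x) else 0)"

lemma poly_over_exp_tendsto_0: "((\<lambda>y::real. poly p y / exp y) \<longlongrightarrow> 0) at_top"
proof -
  have "((\<lambda>y::real. \<Sum>i\<le>degree p. coeff p i * (y ^ i / exp y)) \<longlongrightarrow> (\<Sum>i\<le>degree p. coeff p i * 0)) at_top"
    by (intro tendsto_sum tendsto_mult tendsto_const tendsto_power_div_exp_0)
  then show ?thesis by (simp add: poly_altdef sum_divide_distrib)
qed

lemma flat_tendsto: "((\<lambda>x. poly p (1 / x) * exp (- 1 / x)) \<longlongrightarrow> 0) (at_right (0::real))"
proof -
  have "((\<lambda>x. poly p (inverse x) / exp (inverse x)) \<longlongrightarrow> 0) (at_right (0::real))"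
    using filterlim_compose[OF poly_over_exp_tendsto_0 filterlim_inverse_at_top_right] .
  then show ?thesis
    by (simp add: divide_inverse exp_minus)
qed

lemma flat_has_deriv:
  "(flat p has_real_derivative flat ([:0, 0, 1:] * (p - pderiv p)) x) (at x)"
proof -
  consider "x > 0" | "x < 0" | "x = 0" by linarith
  then show ?thesis
  proof cases
    case 1
    have "((\<lambda>x. poly p (1 / x)) has_real_derivative poly (pderiv p) (1 / x) * (- (1 / x\<^sup>2))) (at x)"
      by (rule DERIV_chain2[OF poly_DERIV]) (use 1 in \<open>auto intro!: derivative_eq_intros simp: power2_eq_square\<close>)
    moreover have "((\<lambda>x. exp (- 1 / x)) has_real_derivative exp (- 1 / x) * (1 / x\<^sup>2)) (at x)"
      by (rule DERIV_chain2[OF DERIV_exp]) (use 1 in \<open>auto intro!: derivative_eq_intros simp: power2_eq_square\<close>)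
    ultimately have "((\<lambda>x. poly p (1 / x) * exp (- 1 / x)) has_real_derivative
        poly (pderiv p) (1 / x) * (- (1 / x\<^sup>2)) * exp (- 1 / x)
        + exp (- 1 / x) * (1 / x\<^sup>2) * poly p (1 / x)) (at x)"
      by (rule DERIV_mult)
    also have "poly (pderiv p) (1 / x) * (- (1 / x\<^sup>2)) * exp (- 1 / x)
        + exp (- 1 / x) * (1 / x\<^sup>2) * poly p (1 / x) = flat ([:0, 0, 1:] * (p - pderiv p)) x"
      using 1 by (simp add: flat_def power2_eq_square algebra_simps)
    finally have "((\<lambda>x. poly p (1 / x) * exp (- 1 / x)) has_real_derivative flat ([:0, 0, 1:] * (p - pderiv p)) x) (at x)" .
    moreover have "eventually (\<lambda>y. flat p y = poly p (1 / y) * exp (- 1 / y)) (nhds x)"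
      using 1 eventually_nhds_in_open[of "{0<..}" x] by (auto elim!: eventually_mono simp: flat_def)
    ultimately show ?thesis by (subst DERIV_cong_ev[OF refl _ refl])
  next
    case 2
    have "eventually (\<lambda>y. flat p y = 0) (nhds x)"
      using 2 eventually_nhds_in_open[of "{..<0}" x] by (auto elim!: eventually_mono simp: flat_def)
    then show ?thesis using 2 by (subst DERIV_cong_ev[OF refl _ refl]) (auto simp: flat_def)
  next
    case 3
    have "((\<lambda>h. (flat p h) / h) \<longlongrightarrow> 0) (at_right 0)"
    proof (rule Lim_transform_eventually[OF flat_tendsto[of "[:0,1:] * p"]])
      show "\<forall>\<^sub>F x in at_right 0. poly ([:0, 1:] * p) (1 / x) * exp (- 1 / x) = flat p x / x"
        by (auto simp: eventually_at_filter flat_def)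
    qed
    moreover have "((\<lambda>h. (flat p h) / h) \<longlongrightarrow> 0) (at_left 0)"
      by (rule Lim_transform_eventually[OF tendsto_const]) (auto simp: eventually_at_filter flat_def)
    ultimately have "((\<lambda>h. (flat p h) / h) \<longlongrightarrow> 0) (at 0)"
      by (simp add: filterlim_split_at)
    moreover have "flat q 0 = 0" for q by (simp add: flat_def)
    ultimately show ?thesis unfolding 3 DERIV_def by simp
  qed
qed

lemma smooth1_flat: "smooth1 (flat p)"
proof (rule smooth1_iterated(2))
  show "(((\<lambda>n. flat (((\<lambda>p. [:0, 0, 1:] * (p - pderiv p)) ^^ n) p)) n) has_real_derivative
     (\<lambda>n. flat (((\<lambda>p. [:0, 0, 1:] * (p - pderiv p)) ^^ n) p)) (Suc n) x) (at x)" for n x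
    using flat_has_deriv by (simp del: pCons_0_0 mult_pCons_left)
qed simp

lemma exists_mollifier:
  fixes e :: real assumes "0 < e"
  obtains r where "smooth1 r" "\<And>x. 0 \<le> r x" "\<And>x. e \<le> \<bar>x\<bar> \<Longrightarrow> r x = 0" "integral {-e..e} r = 1"
proof -
  define b where "b x = flat 1 (e + x) * flat 1 (e - x)" for x
  have b: "smooth1 b"
    unfolding b_def using smooth1_mult[OF smooth1_translate(2)[OF smooth1_flat, of 1 1 "-e"] smooth1_affine(2)[OF smooth1_flat, of 1 1 e]]
    by (simp add: add.commute)
  have nonneg: "0 \<le> b x" for x by (simp add: b_def flat_def)
  have cont: "continuous_on {-e..e} b" using smooth1_continuous[OF b, of _ 0] by simp
  have "0 < integral {-e..e} b"
  proof (rule ccontr)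
    assume "\<not> ?thesis"
    moreover have "0 \<le> integral {-e..e} b" by (simp add: nonneg integral_nonneg integrable_continuous_real cont)
    ultimately have "(b has_integral 0) (cbox (-e) e)"
      using integrable_integral[OF integrable_continuous_real[OF cont]] by simp
    from has_integral_0_cbox_imp_0[OF _ _ this, of 0] have "b 0 = 0" using assms cont nonneg by auto
    then show False using assms by (simp add: b_def flat_def)
  qed
  moreover have "smooth1 (\<lambda>x. (1 / integral {-e..e} b) * b x)"
    using smooth1_translate(2)[OF b, of "1 / integral {-e..e} b" 0] by simp
  moreover have "b x = 0" if "e \<le> \<bar>x\<bar>" for x using that by (auto simp: b_def flat_def)
  ultimately show ?thesis
    by (intro that[of "\<lambda>x. (1 / integral {-e..e} b) * b x"]) (simp_all add: nonneg)
qed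

section \<open>Approximation in one variable with all derivatives\<close>

lemma smooth1_deriv_bounded:
  assumes "smooth1 f" "\<And>x. e \<le> \<bar>x\<bar> \<Longrightarrow> f x = 0"
  obtains B where "\<And>b x. b \<le> m \<Longrightarrow> \<bar>(deriv ^^ b) f x\<bar> \<le> B"
proof -
  have "\<exists>B. \<forall>x. \<bar>(deriv ^^ b) f x\<bar> \<le> B" for b
  proof -
    have "compact ((deriv ^^ b) f ` {-e..e})"
      by (intro compact_continuous_image smooth1_continuous assms) simp
    then obtain B where B: "\<And>x. x \<in> {-e..e} \<Longrightarrow> \<bar>(deriv ^^ b) f x\<bar> \<le> B"
      by (force dest!: compact_imp_bounded simp: bounded_iff)
    have "(deriv ^^ b) f x = 0" if "x \<notin> {-e..e}" for x
      by (rule higher_deriv_zero_open[of "- {-e..e}"]) (use assms that in \<open>auto intro!: open_Compl\<close>)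
    then have "\<bar>(deriv ^^ b) f x\<bar> \<le> max B 0" for x
      using B[of x] by (cases "x \<in> {-e..e}") auto
    then show ?thesis by blast
  qed
  then obtain B where B: "\<And>b x. \<bar>(deriv ^^ b) f x\<bar> \<le> B b" by metis
  have "\<bar>(deriv ^^ b) f x\<bar> \<le> (\<Sum>b\<le>m. \<bar>B b\<bar>)" if "b \<le> m" for b x
  proof -
    have "\<bar>(deriv ^^ b) f x\<bar> \<le> \<bar>B b\<bar>" using B[where b=b and x=x] by linarith
    also have "\<dots> \<le> (\<Sum>b\<le>m. \<bar>B b\<bar>)" using that by (intro member_le_sum) auto
    finally show ?thesis .
  qed
  then show ?thesis using that by blast
qed

lemma riemann_sum_error:
  fixes G G' :: "real \<Rightarrow> real"
  assumes deriv: "\<And>t. (G has_real_derivative G' t) (at t)" and bound: "\<And>t. \<bar>G' t\<bar> \<le> L" and h: "0 \<le> h"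
  shows "\<bar>integral {c..c + real n * h} G - (\<Sum>j<n. h * G (c + real j * h))\<bar> \<le> real n * (h\<^sup>2 * L)"
proof (induction n)
  case (Suc n)
  let ?u = "c + real n * h" let ?v = "c + real (Suc n) * h"
  have cont: "continuous_on A G" for A
    using deriv by (meson DERIV_isCont continuous_at_imp_continuous_on)
  have int: "G integrable_on {a..b}" for a b by (intro integrable_continuous_real cont)
  have uv: "?v = ?u + h" "?u \<le> ?v" using h by (auto simp: algebra_simps)
  have "integral {c..?u} G + integral {?u..?v} G = integral {c..?v} G"
    by (rule Henstock_Kurzweil_Integration.integral_combine) (use h int in \<open>auto simp: algebra_simps\<close>)
  moreover have "\<bar>integral {?u..?v} (\<lambda>t. G t - G ?u)\<bar> \<le> (h * L) * (?v - ?u)"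
  proof -
    have "norm (integral {?u..?v} (\<lambda>t. G t - G ?u)) \<le> (h * L) * (?v - ?u)"
    proof (rule integral_bound)
      fix t assume t: "t \<in> {?u..?v}"
      have "norm (G t - G ?u) \<le> L * norm (t - ?u)"
        by (rule field_differentiable_bound[of UNIV G G'])
           (use deriv bound in auto)
      also have "\<dots> \<le> L * h" using t uv bound[of 0] by (intro mult_left_mono) (auto simp: algebra_simps)
      finally show "norm (G t - G ?u) \<le> h * L" by (simp add: mult.commute)
    qed (use h in \<open>auto intro!: continuous_intros cont simp: algebra_simps\<close>)
    then show ?thesis by simp
  qed
  moreover have "integral {?u..?v} (\<lambda>t. G t - G ?u) = integral {?u..?v} G - h * G ?u"
    using uv h by (subst Henstock_Kurzweil_Integration.integral_diff) (auto simp: int)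
  moreover have "(h * L) * (?v - ?u) = h\<^sup>2 * L" using uv by (simp add: power2_eq_square)
  moreover have "real (Suc n) * (h\<^sup>2 * L) = real n * (h\<^sup>2 * L) + h\<^sup>2 * L" by (simp add: algebra_simps)
  ultimately show ?case using Suc unfolding sum.lessThan_Suc by linarith
qed simp

text \<open>
  Integrating over the support \<open>[x - e, x + e]\<close> of the mollifier, rather than over that of \<open>w\<close>,
  makes the boundary terms of the integration by parts vanish with no condition on \<open>w\<close>.
\<close>

lemma integral_parts_compact:
  assumes w: "smooth1 w" and r: "smooth1 r" and rz: "\<And>x. e \<le> \<bar>x\<bar> \<Longrightarrow> r x = 0" and e: "0 < e"
  shows "integral {x - e..x + e} (\<lambda>t. w t * (deriv ^^ a) r (x - t))
       = integral {x - e..x + e} (\<lambda>t. (deriv ^^ a) w t * r (x - t))"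
proof -
  have bd: "(deriv ^^ a) r e = 0 \<and> (deriv ^^ a) r (- e) = 0" for a
  proof -
    have z: "(deriv ^^ a) r y = 0" if "y \<in> - {-e..e}" for y
      by (rule higher_deriv_zero_open[OF _ _ that]) (use rz in \<open>auto intro!: open_Compl\<close>)
    have "((deriv ^^ a) r \<longlongrightarrow> (deriv ^^ a) r e) (at_right e)" "((deriv ^^ a) r \<longlongrightarrow> (deriv ^^ a) r (-e)) (at_left (-e))"
      using smooth1_continuous[OF r, of UNIV a] 
      by (auto simp: continuous_on_def intro: filterlim_mono[OF _ order_refl at_le[OF subset_UNIV]])
    moreover have "((deriv ^^ a) r \<longlongrightarrow> 0) (at_right e)" "((deriv ^^ a) r \<longlongrightarrow> 0) (at_left (-e))"
      by (rule Lim_transform_eventually[OF tendsto_const], auto simp: eventually_at_filter z)+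
    ultimately show ?thesis by (metis tendsto_unique trivial_limit_at_left_real trivial_limit_at_right_real)
  qed
  show ?thesis using w
  proof (induction a arbitrary: w)
    case (Suc a)
    let ?F = "\<lambda>t. w t * (deriv ^^ a) r (x - t)"
    have d: "(?F has_real_derivative (deriv w t * (deriv ^^ a) r (x - t) - w t * (deriv ^^ Suc a) r (x - t))) (at t)" for t
    proof -
      have "((\<lambda>t. x - t) has_real_derivative -1) (at t)" by (auto intro!: derivative_eq_intros)
      from DERIV_mult[OF smooth1_has_deriv0[OF Suc.prems] DERIV_chain2[OF smooth1_has_deriv[OF r, of a] this]]
      show ?thesis by (simp add: algebra_simps)
    qed
    have "((\<lambda>t. deriv w t * (deriv ^^ a) r (x - t) - w t * (deriv ^^ Suc a) r (x - t)) has_integral (?F (x + e) - ?F (x - e))) {x - e..x + e}"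
      by (rule fundamental_theorem_of_calculus)
        (use e d in \<open>auto simp: has_real_derivative_iff_has_vector_derivative[symmetric] intro: has_field_derivative_at_within\<close>)
    then have "integral {x - e..x + e} (\<lambda>t. deriv w t * (deriv ^^ a) r (x - t) - w t * (deriv ^^ Suc a) r (x - t)) = 0"
      using bd[of a] by (auto dest!: integral_unique)
    moreover have c: "continuous_on {x - e..x + e} (\<lambda>t. (deriv ^^ a) r (x - t))" for a
      by (rule continuous_on_compose2[OF smooth1_continuous[OF r, of UNIV]]) (auto intro!: continuous_intros)
    moreover have "continuous_on {x - e..x + e} (deriv w)" "continuous_on {x - e..x + e} w"
      using smooth1_continuous[OF Suc.prems, of _ 1] smooth1_continuous[OF Suc.prems, of _ 0] by auto
    ultimately have "integral {x - e..x + e} (\<lambda>t. w t * (deriv ^^ Suc a) r (x - t))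
        = integral {x - e..x + e} (\<lambda>t. deriv w t * (deriv ^^ a) r (x - t))"
      using c[of a] c[of "Suc a"]
      by (subst (asm) Henstock_Kurzweil_Integration.integral_diff) 
         (auto intro!: integrable_continuous_real continuous_intros simp del: funpow.simps)
    also have "\<dots> = integral {x - e..x + e} (\<lambda>t. (deriv ^^ Suc a) w t * r (x - t))"
      using Suc.IH[OF smooth1_deriv[OF Suc.prems]] by (simp only: funpow_Suc_right comp_apply)
    finally show ?case .
  qed simp
qed

text \<open>
  Riemann sums of the convolution with a mollifier \<open>r\<close>: \<open>\<psi> j\<close> is the mesh width times the translate of
  \<open>r\<close> to the node \<open>t j\<close>. The nodes and the functions \<open>\<psi> j\<close> depend only on the bounds \<open>R\<close>, \<open>M\<close>, \<open>d\<close> and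
  \<open>m\<close>, not on \<open>w\<close>; this uniformity allows the remaining coordinates to enter as parameters later.
\<close>

lemma smooth1_approx:
  fixes R M d :: real
  assumes R: "0 < R" and M: "0 \<le> M" and d: "0 < d"
  obtains \<psi> :: "nat \<Rightarrow> real \<Rightarrow> real" and N :: nat and t :: "nat \<Rightarrow> real" where
    "\<And>j. smooth1 (\<psi> j)" "\<And>j x. j < N \<Longrightarrow> R + 1 < \<bar>x\<bar> \<Longrightarrow> \<psi> j x = 0"
    "\<forall>w a x. smooth1 w \<and> (\<forall>u. R < \<bar>u\<bar> \<longrightarrow> w u = 0) \<and>
       (\<forall>b u. b \<le> Suc m \<longrightarrow> \<bar>(deriv ^^ b) w u\<bar> \<le> M) \<and> a \<le> m \<longrightarrow>
       \<bar>(deriv ^^ a) w x - (\<Sum>j<N. w (t j) * (deriv ^^ a) (\<psi> j) x)\<bar> \<le> d"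
proof -
  define e where "e = min 1 (d / (2 * (M + 1)))"
  have e: "0 < e" "e \<le> 1" "e * M \<le> d / 2"
  proof -
    show "0 < e" "e \<le> 1" using d M by (auto simp: e_def)
    have "e * M \<le> (d / (2 * (M + 1))) * (M + 1)" using M d by (intro mult_mono) (auto simp: e_def)
    moreover have "(d / (2 * (M + 1))) * (M + 1) = d / 2" using M by (simp add: field_simps)
    ultimately show "e * M \<le> d / 2" by (simp only:)
  qed
  obtain r where r: "smooth1 r" "\<And>x. 0 \<le> r x" "\<And>x. e \<le> \<bar>x\<bar> \<Longrightarrow> r x = 0" "integral {-e..e} r = 1"
    using exists_mollifier[OF e(1)] by blast
  obtain B where B: "\<And>b x. b \<le> Suc m \<Longrightarrow> \<bar>(deriv ^^ b) r x\<bar> \<le> B"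
    using smooth1_deriv_bounded[OF r(1,3)] by blast
  have B0: "0 \<le> B" using B[of 0 0] by simp
  \<comment> \<open>bounds the derivative of \<open>u \<mapsto> w u * r\<^sup>(\<^sup>a\<^sup>) (x - u)\<close>, hence the Riemann sum error\<close>
  define L where "L = 2 * M * B"
  have L0: "0 \<le> L" using M B0 by (simp add: L_def)
  obtain N :: nat where N: "4 * R\<^sup>2 * L * 2 / d + 1 < real N" using reals_Archimedean2 by blast
  have N0: "0 < real N" using N R L0 d by (smt (verit) divide_nonneg_pos mult_nonneg_nonneg zero_le_power2)
  define h where "h = 2 * R / real N"
  have h: "0 < h" "real N * h = 2 * R" using R N0 by (auto simp: h_def)
  have hN: "real N * (h\<^sup>2 * L) \<le> d / 2"
  proof -
    have "4 * R\<^sup>2 * L * 2 / d \<le> real N" using N by simp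
    then have "4 * R\<^sup>2 * L * 2 \<le> real N * d" using d by (simp add: field_simps)
    moreover have "real N * (h\<^sup>2 * L) = 4 * R\<^sup>2 * L / real N"
      using N0 by (simp add: h_def power2_eq_square)
    moreover have "4 * R\<^sup>2 * L / real N \<le> d / 2" using calculation(1) N0 by (simp add: field_simps)
    ultimately show ?thesis by (simp only:)
  qed
  define t where "t j = - R + real j * h" for j
  define \<psi> where "\<psi> j x = h * r (x - t j)" for j x
  have \<psi>: "smooth1 (\<psi> j)" "(deriv ^^ a) (\<psi> j) x = h * (deriv ^^ a) r (x - t j)" for j a x
    using smooth1_translate[OF r(1), where c=h and b="t j"] unfolding \<psi>_def[abs_def] by auto
  show ?thesis
  proof (rule that[of \<psi> N t])
    show "smooth1 (\<psi> j)" for j by (rule \<psi>)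
    show "\<psi> j x = 0" if "j < N" "R + 1 < \<bar>x\<bar>" for j x
    proof -
      have "real j * h \<le> real N * h" using that h by (intro mult_right_mono) auto
      then have "\<bar>t j\<bar> \<le> R" using h by (simp add: t_def abs_le_iff)
      then show ?thesis using r(3)[of "x - t j"] e that by (simp add: \<psi>_def)
    qed
    show "\<forall>w a x. smooth1 w \<and> (\<forall>u. R < \<bar>u\<bar> \<longrightarrow> w u = 0) \<and>
       (\<forall>b u. b \<le> Suc m \<longrightarrow> \<bar>(deriv ^^ b) w u\<bar> \<le> M) \<and> a \<le> m \<longrightarrow>
       \<bar>(deriv ^^ a) w x - (\<Sum>j<N. w (t j) * (deriv ^^ a) (\<psi> j) x)\<bar> \<le> d"
    proof (intro allI impI)
      fix w a x
      assume H: "smooth1 w \<and> (\<forall>u. R < \<bar>u\<bar> \<longrightarrow> w u = 0) \<and>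
         (\<forall>b u. b \<le> Suc m \<longrightarrow> \<bar>(deriv ^^ b) w u\<bar> \<le> M) \<and> a \<le> m"
      have w: "smooth1 w" "\<And>u. R < \<bar>u\<bar> \<Longrightarrow> w u = 0"
        "\<And>b u. b \<le> Suc m \<Longrightarrow> \<bar>(deriv ^^ b) w u\<bar> \<le> M" and a: "a \<le> m"
        using H by blast+
      define G where "G u = w u * (deriv ^^ a) r (x - u)" for u
      define G' where "G' u = deriv w u * (deriv ^^ a) r (x - u) - w u * (deriv ^^ Suc a) r (x - u)" for u
      have dG: "(G has_real_derivative G' u) (at u)" for u
      proof -
        have "((\<lambda>u. x - u) has_real_derivative -1) (at u)" by (auto intro!: derivative_eq_intros)
        from DERIV_mult[OF smooth1_has_deriv0[OF w(1)] DERIV_chain2[OF smooth1_has_deriv[OF r(1), of a] this]]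
        show ?thesis unfolding G_def G'_def by (simp add: algebra_simps)
      qed
      have G'L: "\<bar>G' u\<bar> \<le> L" for u
      proof -
        have "\<bar>G' u\<bar> \<le> \<bar>deriv w u\<bar> * \<bar>(deriv ^^ a) r (x - u)\<bar> + \<bar>w u\<bar> * \<bar>(deriv ^^ Suc a) r (x - u)\<bar>"
          unfolding G'_def by (metis abs_mult abs_triangle_ineq4)
        also have "\<dots> \<le> M * B + M * B"
          using w(3)[of 0 u] w(3)[of 1 u] B[of a "x - u"] B[of "Suc a" "x - u"] a M
          by (intro add_mono mult_mono) auto
        finally show ?thesis unfolding L_def by linarith
      qed
      have RS: "\<bar>integral {-R..R} G - (\<Sum>j<N. w (t j) * (deriv ^^ a) (\<psi> j) x)\<bar> \<le> d / 2"
      proof -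
        have "\<bar>integral {-R..-R + real N * h} G - (\<Sum>j<N. h * G (-R + real j * h))\<bar> \<le> real N * (h\<^sup>2 * L)"
          by (rule riemann_sum_error[OF dG G'L]) (use h in simp)
        then show ?thesis using hN h(2) unfolding G_def \<psi>(2) t_def by (simp add: mult_ac)
      qed
      have rz: "(deriv ^^ a) r y = 0" if "\<bar>y\<bar> > e" for y
        by (rule higher_deriv_zero_open[of "- {-e..e}"]) (use r(3) that in \<open>auto intro!: open_Compl\<close>)
      have "integral {-R..R} G = integral UNIV G"
      proof -
        have "(\<lambda>u. if u \<in> {-R..R} then G u else 0) = G" by (rule ext) (use w(2) in \<open>auto simp: G_def\<close>)
        then show ?thesis using integral_restrict_UNIV[of "{-R..R}" G] by simp
      qed
      also have "\<dots> = integral {x - e..x + e} G"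
      proof -
        have "(\<lambda>u. if u \<in> {x-e..x+e} then G u else 0) = G" by (rule ext) (use rz in \<open>auto simp: G_def\<close>)
        then show ?thesis using integral_restrict_UNIV[of "{x-e..x+e}" G] by simp
      qed
      also have "\<dots> = integral {x - e..x + e} (\<lambda>u. (deriv ^^ a) w u * r (x - u))"
        unfolding G_def by (rule integral_parts_compact[OF w(1) r(1) r(3) e(1)])
      finally have I: "integral {-R..R} G = \<dots>" .
      have cr: "continuous_on {x - e..x + e} (\<lambda>u. r (x - u))"
      proof -
        have "continuous_on {x - e..x + e} (\<lambda>u. x - u)" by (intro continuous_intros)
        from continuous_on_compose2[OF smooth1_continuous[OF r(1), of UNIV 0] this] show ?thesis by simp
      qed
      have cw: "continuous_on {x - e..x + e} ((deriv ^^ a) w)" by (rule smooth1_continuous[OF w(1)])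
      have r1: "integral {x - e..x + e} (\<lambda>u. r (x - u)) = 1"
      proof -
        have "(r has_integral 1) {-e..e}"
          using r(4) smooth1_continuous[OF r(1), of "{-e..e}" 0] by (metis funpow_0 integrable_continuous_real integrable_integral)
        from has_integral_affinity[where m="-1" and c=x, of r 1 "-e" e] this
        have "((\<lambda>u. r (x - u)) has_integral 1) ((\<lambda>u. x - u) ` {-e..e})"
          by (simp add: algebra_simps)
        moreover have "(\<lambda>u. x - u) ` {-e..e} = {x - e..x + e}" by simp
        ultimately show ?thesis by (simp add: integral_unique)
      qed
      have "\<bar>(deriv ^^ a) w x - integral {x - e..x + e} (\<lambda>u. (deriv ^^ a) w u * r (x - u))\<bar> \<le> e * M"
      proof -
        have i1: "(\<lambda>u. c * r (x - u)) integrable_on {x - e..x + e}" for c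
          by (intro integrable_continuous_real continuous_on_mult continuous_on_const cr)
        have i2: "(\<lambda>u. (deriv ^^ a) w u * r (x - u)) integrable_on {x - e..x + e}"
          by (intro integrable_continuous_real continuous_on_mult cw cr)
        have eq: "(deriv ^^ a) w x - integral {x - e..x + e} (\<lambda>u. (deriv ^^ a) w u * r (x - u))
           = integral {x - e..x + e} (\<lambda>u. (deriv ^^ a) w x * r (x - u) - (deriv ^^ a) w u * r (x - u))"
          using r1 Henstock_Kurzweil_Integration.integral_diff[OF i1 i2] by simp
        have "norm (integral {x - e..x + e} (\<lambda>u. (deriv ^^ a) w x * r (x - u) - (deriv ^^ a) w u * r (x - u)))
           \<le> integral {x - e..x + e} (\<lambda>u. (e * M) * r (x - u))"
        proof (rule integral_norm_bound_integral)
          fix u assume u: "u \<in> {x - e..x + e}"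
          have "norm ((deriv ^^ a) w x - (deriv ^^ a) w u) \<le> M * norm (x - u)"
            by (rule field_differentiable_bound[of UNIV _ "(deriv ^^ Suc a) w"])
               (use smooth1_has_deriv[OF w(1), of a] w(3)[of "Suc a"] a in auto)
          also have "\<dots> \<le> M * e" using u M by (intro mult_left_mono) auto
          finally have "\<bar>(deriv ^^ a) w x - (deriv ^^ a) w u\<bar> * r (x - u) \<le> (e * M) * r (x - u)"
            using r(2) by (intro mult_right_mono) (auto simp: mult.commute)
          then show "norm ((deriv ^^ a) w x * r (x - u) - (deriv ^^ a) w u * r (x - u)) \<le> (e * M) * r (x - u)"
            using r(2)[of "x - u"] unfolding left_diff_distrib[symmetric] real_norm_def abs_mult by simp
        qed (rule Henstock_Kurzweil_Integration.integrable_diff[OF i1 i2] i1)+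
        also have "\<dots> = e * M" using r1 by simp
        finally show ?thesis unfolding eq real_norm_def .
      qed
      then show "\<bar>(deriv ^^ a) w x - (\<Sum>j<N. w (t j) * (deriv ^^ a) (\<psi> j) x)\<bar> \<le> d"
        using RS I e(3) by linarith
    qed
  qed
qed

section \<open>Seminorms and their topologies\<close>

lemma seminorm_onD:
  assumes "seminorm_on V p" "subspace V"
  shows "p 0 = 0" "f \<in> V \<Longrightarrow> 0 \<le> p f" "f \<in> V \<Longrightarrow> g \<in> V \<Longrightarrow> p (f + g) \<le> p f + p g"
    "f \<in> V \<Longrightarrow> p (c *\<^sub>R f) = \<bar>c\<bar> * p f" "f \<in> V \<Longrightarrow> p (- f) = p f"
    "f \<in> V \<Longrightarrow> g \<in> V \<Longrightarrow> p (f - g) = p (g - f)"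
    "f \<in> V \<Longrightarrow> g \<in> V \<Longrightarrow> h \<in> V \<Longrightarrow> p (f - h) \<le> p (f - g) + p (g - h)"
proof -
  have V: "0 \<in> V" using assms(2) by (rule subspace_0)
  have sc: "p (c *\<^sub>R f) = \<bar>c\<bar> * p f" if "f \<in> V" for f c using assms(1) that by (auto simp: seminorm_on_def)
  show "p 0 = 0" using sc[OF V, of 0] by simp
  show neg: "f \<in> V \<Longrightarrow> p (- f) = p f" for f using sc[of f "-1"] by simp
  show tri: "f \<in> V \<Longrightarrow> g \<in> V \<Longrightarrow> p (f + g) \<le> p f + p g" for f g using assms(1) by (auto simp: seminorm_on_def)
  show "f \<in> V \<Longrightarrow> g \<in> V \<Longrightarrow> p (f - g) = p (g - f)"
    using neg[of "g - f"] assms(2) by (simp add: subspace_diff)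
  show "f \<in> V \<Longrightarrow> g \<in> V \<Longrightarrow> h \<in> V \<Longrightarrow> p (f - h) \<le> p (f - g) + p (g - h)"
    using tri[of "f - g" "g - h"] assms(2) by (simp add: subspace_diff)
qed (use assms in \<open>auto simp: seminorm_on_def\<close>)

lemma linear_map_onD:
  assumes "linear_map_on V F" "subspace V"
  shows "F 0 = 0" "f \<in> V \<Longrightarrow> g \<in> V \<Longrightarrow> F (f + g) = F f + F g"
    "f \<in> V \<Longrightarrow> F (c *\<^sub>R f) = c *\<^sub>R F f" "f \<in> V \<Longrightarrow> g \<in> V \<Longrightarrow> F (f - g) = F f - F g"
proof -
  have V: "0 \<in> V" using assms(2) by (rule subspace_0)
  have sc: "F (c *\<^sub>R f) = c *\<^sub>R F f" if "f \<in> V" for f c using assms(1) that by (auto simp: linear_map_on_def)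
  show "F 0 = 0" using sc[OF V, of 0] by simp
  show "f \<in> V \<Longrightarrow> F (c *\<^sub>R f) = c *\<^sub>R F f" by (rule sc)
  show add: "F (f + g) = F f + F g" if "f \<in> V" "g \<in> V" for f g using assms(1) that by (auto simp: linear_map_on_def)
  show "f \<in> V \<Longrightarrow> g \<in> V \<Longrightarrow> F (f - g) = F f - F g"
    using add[of f "- g"] sc[of g "-1"] subspace_neg[OF assms(2)] by simp
qed

lemma linear_map_on_sum:
  assumes "linear_map_on V F" "subspace V" "\<And>i. i \<in> I \<Longrightarrow> f i \<in> V"
  shows "F (\<Sum>i\<in>I. c i *\<^sub>R f i) = (\<Sum>i\<in>I. c i *\<^sub>R F (f i))"
  using assms(3)
proof (induction I rule: infinite_finite_induct)
  case (insert x I)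
  have "(\<Sum>i\<in>I. c i *\<^sub>R f i) \<in> V" "c x *\<^sub>R f x \<in> V" 
    using assms(2) insert by (auto intro!: subspace_sum subspace_scale)
  then show ?case using insert linear_map_onD[OF assms(1,2)] by simp
qed (use linear_map_onD[OF assms(1,2)] in auto)

lemma seminorm_on_sqrt_bilinear:
  assumes V: "subspace V"
    and sym: "\<And>f g. f \<in> V \<Longrightarrow> g \<in> V \<Longrightarrow> B f g = B g f"
    and add: "\<And>f g h. f \<in> V \<Longrightarrow> g \<in> V \<Longrightarrow> h \<in> V \<Longrightarrow> B (f + g) h = B f h + B g h"
    and scale: "\<And>f g c. f \<in> V \<Longrightarrow> g \<in> V \<Longrightarrow> B (c *\<^sub>R f) g = c * B f g"
    and pos: "\<And>f. f \<in> V \<Longrightarrow> (0::real) \<le> B f f"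
  shows "seminorm_on V (\<lambda>f. sqrt (B f f))"
proof -
  have exp: "B (f + t *\<^sub>R g) (f + t *\<^sub>R g) = B f f + 2 * t * B f g + t\<^sup>2 * B g g" if f: "f \<in> V" and g: "g \<in> V" for f g t
  proof -
    have t: "t *\<^sub>R g \<in> V" "f + t *\<^sub>R g \<in> V" using V f g by (auto intro!: subspace_add subspace_scale)
    have "B (f + t *\<^sub>R g) (f + t *\<^sub>R g) = B (f + t *\<^sub>R g) f + t * B (f + t *\<^sub>R g) g"
      by (simp only: add[OF f t(1) t(2)] scale[OF g t(2)] sym[OF t(2) f] sym[OF t(2) g])
    also have "\<dots> = B f f + 2 * t * B f g + t\<^sup>2 * B g g"
      by (simp add: add[OF f t(1) f] scale[OF g f] sym[OF g f] add[OF f t(1) g] scale[OF g g] power2_eq_square algebra_simps)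
    finally show ?thesis .
  qed
  have CS: "(B f g)\<^sup>2 \<le> B f f * B g g" if "f \<in> V" "g \<in> V" for f g
  proof -
    have q: "0 \<le> B f f + 2 * t * B f g + t\<^sup>2 * B g g" for t
      using exp[OF that, of t] pos[of "f + t *\<^sub>R g"] V that by (simp add: subspace_add subspace_scale)
    show ?thesis
    proof (cases "B g g = 0")
      case True
      have "B f g = 0"
      proof (rule ccontr)
        assume nz: "B f g \<noteq> 0"
        have "2 * (- (B f f + 1) / (2 * B f g)) * B f g = - (B f f + 1)" using nz by simp
        then show False using q[of "- (B f f + 1) / (2 * B f g)"] True by simp
      qed
      then show ?thesis using True by simp
    next
      case False
      then have "0 < B g g" using pos that by (simp add: less_le)
      moreover have "0 \<le> B f f - (B f g)\<^sup>2 / B g g"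
        using q[of "- B f g / B g g"] False by (simp add: field_simps power2_eq_square)
      ultimately show ?thesis by (simp add: field_simps)
    qed
  qed
  show ?thesis unfolding seminorm_on_def
  proof (intro conjI ballI allI)
    fix f g assume fg: "f \<in> V" "g \<in> V"
    have "B f g \<le> sqrt (B f f) * sqrt (B g g)"
      using real_le_rsqrt[OF CS[OF fg]] by (simp add: real_sqrt_mult)
    then have "B (f + g) (f + g) \<le> (sqrt (B f f) + sqrt (B g g))\<^sup>2"
      using exp[OF fg, of 1] pos fg by (simp add: power2_sum)
    then show "sqrt (B (f + g) (f + g)) \<le> sqrt (B f f) + sqrt (B g g)"
      using pos fg by (intro real_le_lsqrt) auto
  next
    fix f c assume f: "f \<in> V"
    have "B (c *\<^sub>R f) (c *\<^sub>R f) = c\<^sup>2 * B f f"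
      using exp[of 0 f c] f V add[of 0 0 f] add[of 0 0 0] by (simp add: subspace_0)
    then show "sqrt (B (c *\<^sub>R f) (c *\<^sub>R f)) = \<bar>c\<bar> * sqrt (B f f)"
      by (simp add: real_sqrt_mult)
  qed (simp add: pos)
qed

text \<open>
  Norms of weighted Sobolev type: \<open>A J\<close> plays the role of the differential operator with index \<open>J\<close>
  and \<open>w\<close> that of the weight.
\<close>

lemma l2_seminorm_on:
  fixes A :: "'j \<Rightarrow> ('a \<Rightarrow> real) \<Rightarrow> 'a \<Rightarrow> real"
  assumes V: "subspace V"
    and add: "\<And>J f g. J \<in> I \<Longrightarrow> f \<in> V \<Longrightarrow> g \<in> V \<Longrightarrow> A J (f + g) = A J f + A J g"
    and scale: "\<And>J f c. J \<in> I \<Longrightarrow> f \<in> V \<Longrightarrow> A J (c *\<^sub>R f) = c *\<^sub>R A J f"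
    and int: "\<And>J f g. J \<in> I \<Longrightarrow> f \<in> V \<Longrightarrow> g \<in> V \<Longrightarrow> integrable M (\<lambda>x. A J f x * A J g x * w x)"
    and w: "\<And>x. x \<in> space M \<Longrightarrow> 0 \<le> w x"
  shows "seminorm_on V (\<lambda>f. sqrt (\<Sum>J\<in>I. LINT x|M. (A J f x)\<^sup>2 * w x))"
proof -
  have "seminorm_on V (\<lambda>f. sqrt (\<Sum>J\<in>I. LINT x|M. A J f x * A J f x * w x))"
  proof (rule seminorm_on_sqrt_bilinear[where B="\<lambda>f g. \<Sum>J\<in>I. LINT x|M. A J f x * A J g x * w x", OF V])
    fix f g h assume V: "f \<in> V" "g \<in> V" "h \<in> V"
    have "(LINT x|M. A J (f + g) x * A J h x * w x) = (LINT x|M. A J f x * A J h x * w x) + (LINT x|M. A J g x * A J h x * w x)"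
      if "J \<in> I" for J
    proof -
      have "(LINT x|M. A J (f + g) x * A J h x * w x) = (LINT x|M. A J f x * A J h x * w x + A J g x * A J h x * w x)"
        using that V by (simp add: add distrib_right)
      also have "\<dots> = (LINT x|M. A J f x * A J h x * w x) + (LINT x|M. A J g x * A J h x * w x)"
        by (rule Bochner_Integration.integral_add) (use that V int in auto)
      finally show ?thesis .
    qed
    then show "(\<Sum>J\<in>I. LINT x|M. A J (f + g) x * A J h x * w x)
       = (\<Sum>J\<in>I. LINT x|M. A J f x * A J h x * w x) + (\<Sum>J\<in>I. LINT x|M. A J g x * A J h x * w x)"
      by (simp add: sum.distrib)
  next
    fix f g c assume V: "f \<in> V" "g \<in> V"
    have "(LINT x|M. A J (c *\<^sub>R f) x * A J g x * w x) = c * (LINT x|M. A J f x * A J g x * w x)"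
      if "J \<in> I" for J
    proof -
      have "A J (c *\<^sub>R f) = (\<lambda>x. c * A J f x)" unfolding scale[OF that V(1)] by (simp add: scaleR_fun_def)
      then show ?thesis by (simp add: mult.assoc)
    qed
    then show "(\<Sum>J\<in>I. LINT x|M. A J (c *\<^sub>R f) x * A J g x * w x) = c * (\<Sum>J\<in>I. LINT x|M. A J f x * A J g x * w x)"
      by (simp add: sum_distrib_left)
  qed (auto simp: mult_ac w intro!: sum_nonneg Bochner_Integration.integral_nonneg)
  then show ?thesis by (simp add: power2_eq_square)
qed

lemma l2_norm_mono:
  assumes "finite I'" "I \<subseteq> I'" and w: "\<And>x. x \<in> space M \<Longrightarrow> 0 \<le> w x \<and> w x \<le> w' x"
    and int: "\<And>J. J \<in> I' \<Longrightarrow> integrable M (\<lambda>x. (A J x)\<^sup>2 * w' x)"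
  shows "sqrt (\<Sum>J\<in>I. LINT x|M. (A J x)\<^sup>2 * (w x :: real)) \<le> sqrt (\<Sum>J\<in>I'. LINT x|M. (A J x)\<^sup>2 * w' x)"
proof -
  have "(\<Sum>J\<in>I. LINT x|M. (A J x)\<^sup>2 * w x) \<le> (\<Sum>J\<in>I. LINT x|M. (A J x)\<^sup>2 * w' x)"
    using assms(2) by (intro sum_mono integral_mono' int) (use w in \<open>force intro: mult_left_mono order_trans\<close>)+
  also have "\<dots> \<le> (\<Sum>J\<in>I'. LINT x|M. (A J x)\<^sup>2 * w' x)"
    using assms(1,2) by (intro sum_mono2 Bochner_Integration.integral_nonneg) (use w in \<open>force intro: mult_nonneg_nonneg order_trans\<close>)+
  finally show ?thesis by simp
qed

lemma openin_seminorm_ball: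
  assumes "p \<in> N" "f \<in> V" "0 < e"
  shows "openin (seminorm_topology V N) {g \<in> V. p (g - f) < e}"
  unfolding seminorm_topology_def by (rule topology_generated_by_Basis) (use assms in blast)

lemma topspace_seminorm_topology_nonempty:
  assumes "subspace V" "N \<noteq> {}" "\<And>p. p \<in> N \<Longrightarrow> seminorm_on V p"
  shows "topspace (seminorm_topology V N) = V"
proof -
  obtain p where "p \<in> N" using assms(2) by blast
  then show ?thesis using topspace_seminorm_topology seminorm_onD(1) assms by blast
qed

text \<open>
  For a directed family, every neighbourhood contains a ball of a single seminorm of the family.
\<close>

lemma openin_seminorm_topology_ball:
  assumes V: "subspace V" and N: "N \<noteq> {}" "\<And>p. p \<in> N \<Longrightarrow> seminorm_on V p"
    and dir: "\<And>p q. p \<in> N \<Longrightarrow> q \<in> N \<Longrightarrow> \<exists>r\<in>N. \<forall>f\<in>V. p f \<le> r f \<and> q f \<le> r f"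
    and U: "openin (seminorm_topology V N) U" "f \<in> U"
  obtains p e where "p \<in> N" "0 < e" "{g \<in> V. p (g - f) < e} \<subseteq> U"
proof -
  have fV: "f \<in> V" using U openin_subset topspace_seminorm_topology_nonempty[OF V N] by blast
  have "generate_topology_on {{g \<in> V. p (g - f) < e} | p f e. p \<in> N \<and> f \<in> V \<and> 0 < e} U"
    using U(1) by (simp add: seminorm_topology_def openin_topology_generated_by_iff)
  then have "\<exists>p\<in>N. \<exists>e>0. {g \<in> V. p (g - f) < e} \<subseteq> U" using U(2)
  proof induction
    case (Int a b)
    then obtain p e q d where *: "p \<in> N" "0 < e" "{g \<in> V. p (g - f) < e} \<subseteq> a" "q \<in> N" "0 < d" "{g \<in> V. q (g - f) < d} \<subseteq> b"
      by blast
    obtain r where r: "r \<in> N" "\<forall>f\<in>V. p f \<le> r f \<and> q f \<le> r f" using dir * by blast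
    have "{g \<in> V. r (g - f) < min e d} \<subseteq> a \<inter> b"
    proof
      fix g assume g: "g \<in> {g \<in> V. r (g - f) < min e d}"
      have "g - f \<in> V" using g fV V by (simp add: subspace_diff)
      then have "p (g - f) < e" "q (g - f) < d" using g r(2) by force+
      then show "g \<in> a \<inter> b" using g * by blast
    qed
    then show ?case using r * by (metis min_less_iff_conj)
  next
    case (Basis s)
    then obtain p f0 e where s: "s = {g \<in> V. p (g - f0) < e}" "p \<in> N" "f0 \<in> V" "0 < e" by blast
    have "{g \<in> V. p (g - f) < e - p (f - f0)} \<subseteq> s"
    proof
      fix g assume g: "g \<in> {g \<in> V. p (g - f) < e - p (f - f0)}"
      then have "p (g - f0) \<le> p (g - f) + p (f - f0)"
        using seminorm_onD(7)[OF N(2)[OF s(2)] V] s fV by blast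
      then show "g \<in> s" using g s by auto
    qed
    moreover have "0 < e - p (f - f0)" using Basis s by auto
    ultimately show ?case using s(2) by blast
  qed blast+
  then show ?thesis using that by blast
qed

lemma linear_continuous_of_bound:
  assumes V: "subspace V" and p: "p \<in> N" "seminorm_on V p" and F: "linear_map_on V F"
    and bd: "\<And>f. f \<in> V \<Longrightarrow> \<bar>F f\<bar> \<le> C * p f"
  shows "continuous_map (seminorm_topology V N) euclideanreal F"
proof -
  have top: "topspace (seminorm_topology V N) = V"
    using topspace_seminorm_topology p V seminorm_onD(1) by blast
  show ?thesis unfolding continuous_map_def top
  proof (intro conjI allI impI)
    fix U :: "real set" assume "openin euclidean U"
    then have U: "open U" by simp
    show "openin (seminorm_topology V N) {f \<in> V. F f \<in> U}"
    proof (subst openin_subopen, intro ballI)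
      fix f assume f: "f \<in> {f \<in> V. F f \<in> U}"
      then obtain e where e: "0 < e" "\<And>y. \<bar>y - F f\<bar> < e \<Longrightarrow> y \<in> U"
        using U unfolding open_dist dist_real_def by blast
      let ?T = "{g \<in> V. p (g - f) < e / (\<bar>C\<bar> + 1)}"
      have "openin (seminorm_topology V N) ?T" using p f e by (intro openin_seminorm_ball) auto
      moreover have "f \<in> ?T" using f e seminorm_onD(1)[OF p(2) V] by simp
      moreover have "?T \<subseteq> {f \<in> V. F f \<in> U}"
      proof
        fix g assume g: "g \<in> ?T"
        have gf: "g - f \<in> V" using g f V by (simp add: subspace_diff)
        have "\<bar>F g - F f\<bar> = \<bar>F (g - f)\<bar>" using linear_map_onD(4)[OF F V] g f by simp
        also have "\<dots> \<le> C * p (g - f)" by (rule bd[OF gf])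
        also have "\<dots> \<le> (\<bar>C\<bar> + 1) * p (g - f)"
          using seminorm_onD(2)[OF p(2) V gf] by (intro mult_right_mono) auto
        also have "\<dots> < e" using g by (simp add: field_simps)
        finally show "g \<in> {f \<in> V. F f \<in> U}" using e g by auto
      qed
      ultimately show "\<exists>T. openin (seminorm_topology V N) T \<and> f \<in> T \<and> T \<subseteq> {f \<in> V. F f \<in> U}" by blast
    qed
  qed auto
qed

lemma linear_bound_of_continuous:
  assumes V: "subspace V" and N: "N \<noteq> {}" "\<And>p. p \<in> N \<Longrightarrow> seminorm_on V p"
    and dir: "\<And>p q. p \<in> N \<Longrightarrow> q \<in> N \<Longrightarrow> \<exists>r\<in>N. \<forall>f\<in>V. p f \<le> r f \<and> q f \<le> r f"
    and F: "linear_map_on V F" and cont: "continuous_map (seminorm_topology V N) euclideanreal F"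
  obtains p C where "p \<in> N" "0 \<le> C" "\<And>f. f \<in> V \<Longrightarrow> \<bar>F f\<bar> \<le> C * p f"
proof -
  have top: "topspace (seminorm_topology V N) = V" by (rule topspace_seminorm_topology_nonempty[OF V N])
  have o1: "openin (seminorm_topology V N) {f \<in> V. F f \<in> {-1<..<1}}"
    using openin_continuous_map_preimage[OF cont, of "{-1<..<1}"] top by simp
  have z1: "0 \<in> {f \<in> V. F f \<in> {-1<..<1}}"
    using V linear_map_onD(1)[OF F V] by (simp add: subspace_0)
  obtain p e where p: "p \<in> N" "0 < e" "{g \<in> V. p (g - 0) < e} \<subseteq> {f \<in> V. F f \<in> {-1<..<1}}"
    by (rule openin_seminorm_topology_ball[OF V N dir o1 z1])
  have "\<bar>F f\<bar> \<le> 2 / e * p f" if f: "f \<in> V" for f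
  proof -
    have pf: "0 \<le> p f" by (rule seminorm_onD(2)[OF N(2)[OF p(1)] V f])
    \<comment> \<open>\<open>d > 0\<close> allows for \<open>p f = 0\<close> in the rescaling of \<open>f\<close>\<close>
    have "\<bar>F f\<bar> \<le> 2 / e * (p f + d)" if d: "0 < d" for d
    proof -
      define c where "c = e / (2 * (p f + d))"
      have c: "0 < c" using p pf d by (simp add: c_def)
      have "p (c *\<^sub>R f) = c * p f" using seminorm_onD(4)[OF N(2)[OF p(1)] V f] c by simp
      also have "\<dots> \<le> c * (p f + d)" using c d by simp
      also have "\<dots> = e / 2"
      proof -
        have "e / (2 * s) * s = e / 2" if "0 < s" for s using that by simp
        from this[of "p f + d"] show ?thesis using pf d unfolding c_def by linarith
      qed
      also have "\<dots> < e" using p by simp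
      finally have "p (c *\<^sub>R f - 0) < e" by simp
      moreover have "c *\<^sub>R f \<in> V" using f V by (simp add: subspace_scale)
      ultimately have "\<bar>F (c *\<^sub>R f)\<bar> < 1" using p(3) by force
      then have "c * \<bar>F f\<bar> < 1" using linear_map_onD(3)[OF F V f] c by (simp add: abs_mult)
      then have "\<bar>F f\<bar> \<le> 1 / c" using c by (simp add: field_simps)
      moreover have "2 / e * (p f + d) = 1 / c" using p(2) by (simp add: c_def)
      ultimately show ?thesis by simp
    qed
    note this[of "x * (e / 2)" for x]
    moreover have "2 / e * (p f + x * (e / 2)) = 2 / e * p f + x" for x
      using p(2) by (simp add: distrib_left)
    ultimately have "\<bar>F f\<bar> \<le> 2 / e * p f + x" if "0 < x" for x
      using that p(2) by simp
    then show ?thesis by (rule field_le_epsilon)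
  qed
  then show ?thesis using that[of p "2 / e"] p by simp
qed

lemma linear_continuous_seminorm_topologies:
  assumes V: "subspace V" and N: "N \<noteq> {}" "\<And>p. p \<in> N \<Longrightarrow> seminorm_on V p"
    and dir: "\<And>p q. p \<in> N \<Longrightarrow> q \<in> N \<Longrightarrow> \<exists>r\<in>N. \<forall>f\<in>V. p f \<le> r f \<and> q f \<le> r f"
    and V': "subspace V'" and N': "N' \<noteq> {}" "\<And>p. p \<in> N' \<Longrightarrow> seminorm_on V' p"
    and \<phi>: "linear_map_on V \<phi>" "\<And>f. f \<in> V \<Longrightarrow> \<phi> f \<in> V'"
    and cont: "\<And>p. p \<in> N' \<Longrightarrow> continuous_map (seminorm_topology V N) euclideanreal (\<lambda>g. p (\<phi> g))"
  shows "continuous_map (seminorm_topology V N) (seminorm_topology V' N') \<phi>"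
proof -
  have top: "topspace (seminorm_topology V N) = V" by (rule topspace_seminorm_topology_nonempty[OF V N])
  have top': "topspace (seminorm_topology V' N') = V'" by (rule topspace_seminorm_topology_nonempty[OF V' N'])
  show ?thesis
    unfolding seminorm_topology_def[of V' N']
  proof (rule continuous_on_generated_topo)
    show "\<phi> ` topspace (seminorm_topology V N) \<subseteq> \<Union>{{g \<in> V'. p (g - f) < e} | p f e. p \<in> N' \<and> f \<in> V' \<and> 0 < e}"
      using \<phi>(2) top top' unfolding seminorm_topology_def[of V' N'] topology_generated_by_topspace by auto
    fix U assume "U \<in> {{g \<in> V'. p (g - f) < e} | p f e. p \<in> N' \<and> f \<in> V' \<and> 0 < e}"
    then obtain p f e where U: "U = {g \<in> V'. p (g - f) < e}" "p \<in> N'" "f \<in> V'" "0 < e" by blast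
    show "openin (seminorm_topology V N) (\<phi> -` U \<inter> topspace (seminorm_topology V N))"
    proof (subst openin_subopen, intro ballI)
      fix g assume "g \<in> \<phi> -` U \<inter> topspace (seminorm_topology V N)"
      then have g: "g \<in> V" "\<phi> g \<in> V'" "p (\<phi> g - f) < e" using top U by auto
      have o1: "openin (seminorm_topology V N) {h \<in> V. p (\<phi> h) \<in> {..< e - p (\<phi> g - f)}}"
        using openin_continuous_map_preimage[OF cont[OF U(2)], of "{..< e - p (\<phi> g - f)}"] top by simp
      have z1: "0 \<in> {h \<in> V. p (\<phi> h) \<in> {..< e - p (\<phi> g - f)}}"
        using V g linear_map_onD(1)[OF \<phi>(1) V] seminorm_onD(1)[OF N'(2)[OF U(2)] V'] by (simp add: subspace_0)
      obtain q d where q: "q \<in> N" "0 < d" "{h \<in> V. q (h - 0) < d} \<subseteq> {h \<in> V. p (\<phi> h) \<in> {..< e - p (\<phi> g - f)}}"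
        by (rule openin_seminorm_topology_ball[OF V N dir o1 z1])
      let ?T = "{h \<in> V. q (h - g) < d}"
      have "?T \<subseteq> \<phi> -` U \<inter> topspace (seminorm_topology V N)"
      proof
        fix h assume h: "h \<in> ?T"
        have hg: "h - g \<in> V" using h g V by (simp add: subspace_diff)
        then have "p (\<phi> (h - g)) < e - p (\<phi> g - f)" using h q(3) by force
        then have "p (\<phi> h - \<phi> g) < e - p (\<phi> g - f)" using linear_map_onD(4)[OF \<phi>(1) V] h g by simp
        moreover have "p (\<phi> h - f) \<le> p (\<phi> h - \<phi> g) + p (\<phi> g - f)"
          using seminorm_onD(7)[OF N'(2)[OF U(2)] V'] \<phi>(2) h g U by blast
        ultimately show "h \<in> \<phi> -` U \<inter> topspace (seminorm_topology V N)" using h \<phi>(2) U top by auto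
      qed
      moreover have "openin (seminorm_topology V N) ?T" using q g by (intro openin_seminorm_ball) auto
      moreover have "g \<in> ?T" using g q seminorm_onD(1)[OF N(2)[OF q(1)] V] by simp
      ultimately show "\<exists>T. openin (seminorm_topology V N) T \<and> g \<in> T \<and> T \<subseteq> \<phi> -` U \<inter> topspace (seminorm_topology V N)" by blast
    qed
  qed
qed

text \<open>
  A linear functional on a dense subspace, bounded by \<open>C\<close> times the seminorm, extends with the same
  bound. It is given by its graph \<open>G\<close>; the bound makes the graph single-valued.
\<close>

lemma linear_extension_by_density:
  fixes G :: "('v::real_vector \<times> real) set"
  assumes V: "subspace V" and p: "seminorm_on V p" and G: "subspace G"
    and GV: "\<And>v r. (v, r) \<in> G \<Longrightarrow> v \<in> V" and bd: "\<And>v r. (v, r) \<in> G \<Longrightarrow> \<bar>r\<bar> \<le> C * p v"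
    and C: "0 \<le> C" and dense: "\<And>f e. f \<in> V \<Longrightarrow> 0 < e \<Longrightarrow> \<exists>(v, r)\<in>G. p (f - v) < e"
  obtains F where "linear_map_on V F" "\<And>f. f \<in> V \<Longrightarrow> \<bar>F f\<bar> \<le> C * p f" "\<And>v r. (v, r) \<in> G \<Longrightarrow> F v = r"
    "\<And>f. f \<notin> V \<Longrightarrow> F f = 0"
proof -
  note pD = seminorm_onD[OF p V]
  have G0: "(0, 0) \<in> G" using subspace_0[OF G] by (simp add: zero_prod_def)
  have Gdiff: "(v - v', r - r') \<in> G" if "(v, r) \<in> G" "(v', r') \<in> G" for v r v' r'
    using subspace_diff[OF G that] by simp
  have Gadd: "(v + v', r + r') \<in> G" if "(v, r) \<in> G" "(v', r') \<in> G" for v r v' r'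
    using subspace_add[OF G that] by simp
  have Gsc: "(c *\<^sub>R v, c * r) \<in> G" if "(v, r) \<in> G" for c v r
    using subspace_scale[OF G that, of c] by simp
  \<comment> \<open>the value at \<open>f\<close> has to lie within \<open>C * p (f - v)\<close> of each \<open>s\<close> with \<open>(v, s) \<in> G\<close>\<close>
  define ok where "ok f r \<longleftrightarrow> (\<forall>(v, s)\<in>G. \<bar>r - s\<bar> \<le> C * p (f - v))" for f r
  have cross: "\<bar>s - s'\<bar> \<le> C * p (f - v) + C * p (f - v')" if "f \<in> V" "(v, s) \<in> G" "(v', s') \<in> G" for f v s v' s'
  proof -
    have "\<bar>s - s'\<bar> \<le> C * p (v - v')" using bd[OF Gdiff] that by blast
    also have "\<dots> \<le> C * (p (v - f) + p (f - v'))" using pD(7)[of v f v'] GV that C by (intro mult_left_mono) auto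
    finally show ?thesis using pD(6)[of v f] GV that by (simp add: distrib_left)
  qed
  have ex: "\<exists>r. ok f r" if f: "f \<in> V" for f
  proof -
    \<comment> \<open>the intervals that have to contain the value meet pairwise, so that the supremum of the left
      end points lies in all of them\<close>
    let ?L = "(\<lambda>(v, s). s - C * p (f - v)) ` G"
    have "s - C * p (f - v) \<le> s' + C * p (f - v')" if "(v, s) \<in> G" "(v', s') \<in> G" for v s v' s'
      using cross[OF f that] by linarith
    then have up: "y \<le> s' + C * p (f - v')" if "y \<in> ?L" "(v', s') \<in> G" for y v' s'
      using that by auto
    have bdd: "bdd_above ?L" using up[OF _ G0] by (meson bdd_aboveI)
    have "\<bar>Sup ?L - s\<bar> \<le> C * p (f - v)" if "(v, s) \<in> G" for v s
    proof -
      have "s - C * p (f - v) \<le> Sup ?L" by (rule cSup_upper) (use that bdd in force)+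
      moreover have "Sup ?L \<le> s + C * p (f - v)" by (rule cSup_least) (use G0 up[OF _ that] in auto)
      ultimately show ?thesis by linarith
    qed
    then show ?thesis unfolding ok_def by blast
  qed
  have closeness: "\<bar>r - r'\<bar> \<le> 0" if "f \<in> V" and "\<And>e. 0 < e \<Longrightarrow> \<bar>r - r'\<bar> \<le> K * e" for f r r' and K :: real
  proof (rule field_le_epsilon)
    fix e :: real assume e: "0 < e"
    have "K * (e / (\<bar>K\<bar> + 1)) \<le> (\<bar>K\<bar> + 1) * (e / (\<bar>K\<bar> + 1))" using e by (intro mult_right_mono) auto
    also have "\<dots> = e" by simp
    finally show "\<bar>r - r'\<bar> \<le> 0 + e" using that(2)[of "e / (\<bar>K\<bar> + 1)"] e by simp
  qed
  have uniq: "r = r'" if "f \<in> V" "ok f r" "ok f r'" for f r r'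
  proof -
    have "\<bar>r - r'\<bar> \<le> (2 * C) * e" if e: "0 < e" for e
    proof -
      obtain v s where v: "(v, s) \<in> G" "p (f - v) < e" using dense[OF \<open>f \<in> V\<close> e] by blast
      have "\<bar>r - s\<bar> \<le> C * p (f - v)" "\<bar>r' - s\<bar> \<le> C * p (f - v)"
        using v \<open>ok f r\<close> \<open>ok f r'\<close> unfolding ok_def by blast+
      moreover have "C * p (f - v) \<le> C * e" using v C by (intro mult_left_mono) auto
      ultimately show ?thesis by linarith
    qed
    from closeness[OF \<open>f \<in> V\<close> this] show ?thesis by simp
  qed
  define F where "F f = (if f \<in> V then THE r. ok f r else 0)" for f
  have Fok: "ok f (F f)" if "f \<in> V" for f
  proof -
    have "\<exists>!r. ok f r" using ex uniq that by blast
    from theI'[OF this] that show ?thesis by (simp add: F_def)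
  qed
  have Feq: "F f = r" if "f \<in> V" "ok f r" for f r using uniq Fok that by blast
  show ?thesis
  proof (rule that[of F])
    show "linear_map_on V F" unfolding linear_map_on_def
    proof (intro conjI ballI allI)
      fix f g assume fg: "f \<in> V" "g \<in> V"
      then have fgV: "f + g \<in> V" using V by (simp add: subspace_add)
      have "\<bar>F (f + g) - (F f + F g)\<bar> \<le> (4 * C) * e" if e: "0 < e" for e
      proof -
        obtain v s where v: "(v, s) \<in> G" "p (f - v) < e" using dense[OF fg(1) e] by blast
        obtain v' s' where v': "(v', s') \<in> G" "p (g - v') < e" using dense[OF fg(2) e] by blast
        have vV: "v \<in> V" "v' \<in> V" using v v' GV by auto
        have "p ((f - v) + (g - v')) \<le> p (f - v) + p (g - v')"
          using fg vV V by (intro pD(3)) (auto simp: subspace_diff)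
        then have "p ((f + g) - (v + v')) < 2 * e" using v v' by (simp add: algebra_simps)
        then have "C * p ((f + g) - (v + v')) \<le> C * (2 * e)" using C by (intro mult_left_mono) auto
        moreover have "\<bar>F (f + g) - (s + s')\<bar> \<le> C * p ((f + g) - (v + v'))"
          using Fok[OF fgV] Gadd[OF v(1) v'(1)] unfolding ok_def by blast
        moreover have "\<bar>F f - s\<bar> \<le> C * p (f - v)" "\<bar>F g - s'\<bar> \<le> C * p (g - v')"
          using Fok fg v v' unfolding ok_def by blast+
        moreover have "C * p (f - v) \<le> C * e" "C * p (g - v') \<le> C * e" using v v' C by (auto intro!: mult_left_mono)
        ultimately show ?thesis by linarith
      qed
      from closeness[OF fg(1) this] show "F (f + g) = F f + F g" by simp
    next
      fix f c assume f: "f \<in> V"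
      show "F (c *\<^sub>R f) = c *\<^sub>R F f"
      proof (cases "c = 0")
        case True
        have "ok 0 0" using bd pD(5) GV by (auto simp: ok_def)
        then show ?thesis using True Feq[of 0] V by (simp add: subspace_0)
      next
        case False
        have "ok (c *\<^sub>R f) (c * F f)" unfolding ok_def
        proof (intro ballI, safe)
          fix v s assume v: "(v, s) \<in> G"
          have "\<bar>F f - s / c\<bar> \<le> C * p (f - v /\<^sub>R c)"
            using Fok[OF f] Gsc[OF v, of "1 / c"] unfolding ok_def by (auto simp: divide_inverse mult.commute)
          then have "\<bar>c\<bar> * \<bar>F f - s / c\<bar> \<le> \<bar>c\<bar> * (C * p (f - v /\<^sub>R c))" by (intro mult_left_mono) auto
          moreover have "\<bar>c\<bar> * \<bar>F f - s / c\<bar> = \<bar>c * F f - s\<bar>" using False by (simp add: abs_mult[symmetric] field_simps)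
          moreover have "\<bar>c\<bar> * p (f - v /\<^sub>R c) = p (c *\<^sub>R f - v)"
            using pD(4)[of "f - v /\<^sub>R c" c] f GV[OF v] V False by (simp add: subspace_diff subspace_scale scaleR_diff_right)
          ultimately show "\<bar>c * F f - s\<bar> \<le> C * p (c *\<^sub>R f - v)" by (simp add: mult_ac)
        qed
        then show ?thesis using Feq[of "c *\<^sub>R f"] V f by (simp add: subspace_scale)
      qed
    qed
    show "\<bar>F f\<bar> \<le> C * p f" if "f \<in> V" for f using Fok[OF that] G0 unfolding ok_def by force
    show "F v = r" if "(v, r) \<in> G" for v r
    proof (rule Feq)
      show "v \<in> V" using GV that .
      show "ok v r" unfolding ok_def using bd[OF Gdiff[OF that]] by blast
    qed
    show "F f = 0" if "f \<notin> V" for f using that by (simp add: F_def)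
  qed
qed

section \<open>Test functions and their Sobolev norms\<close>

lemma smoothD:
  assumes "smooth f"
  shows "continuous_on UNIV (foldr pdiff js f)"
    and "(\<lambda>t. foldr pdiff js f (x + t *\<^sub>R axis j 1)) field_differentiable at 0"
  using assms unfolding smooth_def by blast+

lemma pdiff_add:
  assumes "(\<lambda>t. f (x + t *\<^sub>R axis j 1)) field_differentiable at 0"
    "(\<lambda>t. g (x + t *\<^sub>R axis j 1)) field_differentiable at 0"
  shows "pdiff j (f + g) x = pdiff j f x + pdiff j g x"
  using deriv_add[OF assms] by (simp add: pdiff_def)

lemma pdiff_scale:
  assumes "(\<lambda>t. f (x + t *\<^sub>R axis j 1)) field_differentiable at 0"
  shows "pdiff j (c *\<^sub>R f) x = c * pdiff j f x"
  using deriv_cmult[OF assms, of c] by (simp add: pdiff_def scaleR_fun_def)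

lemma foldr_pdiff_add:
  assumes "smooth f" "smooth g"
  shows "foldr pdiff js (f + g) = foldr pdiff js f + foldr pdiff js g"
proof (induction js)
  case (Cons j js)
  show ?case
  proof
    fix x
    show "foldr pdiff (j # js) (f + g) x = (foldr pdiff (j # js) f + foldr pdiff (j # js) g) x"
      using pdiff_add[OF smoothD(2)[OF assms(1), of js x j] smoothD(2)[OF assms(2), of js x j]]
      by (simp only: foldr.simps comp_apply Cons.IH plus_fun_apply[of "pdiff j (foldr pdiff js f)"])
  qed
qed simp

lemma foldr_pdiff_scale:
  assumes "smooth f"
  shows "foldr pdiff js (c *\<^sub>R f) = c *\<^sub>R foldr pdiff js f"
proof (induction js)
  case (Cons j js)
  show ?case
  proof
    fix x
    show "foldr pdiff (j # js) (c *\<^sub>R f) x = (c *\<^sub>R foldr pdiff (j # js) f) x"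
      using pdiff_scale[OF smoothD(2)[OF assms(1), of js x j], of c]
      by (simp only: foldr.simps comp_apply Cons.IH scaleR_fun_def[of c "pdiff j (foldr pdiff js f)"] real_scaleR_def)
  qed
qed simp

lemma smooth_add: "smooth f \<Longrightarrow> smooth g \<Longrightarrow> smooth (f + g)"
  unfolding smooth_def[of "f + g"] foldr_pdiff_add
  by (auto simp: foldr_pdiff_add plus_fun_def smoothD intro!: continuous_intros field_differentiable_add)

lemma smooth_scale:
  assumes "smooth f"
  shows "smooth (c *\<^sub>R f)"
  unfolding smooth_def[of "c *\<^sub>R f"] foldr_pdiff_scale[OF assms]
  unfolding scaleR_fun_def
  using smoothD[OF assms] by (auto intro!: continuous_intros field_differentiable_mult)

lemma foldr_pdiff_const: "foldr pdiff js (\<lambda>_. c) = (\<lambda>_. if js = [] then c else 0)"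
  by (induction js) (auto simp: pdiff_def fun_eq_iff)

lemma smooth_const: "smooth (\<lambda>_. c)"
  by (simp add: smooth_def foldr_pdiff_const)

text \<open>
  Derivatives vanish off every closed set off which the function vanishes.
\<close>

lemma foldr_pdiff_eq_0:
  fixes f :: "real^'d \<Rightarrow> real"
  assumes "closed K" "\<And>x. x \<notin> K \<Longrightarrow> f x = 0" "x \<notin> K"
  shows "foldr pdiff js f x = 0"
  using assms(3)
proof (induction js arbitrary: x)
  case (Cons j js)
  have "open ((\<lambda>t. x + t *\<^sub>R axis j (1::real)) -` (- K))"
    by (rule continuous_open_vimage) (use assms(1) in \<open>auto intro!: continuous_intros\<close>)
  then have "eventually (\<lambda>t. t \<in> (\<lambda>t. x + t *\<^sub>R axis j (1::real)) -` (- K)) (nhds 0)"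
    by (rule eventually_nhds_in_open) (use Cons in simp)
  then have "eventually (\<lambda>t. foldr pdiff js f (x + t *\<^sub>R axis j 1) = 0) (nhds 0)"
    by eventually_elim (use Cons in simp)
  then have "deriv (\<lambda>t. foldr pdiff js f (x + t *\<^sub>R axis j 1)) 0 = deriv (\<lambda>_. 0) 0"
    by (rule deriv_cong_ev) simp
  then show ?case by (simp add: pdiff_def[of j "foldr pdiff js f" x])
qed (use assms in simp)

lemma test_funD: "f \<in> test_fun \<Longrightarrow> smooth f" "f \<in> test_fun \<Longrightarrow> compact (closure {x. f x \<noteq> 0})"
  by (auto simp: test_fun_def)

lemma test_funI: "smooth f \<Longrightarrow> compact K \<Longrightarrow> (\<And>x. x \<notin> K \<Longrightarrow> f x = 0) \<Longrightarrow> f \<in> test_fun"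
  unfolding test_fun_def
  by (auto intro!: compact_closure[THEN iffD2] elim!: bounded_subset[OF compact_imp_bounded])

lemma test_fun_support: "f \<in> test_fun \<Longrightarrow> x \<notin> closure {x. f x \<noteq> 0} \<Longrightarrow> foldr pdiff js f x = 0"
  by (rule foldr_pdiff_eq_0[of "closure {x. f x \<noteq> 0}"]) (use closure_subset[of "{x. f x \<noteq> 0}"] in blast)+

lemma subspace_test_fun: "subspace test_fun"
  unfolding subspace_def
proof (intro conjI ballI allI)
  show "0 \<in> test_fun" by (rule test_funI[of _ "{}"]) (auto simp: zero_fun_def smooth_const)
  fix f :: "real^'d \<Rightarrow> real" assume f: "f \<in> test_fun"
  have z: "h x = 0" if "x \<notin> closure {x. h x \<noteq> 0}" for h :: "real^'d \<Rightarrow> real" and x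
    using that closure_subset[of "{x. h x \<noteq> 0}"] by blast
  show "c *\<^sub>R f \<in> test_fun" for c
  proof (rule test_funI[OF smooth_scale[OF test_funD(1)[OF f]] test_funD(2)[OF f]])
    show "(c *\<^sub>R f) x = 0" if "x \<notin> closure {x. f x \<noteq> 0}" for x
      unfolding scaleR_fun_def z[OF that] by simp
  qed
  fix g :: "real^'d \<Rightarrow> real" assume g: "g \<in> test_fun"
  show "f + g \<in> test_fun"
  proof (rule test_funI[OF smooth_add compact_Un[OF test_funD(2)[OF f] test_funD(2)[OF g]]])
    show "(f + g) x = 0" if "x \<notin> closure {x. f x \<noteq> 0} \<union> closure {x. g x \<noteq> 0}" for x
      using z[of x f] z[of x g] that unfolding plus_fun_apply by simp
  qed (use f g test_funD in auto)
qed

lemma weightsD: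
  assumes "\<tau> \<in> weights"
  shows "smooth (snd \<tau>)" "1 \<le> snd \<tau> x" "continuous_on UNIV (snd \<tau>)"
  using assms smoothD(1)[of "snd \<tau>" "[]"] by (auto simp: weights_def)

lemma integrable_test_fun_derivs:
  assumes f: "f \<in> test_fun" and g: "g \<in> test_fun" and \<tau>: "\<tau> \<in> weights"
  shows "integrable lborel (\<lambda>x. foldr pdiff js f x * foldr pdiff js' g x * snd \<tau> x)"
proof -
  let ?K = "closure {x. f x \<noteq> 0}"
  have "integrable lborel (\<lambda>x. indicator ?K x *\<^sub>R (foldr pdiff js f x * foldr pdiff js' g x * snd \<tau> x))"
    by (intro borel_integrable_compact test_funD(2)[OF f] continuous_intros)
       (auto intro: continuous_on_subset[OF smoothD(1)] continuous_on_subset[OF weightsD(3)] test_funD f g \<tau>)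
  moreover have "(\<lambda>x. indicator ?K x *\<^sub>R (foldr pdiff js f x * foldr pdiff js' g x * snd \<tau> x)) = (\<lambda>x. foldr pdiff js f x * foldr pdiff js' g x * snd \<tau> x)"
  proof
    fix x
    show "indicator ?K x *\<^sub>R (foldr pdiff js f x * foldr pdiff js' g x * snd \<tau> x) = foldr pdiff js f x * foldr pdiff js' g x * snd \<tau> x"
      using test_fun_support[OF f, of x js] by (cases "x \<in> ?K") auto
  qed
  ultimately show ?thesis by (simp only:)
qed

lemma finite_words: "finite {js :: 'd::finite list. length js \<le> l}"
  using finite_lists_length_le[of "UNIV :: 'd set" l] by simp

lemma seminorm_sobolev_norm:
  assumes "\<tau> \<in> weights"
  shows "seminorm_on test_fun (sobolev_norm \<tau>)"
proof -
  have "seminorm_on test_fun (\<lambda>f. sqrt (\<Sum>js\<in>{js. length js \<le> fst \<tau>}. LINT x|lborel. (foldr pdiff js f x)\<^sup>2 * snd \<tau> x))"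
    by (rule l2_seminorm_on[where A="foldr pdiff", OF subspace_test_fun])
       (use assms weightsD(2)[OF assms] in \<open>auto simp: foldr_pdiff_add foldr_pdiff_scale test_funD integrable_test_fun_derivs intro: order_trans[of 0 1]\<close>)
  then show ?thesis by (simp add: sobolev_norm_def[abs_def])
qed

text \<open>
  An upper bound of two weights, for the order in which the Sobolev norms are monotone.
\<close>

definition weight_join :: "nat \<times> (real^'d \<Rightarrow> real) \<Rightarrow> nat \<times> (real^'d \<Rightarrow> real) \<Rightarrow> nat \<times> (real^'d \<Rightarrow> real)" where
  "weight_join \<tau> \<sigma> = (max (fst \<tau>) (fst \<sigma>), snd \<tau> + snd \<sigma>)"

lemma weight_join:
  assumes "\<tau> \<in> weights" "\<sigma> \<in> weights"
  shows "weight_join \<tau> \<sigma> \<in> weights" 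
    "fst \<tau> \<le> fst (weight_join \<tau> \<sigma>)" "fst \<sigma> \<le> fst (weight_join \<tau> \<sigma>)"
    "snd \<tau> x \<le> snd (weight_join \<tau> \<sigma>) x" "snd \<sigma> x \<le> snd (weight_join \<tau> \<sigma>) x"
proof -
  have *: "1 \<le> snd \<tau> x" "1 \<le> snd \<sigma> x" for x using weightsD(2)[OF assms(1)] weightsD(2)[OF assms(2)] by auto
  show "snd \<tau> x \<le> snd (weight_join \<tau> \<sigma>) x" "snd \<sigma> x \<le> snd (weight_join \<tau> \<sigma>) x"
    using *[of x] by (auto simp: weight_join_def)
  have "1 \<le> snd \<tau> x + snd \<sigma> x" for x using *[of x] by linarith
  then show "weight_join \<tau> \<sigma> \<in> weights"
    using assms by (auto simp: weight_join_def weights_def smooth_add)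
qed (auto simp: weight_join_def)

lemma weights_nonempty: "(0, \<lambda>_. 1) \<in> weights"
  by (simp add: weights_def smooth_const)

lemma sobolev_norm_mono:
  assumes "\<tau> \<in> weights" "\<sigma> \<in> weights" "fst \<tau> \<le> fst \<sigma>" "\<And>x. snd \<tau> x \<le> snd \<sigma> x" "f \<in> test_fun"
  shows "sobolev_norm \<tau> f \<le> sobolev_norm \<sigma> f"
  unfolding sobolev_norm_def
  by (rule l2_norm_mono)
     (use assms finite_words weightsD(2)[OF assms(1)] integrable_test_fun_derivs[OF assms(5,5,2)] in
       \<open>auto simp: power2_eq_square intro: order_trans[of 0 1]\<close>)

lemma sobolev_directed:
  assumes "p \<in> sobolev_norm ` weights" "q \<in> sobolev_norm ` weights"
  shows "\<exists>r\<in>sobolev_norm ` weights. \<forall>f\<in>test_fun. p f \<le> r f \<and> q f \<le> r f"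
proof -
  obtain \<tau> \<sigma> where *: "\<tau> \<in> weights" "\<sigma> \<in> weights" "p = sobolev_norm \<tau>" "q = sobolev_norm \<sigma>" using assms by auto
  show ?thesis
    by (rule bexI[of _ "sobolev_norm (weight_join \<tau> \<sigma>)"])
       (use * weight_join[OF *(1,2)] sobolev_norm_mono[OF *(1) weight_join(1)[OF *(1,2)]] 
          sobolev_norm_mono[OF *(2) weight_join(1)[OF *(1,2)]] in auto)
qed

lemma distributionD:
  assumes "\<omega> \<in> distributions"
  shows "linear_map_on test_fun \<omega>" "continuous_map test_fun_topology euclideanreal \<omega>" "f \<notin> test_fun \<Longrightarrow> \<omega> f = 0"
  using assms by (auto simp: distributions_def topological_dual_def)

text \<open>
  Continuity of a distribution amounts to a bound by one Sobolev norm.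
\<close>

lemma distribution_bound:
  assumes "\<omega> \<in> distributions"
  obtains \<tau> C where "\<tau> \<in> weights" "0 \<le> C" "\<And>f. f \<in> test_fun \<Longrightarrow> \<bar>\<omega> f\<bar> \<le> C * sobolev_norm \<tau> f"
proof -
  obtain p C where "p \<in> sobolev_norm ` weights" "0 \<le> C" "\<And>f. f \<in> test_fun \<Longrightarrow> \<bar>\<omega> f\<bar> \<le> C * p f"
    by (rule linear_bound_of_continuous[OF subspace_test_fun _ _ sobolev_directed distributionD(1)[OF assms]
          distributionD(2)[OF assms, unfolded test_fun_topology_def]])
       (use seminorm_sobolev_norm weights_nonempty in blast)+
  then show ?thesis using that by auto
qed

lemma add_distributions:
  assumes "\<omega> \<in> distributions" "\<zeta> \<in> distributions"
  shows "\<omega> + \<zeta> \<in> distributions"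
  using assms by (auto simp: distributions_def topological_dual_def linear_map_on_def algebra_simps plus_fun_def intro!: continuous_map_add)

lemma zero_distributions: "0 \<in> distributions"
  by (auto simp: distributions_def topological_dual_def linear_map_on_def zero_fun_def)

section \<open>Calculus on powers of Euclidean space\<close>

text \<open>
  The iterated derivative along a word of scalar coordinates. A scalar coordinate is a pair \<open>(i, j)\<close>,
  standing for component \<open>j\<close> of the vector \<open>x i\<close>; the first letter of the word is applied last.
\<close>

definition wderiv :: "(nat \<times> 'd) list \<Rightarrow> ((nat \<Rightarrow> real^'d) \<Rightarrow> real) \<Rightarrow> (nat \<Rightarrow> real^'d) \<Rightarrow> real" where
  "wderiv ps = foldr (\<lambda>(i, j). pdiff_at i j) ps"

text \<open>
  The value of a point in a scalar coordinate.
\<close>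

definition crd :: "nat \<times> 'd \<Rightarrow> (nat \<Rightarrow> real^'d) \<Rightarrow> real" where
  "crd s x = x (fst s) $ snd s"

text \<open>
  The point obtained by setting scalar coordinate \<open>s\<close> to \<open>t\<close>. Partial derivatives become ordinary
  derivatives of \<open>t \<mapsto> f (put s t x)\<close> at \<open>t = crd s x\<close>.
\<close>

definition put :: "nat \<times> 'd \<Rightarrow> real \<Rightarrow> (nat \<Rightarrow> real^'d) \<Rightarrow> nat \<Rightarrow> real^'d" where
  "put s t x = x(fst s := x (fst s) + (t - x (fst s) $ snd s) *\<^sub>R axis (snd s) 1)"

abbreviation coords :: "nat \<Rightarrow> (nat \<times> 'd) set" where
  "coords k \<equiv> {..<k} \<times> UNIV"

lemma wderiv_simps [simp]:
  "wderiv [] f = f" "wderiv (s # ps) f = pdiff_at (fst s) (snd s) (wderiv ps f)"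
  by (simp_all add: wderiv_def split: prod.split)

lemma wderiv_append: "wderiv (ps @ qs) f = wderiv ps (wderiv qs f)"
  by (simp add: wderiv_def)

lemma mem_points: "x \<in> points k \<longleftrightarrow> (\<forall>i\<ge>k. x i = undefined)"
  by (auto simp: points_def PiE_def extensional_def)

lemma put_in_points:
  assumes "s \<in> coords k"
  shows "put s t x \<in> points k \<longleftrightarrow> x \<in> points k"
proof -
  have "put s t x i = x i" if "k \<le> i" for i using that assms by (auto simp: put_def)
  then show ?thesis by (simp add: mem_points)
qed

lemma crd_put: "crd s' (put s t x) = (if s' = s then t else crd s' x)"
  by (cases s; cases s') (auto simp: crd_def put_def axis_def)

lemma put_put [simp]: "put s u (put s t x) = put s u x"
  by (rule ext) (auto simp: put_def axis_def vec_eq_iff)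

lemma put_commute: "s \<noteq> s' \<Longrightarrow> put s u (put s' t x) = put s' t (put s u x)"
  by (cases s; cases s'; rule ext) (auto simp: put_def axis_def vec_eq_iff)

lemma put_crd [simp]: "put s (crd s x) x = x"
  by (simp add: put_def crd_def)

lemma pdiff_at_put: "pdiff_at i j f x = deriv (\<lambda>t. f (put (i, j) t x)) (crd (i, j) x)"
proof -
  have "x(i := x i + t *\<^sub>R axis j 1) = put (i, j) (t + crd (i, j) x) x" for t
    by (simp add: put_def crd_def)
  then show ?thesis
    unfolding pdiff_at_def deriv_def using DERIV_shift[of "\<lambda>t. f (put (i, j) t x)" _ 0 "crd (i, j) x"]
    by simp
qed

lemma smooth_pow_continuous:
  "smooth_pow k f \<Longrightarrow> set ps \<subseteq> coords k \<Longrightarrow> continuous_on (points k) (wderiv ps f)"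
  unfolding smooth_pow_def wderiv_def by (auto simp: lists_eq_set)

lemma smooth_pow_has_deriv:
  assumes "smooth_pow k f" "set ps \<subseteq> coords k" "s \<in> coords k" "x \<in> points k"
  shows "((\<lambda>t. wderiv ps f (put s t x)) has_real_derivative wderiv (s # ps) f (put s t x)) (at t)"
proof -
  obtain i j where s: "s = (i, j)" by (cases s)
  have y: "put s t x \<in> points k" using assms put_in_points by blast
  let ?F = "\<lambda>h. wderiv ps f ((put s t x)(i := put s t x i + h *\<^sub>R axis j 1))"
  have "?F field_differentiable at 0"
    using assms(1,2,3) y unfolding smooth_pow_def wderiv_def by (auto simp: lists_eq_set s)
  then have "(?F has_real_derivative wderiv (s # ps) f (put s t x)) (at 0)"
    by (simp add: DERIV_deriv_iff_field_differentiable s pdiff_at_def)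
  moreover have "?F = (\<lambda>h. wderiv ps f (put s (h + t) x))"
    by (rule ext, rule arg_cong[where f="wderiv ps f"]) (auto simp: put_def s axis_def vec_eq_iff)
  ultimately show ?thesis using DERIV_shift[of "\<lambda>t. wderiv ps f (put s t x)" _ 0 t] by simp
qed

lemma wderiv_off_points:
  assumes "\<And>x. x \<notin> points k \<Longrightarrow> f x = 0" "set ps \<subseteq> coords k" "x \<notin> points k"
  shows "wderiv ps f x = 0"
  using assms(2,3)
proof (induction ps arbitrary: x)
  case (Cons s ps)
  then have "(\<lambda>t. wderiv ps f (put s t x)) = (\<lambda>_. 0)" using put_in_points[of s k] by auto
  then show ?case by (cases s) (simp add: pdiff_at_put)
qed (simp add: assms(1))

text \<open>
  The main tool for computing derivatives: a family \<open>G\<close>, indexed by words, in which adding a letter is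
  differentiation, consists of the iterated derivatives of \<open>G []\<close>.
\<close>

lemma smooth_pow_iterated:
  assumes G0: "G [] = g"
    and der: "\<And>ps s x. set ps \<subseteq> coords k \<Longrightarrow> s \<in> coords k \<Longrightarrow> x \<in> points k \<Longrightarrow>
        ((\<lambda>t. G ps (put s t x)) has_real_derivative G (s # ps) x) (at (crd s x))"
    and zero: "\<And>ps x. set ps \<subseteq> coords k \<Longrightarrow> x \<notin> points k \<Longrightarrow> G ps x = 0"
    and cont: "\<And>ps. set ps \<subseteq> coords k \<Longrightarrow> continuous_on (points k) (G ps)"
  shows "set ps \<subseteq> coords k \<Longrightarrow> wderiv ps g = G ps" and "smooth_pow k g"
proof -
  show *: "wderiv ps g = G ps" if "set ps \<subseteq> coords k" for ps
    using that
  proof (induction ps)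
    case (Cons s ps)
    have "wderiv (s # ps) g x = G (s # ps) x" for x
    proof (cases "x \<in> points k")
      case True
      then show ?thesis using Cons DERIV_imp_deriv[OF der[of ps s x]] by (simp add: pdiff_at_put)
    next
      case False
      then have "(\<lambda>t. G ps (put s t x)) = (\<lambda>_. 0)" using Cons put_in_points[of s k] zero by auto
      then show ?thesis using Cons False by (cases s) (simp add: pdiff_at_put zero)
    qed
    then show ?case by blast
  qed (simp add: G0)
  have "(\<lambda>t. wderiv ps g (x(i := x i + t *\<^sub>R axis j 1))) field_differentiable at 0"
    if "set ps \<subseteq> coords k" "i < k" "x \<in> points k" for ps i j x
  proof -
    have "x(i := x i + t *\<^sub>R axis j 1) = put (i, j) (t + crd (i, j) x) x" for t
      by (simp add: put_def crd_def)
    moreover have "((\<lambda>t. wderiv ps g (put (i, j) t x)) has_real_derivative G ((i, j) # ps) x) (at (crd (i, j) x))"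
      using der[of ps "(i, j)" x] that * by simp
    ultimately show ?thesis 
      using DERIV_shift[of "\<lambda>t. wderiv ps g (put (i, j) t x)" _ 0 "crd (i, j) x"]
      by (auto simp: field_differentiable_def)
  qed
  moreover have "continuous_on (points k) (wderiv ps g)" if "set ps \<subseteq> coords k" for ps
    using * cont that by simp
  ultimately show "smooth_pow k g"
    unfolding smooth_pow_def wderiv_def[symmetric] by (auto simp: lists_eq_set)
qed

text \<open>
  Smooth functions on the \<open>k\<close>-th power, not necessarily symmetric, that vanish where some scalar
  coordinate \<open>s\<close> exceeds \<open>\<rho> s\<close> in absolute value. With \<open>\<rho>\<close> fixed this is a vector space, and compact
  supports need no further bookkeeping; the dependence of \<open>\<rho>\<close> on \<open>s\<close> permits enlarging the support
  in one coordinate at a time.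
\<close>

definition pow_fun :: "nat \<Rightarrow> (nat \<times> 'd \<Rightarrow> real) \<Rightarrow> ((nat \<Rightarrow> real^'d) \<Rightarrow> real) set" where
  "pow_fun k \<rho> = {f. smooth_pow k f \<and> (\<forall>x. x \<notin> points k \<longrightarrow> f x = 0) \<and>
     (\<forall>x. \<forall>s\<in>coords k. \<rho> s < \<bar>crd s x\<bar> \<longrightarrow> f x = 0)}"

text \<open>
  The compact box that carries the functions of \<open>pow_fun k \<rho>\<close>.
\<close>

definition pow_box :: "nat \<Rightarrow> (nat \<times> 'd \<Rightarrow> real) \<Rightarrow> (nat \<Rightarrow> real^'d) set" where
  "pow_box k \<rho> = PiE {..<k} (\<lambda>i. cbox (\<chi> j. - \<rho> (i, j)) (\<chi> j. \<rho> (i, j)))"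

lemma mem_pow_box: "x \<in> pow_box k \<rho> \<longleftrightarrow> x \<in> points k \<and> (\<forall>s\<in>coords k. \<bar>crd s x\<bar> \<le> \<rho> s)"
  by (auto simp: pow_box_def points_def PiE_iff mem_box_cart crd_def abs_le_iff minus_le_iff)

lemma compact_pow_box: "compact (pow_box k \<rho>)"
proof -
  let ?S = "\<lambda>i. if i < k then cbox (\<chi> j. - \<rho> (i, j)) (\<chi> j. \<rho> (i, j)) else {undefined}"
  have "PiE {..<k} C = PiE UNIV (\<lambda>i. if i < k then C i else {undefined})" for C :: "nat \<Rightarrow> (real^'a) set"
  proof (intro set_eqI iffI)
    fix x assume "x \<in> PiE UNIV (\<lambda>i. if i < k then C i else {undefined})"
    then have x: "x i \<in> (if i < k then C i else {undefined})" for i by (rule PiE_mem) simp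
    show "x \<in> PiE {..<k} C"
    proof (rule PiE_I)
      show "x i \<in> C i" if "i \<in> {..<k}" for i using x[of i] that by simp
      show "x i = undefined" if "i \<notin> {..<k}" for i using x[of i] that by simp
    qed
  next
    fix x assume x: "x \<in> PiE {..<k} C"
    show "x \<in> PiE UNIV (\<lambda>i. if i < k then C i else {undefined})"
    proof (rule PiE_I)
      show "x i \<in> (if i < k then C i else {undefined})" for i
        using PiE_mem[OF x, of i] PiE_arb[OF x, of i] by simp
    qed simp
  qed
  then have "pow_box k \<rho> = PiE UNIV ?S"
    by (simp add: pow_box_def)
  moreover have "compactin (product_topology (\<lambda>_. euclidean) UNIV) (PiE UNIV ?S)"
    by (auto simp: compactin_PiE compactin_euclidean_iff)
  ultimately show ?thesis by (simp add: euclidean_product_topology)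
qed

lemma pow_funD:
  assumes "f \<in> pow_fun k \<rho>"
  shows "smooth_pow k f" "x \<notin> points k \<Longrightarrow> f x = 0" "s \<in> coords k \<Longrightarrow> \<rho> s < \<bar>crd s x\<bar> \<Longrightarrow> f x = 0"
  using assms by (auto simp: pow_fun_def)

lemma pow_fun_wderiv_off_points:
  "f \<in> pow_fun k \<rho> \<Longrightarrow> set ps \<subseteq> coords k \<Longrightarrow> x \<notin> points k \<Longrightarrow> wderiv ps f x = 0"
  by (rule wderiv_off_points) (auto simp: pow_funD(2))

lemma pow_fun_wderiv_outside:
  assumes f: "f \<in> pow_fun k \<rho>" and s: "s \<in> coords k" "\<rho> s < \<bar>crd s x\<bar>"
  shows "wderiv ps f x = 0"
  using s(2)
proof (induction ps arbitrary: x)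
  case (Cons s' ps)
  have "open {t. \<rho> s < \<bar>t\<bar>}" by (intro open_Collect_less continuous_intros)
  then have "\<forall>\<^sub>F t in nhds (crd s x). \<rho> s < \<bar>t\<bar>" using eventually_nhds_in_open Cons.prems by fastforce
  then have "\<forall>\<^sub>F t in nhds (crd s' x). \<rho> s < \<bar>crd s (put s' t x)\<bar>"
    by (cases "s = s'") (simp_all add: crd_put Cons.prems)
  then have "\<forall>\<^sub>F t in nhds (crd s' x). wderiv ps f (put s' t x) = 0"
    by (rule eventually_mono) (rule Cons.IH)
  then have "deriv (\<lambda>t. wderiv ps f (put s' t x)) (crd s' x) = deriv (\<lambda>_. 0) (crd s' x)"
    by (rule deriv_cong_ev) simp
  then show ?case by (cases s') (simp add: pdiff_at_put)
qed (use pow_funD(3)[OF f s(1)] in simp)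

lemma pow_fun_wderiv_outside_box:
  "f \<in> pow_fun k \<rho> \<Longrightarrow> set ps \<subseteq> coords k \<Longrightarrow> x \<notin> pow_box k \<rho> \<Longrightarrow> wderiv ps f x = 0"
  using pow_fun_wderiv_off_points pow_fun_wderiv_outside unfolding mem_pow_box by (metis not_le)

lemma wderiv_add:
  fixes f g :: "(nat \<Rightarrow> real^'d) \<Rightarrow> real"
  assumes f: "f \<in> pow_fun k \<rho>" and g: "g \<in> pow_fun k \<rho>'"
  shows "set ps \<subseteq> coords k \<Longrightarrow> wderiv ps (f + g) = wderiv ps f + wderiv ps g" "smooth_pow k (f + g)"
proof -
  let ?G = "\<lambda>ps x. wderiv ps f x + wderiv ps g x"
  have G0: "?G [] = f + g" by (rule ext) simp
  have der: "((\<lambda>t. ?G ps (put s t x)) has_real_derivative ?G (s # ps) x) (at (crd s x))"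
    if *: "set ps \<subseteq> coords k" "s \<in> coords k" "x \<in> points k" for ps s x
    using DERIV_add[OF smooth_pow_has_deriv[OF pow_funD(1)[OF f] *, of "crd s x"] smooth_pow_has_deriv[OF pow_funD(1)[OF g] *, of "crd s x"]]
    by simp
  have zero: "?G ps x = 0" if "set ps \<subseteq> coords k" "x \<notin> points k" for ps x
    by (simp add: pow_fun_wderiv_off_points[OF f that] pow_fun_wderiv_off_points[OF g that])
  have cont: "continuous_on (points k) (?G ps)" if "set ps \<subseteq> coords k" for ps
    by (intro continuous_on_add smooth_pow_continuous pow_funD(1)[OF f] pow_funD(1)[OF g] that)
  show "smooth_pow k (f + g)" by (rule smooth_pow_iterated(2)[OF G0 der zero cont])
  show "wderiv ps (f + g) = wderiv ps f + wderiv ps g" if "set ps \<subseteq> coords k"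
  proof -
    have "wderiv ps (f + g) = ?G ps" by (rule smooth_pow_iterated(1)[OF G0 der zero cont that])
    then show ?thesis by (simp only: plus_fun_def)
  qed
qed

lemma wderiv_scale:
  fixes f :: "(nat \<Rightarrow> real^'d) \<Rightarrow> real"
  assumes f: "f \<in> pow_fun k \<rho>"
  shows "set ps \<subseteq> coords k \<Longrightarrow> wderiv ps (c *\<^sub>R f) = c *\<^sub>R wderiv ps f" "smooth_pow k (c *\<^sub>R f)"
proof -
  let ?G = "\<lambda>ps x. c * wderiv ps f x"
  have G0: "?G [] = c *\<^sub>R f" by (rule ext) (simp add: scaleR_fun_def)
  have der: "((\<lambda>t. ?G ps (put s t x)) has_real_derivative ?G (s # ps) x) (at (crd s x))"
    if *: "set ps \<subseteq> coords k" "s \<in> coords k" "x \<in> points k" for ps s x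
    using DERIV_cmult[OF smooth_pow_has_deriv[OF pow_funD(1)[OF f] *, of "crd s x"], of c] by simp
  have zero: "?G ps x = 0" if "set ps \<subseteq> coords k" "x \<notin> points k" for ps x
    by (simp add: pow_fun_wderiv_off_points[OF f that])
  have cont: "continuous_on (points k) (?G ps)" if "set ps \<subseteq> coords k" for ps
    by (intro continuous_on_mult continuous_on_const smooth_pow_continuous pow_funD(1)[OF f] that)
  show "smooth_pow k (c *\<^sub>R f)" by (rule smooth_pow_iterated(2)[OF G0 der zero cont])
  show "wderiv ps (c *\<^sub>R f) = c *\<^sub>R wderiv ps f" if "set ps \<subseteq> coords k"
  proof -
    have "wderiv ps (c *\<^sub>R f) = ?G ps" by (rule smooth_pow_iterated(1)[OF G0 der zero cont that])
    then show ?thesis by (simp only: scaleR_fun_def real_scaleR_def)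
  qed
qed

lemma smooth_pow_zero: "smooth_pow k 0"
  by (rule smooth_pow_iterated(2)[where G="\<lambda>_ _. 0"]) (auto simp: zero_fun_def)

lemma subspace_pow_fun: "subspace (pow_fun k \<rho>)"
  unfolding subspace_def
proof (intro conjI ballI allI)
  show "0 \<in> pow_fun k \<rho>" by (simp add: pow_fun_def smooth_pow_zero)
  fix f assume f: "f \<in> pow_fun k \<rho>"
  show "c *\<^sub>R f \<in> pow_fun k \<rho>" for c
    using wderiv_scale(2)[OF f] pow_funD[OF f] by (auto simp: pow_fun_def scaleR_fun_def)
  fix g assume g: "g \<in> pow_fun k \<rho>"
  show "f + g \<in> pow_fun k \<rho>"
    using wderiv_add(2)[OF f g] pow_funD[OF f] pow_funD[OF g] by (auto simp: pow_fun_def)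
qed

lemma pow_fun_mono:
  assumes f: "f \<in> pow_fun k \<rho>" and le: "\<And>s. s \<in> coords k \<Longrightarrow> \<rho> s \<le> \<rho>' s"
  shows "f \<in> pow_fun k \<rho>'"
proof -
  have "f x = 0" if "s \<in> coords k" "\<rho>' s < \<bar>crd s x\<bar>" for s x
    using pow_funD(3)[OF f that(1)] le[OF that(1)] that(2) by simp
  then show ?thesis using pow_funD(1,2)[OF f] unfolding pow_fun_def by blast
qed

lemma pow_fun_wderiv_bounded:
  assumes f: "f \<in> pow_fun k \<rho>" and ps: "set ps \<subseteq> coords k"
  obtains B where "\<And>x. \<bar>wderiv ps f x\<bar> \<le> B"
proof -
  have "continuous_on (pow_box k \<rho>) (wderiv ps f)"
    by (rule continuous_on_subset[OF smooth_pow_continuous[OF pow_funD(1)[OF f] ps]]) (auto simp: mem_pow_box)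
  then have "bounded (wderiv ps f ` pow_box k \<rho>)"
    by (intro compact_imp_bounded compact_continuous_image compact_pow_box)
  then obtain B where B: "\<And>x. x \<in> pow_box k \<rho> \<Longrightarrow> \<bar>wderiv ps f x\<bar> \<le> B" by (auto simp: bounded_iff)
  have "\<bar>wderiv ps f x\<bar> \<le> max B 0" for x
    using B[of x] pow_fun_wderiv_outside_box[OF f ps, of x] by (cases "x \<in> pow_box k \<rho>") auto
  then show ?thesis using that by blast
qed

text \<open>
  Symmetry of second derivatives: both mixed partial derivatives are limits of the same second
  difference quotient, by two applications of the mean value theorem in either order.
\<close>

lemma mixed_partials_commute:
  fixes F :: "real \<Rightarrow> real \<Rightarrow> real"
  assumes 1: "\<And>a b. ((\<lambda>a. F a b) has_real_derivative Fa a b) (at a)"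
    and 2: "\<And>a b. (F a has_real_derivative Fb a b) (at b)"
    and 12: "\<And>a b. (Fa a has_real_derivative Fab a b) (at b)"
    and 21: "\<And>a b. ((\<lambda>a. Fb a b) has_real_derivative Fba a b) (at a)"
    and c12: "continuous_on UNIV (\<lambda>p. Fab (fst p) (snd p))"
    and c21: "continuous_on UNIV (\<lambda>p. Fba (fst p) (snd p))"
  shows "Fab a0 b0 = Fba a0 b0"
proof -
  have ex: "\<exists>x y x' y'. Fab x y = Fba x' y' \<and> a0 < x \<and> x < a0 + h \<and> b0 < y \<and> y < b0 + h
      \<and> a0 < x' \<and> x' < a0 + h \<and> b0 < y' \<and> y' < b0 + h" if h: "0 < h" for h
  proof -
    let ?D = "F (a0 + h) (b0 + h) - F (a0 + h) b0 - (F a0 (b0 + h) - F a0 b0)"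
    have d1: "((\<lambda>a. F a (b0 + h) - F a b0) has_real_derivative Fa a (b0 + h) - Fa a b0) (at a)" for a
      by (rule DERIV_diff[OF 1 1])
    have d2: "((\<lambda>b. F (a0 + h) b - F a0 b) has_real_derivative Fb (a0 + h) b - Fb a0 b) (at b)" for b
      by (rule DERIV_diff[OF 2 2])
    obtain x where x: "a0 < x" "x < a0 + h" "?D = h * (Fa x (b0 + h) - Fa x b0)"
      using MVT2[of a0 "a0 + h" "\<lambda>a. F a (b0 + h) - F a b0" "\<lambda>a. Fa a (b0 + h) - Fa a b0"] h
      d1 by auto
    obtain y where y: "b0 < y" "y < b0 + h" "Fa x (b0 + h) - Fa x b0 = h * Fab x y"
      using MVT2[of b0 "b0 + h" "Fa x" "Fab x"] h 12 by auto
    obtain y' where y': "b0 < y'" "y' < b0 + h"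
      "(F (a0 + h) (b0 + h) - F a0 (b0 + h)) - (F (a0 + h) b0 - F a0 b0) = h * (Fb (a0 + h) y' - Fb a0 y')"
      using MVT2[of b0 "b0 + h" "\<lambda>b. F (a0 + h) b - F a0 b" "\<lambda>b. Fb (a0 + h) b - Fb a0 b"] h
      d2 by auto
    obtain x' where x': "a0 < x'" "x' < a0 + h" "Fb (a0 + h) y' - Fb a0 y' = h * Fba x' y'"
      using MVT2[of a0 "a0 + h" "\<lambda>a. Fb a y'" "\<lambda>a. Fba a y'"] h 21 by auto
    have "h * (h * Fab x y) = h * (h * Fba x' y')"
      using x(3) y(3) y'(3) x'(3) by (simp add: algebra_simps)
    then show ?thesis using x y x' y' h by auto
  qed
  have "\<bar>Fab a0 b0 - Fba a0 b0\<bar> \<le> 0 + e" if e: "0 < e" for e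
  proof -
    obtain d1 where d1: "0 < d1" "\<And>p. dist p (a0, b0) < d1 \<Longrightarrow> \<bar>Fab (fst p) (snd p) - Fab a0 b0\<bar> < e / 2"
      using c12[unfolded continuous_on_iff, rule_format, of "(a0, b0)" "e / 2"] e by (auto simp: dist_real_def)
    obtain d2 where d2: "0 < d2" "\<And>p. dist p (a0, b0) < d2 \<Longrightarrow> \<bar>Fba (fst p) (snd p) - Fba a0 b0\<bar> < e / 2"
      using c21[unfolded continuous_on_iff, rule_format, of "(a0, b0)" "e / 2"] e by (auto simp: dist_real_def)
    define h where "h = min d1 d2 / 2"
    have h: "0 < h" "2 * h \<le> d1" "2 * h \<le> d2" using d1 d2 by (auto simp: h_def)
    obtain x y x' y' where *: "Fab x y = Fba x' y'" "a0 < x" "x < a0 + h" "b0 < y" "y < b0 + h"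
      "a0 < x'" "x' < a0 + h" "b0 < y'" "y' < b0 + h" using ex[OF h(1)] by blast
    have near: "dist (u, v) (a0, b0) < 2 * h" if "a0 < u" "u < a0 + h" "b0 < v" "v < b0 + h" for u v
    proof -
      have "dist (u, v) (a0, b0) \<le> \<bar>u - a0\<bar> + \<bar>v - b0\<bar>"
        by (simp add: dist_Pair_Pair dist_real_def sqrt_sum_squares_le_sum_abs)
      then show ?thesis using that by linarith
    qed
    have "\<bar>Fab x y - Fab a0 b0\<bar> < e / 2" "\<bar>Fba x' y' - Fba a0 b0\<bar> < e / 2"
      using d1(2)[of "(x, y)"] d2(2)[of "(x', y')"] near[of x y] near[of x' y'] * h by auto
    then show ?thesis using *(1) by linarith
  qed
  then have "\<bar>Fab a0 b0 - Fba a0 b0\<bar> \<le> 0" by (rule field_le_epsilon)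
  then show ?thesis by simp
qed

lemma continuous_on_put:
  assumes "continuous_on A f" "continuous_on A g"
  shows "continuous_on A (\<lambda>p. put s (f p) (g p))"
proof (rule continuous_on_coordinatewise_then_product)
  fix i
  have c: "continuous_on A (\<lambda>p. g p i)" for i
    using continuous_on_compose2[OF continuous_on_product_coordinates assms(2)] by simp
  show "continuous_on A (\<lambda>p. put s (f p) (g p) i)"
    unfolding put_def by (cases "i = fst s") (auto intro!: continuous_intros c assms(1))
qed

lemma wderiv_swap:
  assumes f: "f \<in> pow_fun k \<rho>" and ps: "set ps \<subseteq> coords k" and s: "s \<in> coords k" "s' \<in> coords k"
  shows "wderiv (s # s' # ps) f = wderiv (s' # s # ps) f"
proof
  fix x
  show "wderiv (s # s' # ps) f x = wderiv (s' # s # ps) f x"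
  proof (cases "s = s' \<or> x \<notin> points k")
    case True
    then show ?thesis using pow_fun_wderiv_off_points[OF f, of "s # s' # ps" x]
       pow_fun_wderiv_off_points[OF f, of "s' # s # ps" x] ps s by auto
  next
    case False
    then have ne: "s \<noteq> s'" and x: "x \<in> points k" by auto
    let ?p = "\<lambda>a b. put s a (put s' b x)"
    have swap: "?p a b = put s' b (put s a x)" for a b by (rule put_commute[OF ne])
    have in_p: "?p a b \<in> points k" "put s a x \<in> points k" "put s' b x \<in> points k" for a b using x s by (simp_all add: put_in_points)
    have cont: "continuous_on UNIV (\<lambda>p. wderiv qs f (?p (fst p) (snd p)))" if "set qs \<subseteq> coords k" for qs
    proof -
      have c: "continuous_on UNIV (\<lambda>p. ?p (fst p) (snd p))"
        by (intro continuous_on_put continuous_on_fst continuous_on_snd continuous_on_id continuous_on_const)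
      show ?thesis
        by (rule continuous_on_compose2[OF smooth_pow_continuous[OF pow_funD(1)[OF f] that] c]) (use in_p in auto)
    qed
    note d = smooth_pow_has_deriv[OF pow_funD(1)[OF f]]
    have "wderiv (s' # s # ps) f (?p (crd s x) (crd s' x)) = wderiv (s # s' # ps) f (?p (crd s x) (crd s' x))"
    proof (rule mixed_partials_commute[where F="\<lambda>a b. wderiv ps f (?p a b)"
          and Fa="\<lambda>a b. wderiv (s # ps) f (?p a b)" and Fb="\<lambda>a b. wderiv (s' # ps) f (?p a b)"
          and Fab="\<lambda>a b. wderiv (s' # s # ps) f (?p a b)" and Fba="\<lambda>a b. wderiv (s # s' # ps) f (?p a b)"])
      fix a b
      show "((\<lambda>a. wderiv ps f (?p a b)) has_real_derivative wderiv (s # ps) f (?p a b)) (at a)"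
        by (rule d[OF ps s(1) in_p(3)])
      show "((\<lambda>b. wderiv ps f (?p a b)) has_real_derivative wderiv (s' # ps) f (?p a b)) (at b)"
        unfolding swap by (rule d[OF ps s(2) in_p(2)])
      show "((\<lambda>b. wderiv (s # ps) f (?p a b)) has_real_derivative wderiv (s' # s # ps) f (?p a b)) (at b)"
        unfolding swap by (rule d[OF _ s(2) in_p(2)]) (use ps s in auto)
      show "((\<lambda>a. wderiv (s' # ps) f (?p a b)) has_real_derivative wderiv (s # s' # ps) f (?p a b)) (at a)"
        by (rule d[OF _ s(1) in_p(3)]) (use ps s in auto)
      show "continuous_on UNIV (\<lambda>p. wderiv (s' # s # ps) f (?p (fst p) (snd p)))"
        by (rule cont) (use ps s in auto)
      show "continuous_on UNIV (\<lambda>p. wderiv (s # s' # ps) f (?p (fst p) (snd p)))"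
        by (rule cont) (use ps s in auto)
    qed
    then show ?thesis by simp
  qed
qed

lemma wderiv_replicate_swap:
  assumes f: "f \<in> pow_fun k \<rho>" and ps: "set ps \<subseteq> coords k" and s: "s \<in> coords k" "s' \<in> coords k"
  shows "wderiv (s' # replicate n s @ ps) f = wderiv (replicate n s @ s' # ps) f"
proof (induction n)
  case (Suc n)
  have "set (replicate n s @ ps) \<subseteq> coords k" using ps s by (auto simp: set_replicate_conv_if)
  from wderiv_swap[OF f this s(2,1)]
  have "wderiv (s' # replicate (Suc n) s @ ps) f = wderiv (s # s' # replicate n s @ ps) f"
    by (simp only: replicate_Suc append_Cons)
  then show ?case using Suc by simp
qed simp

text \<open>
  All letters \<open>s\<close> of a word can be moved to its front.
\<close>

lemma wderiv_collect:
  assumes f: "f \<in> pow_fun k \<rho>" and ps: "set ps \<subseteq> coords k" and s: "s \<in> coords k"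
  shows "wderiv ps f = wderiv (replicate (count_list ps s) s @ filter (\<lambda>s'. s' \<noteq> s) ps) f"
  using ps
proof (induction ps)
  case (Cons s' ps)
  have sub: "set (filter (\<lambda>s'. s' \<noteq> s) ps) \<subseteq> coords k" using Cons by auto
  show ?case
  proof (cases "s' = s")
    case False
    have "wderiv (s' # ps) f = wderiv (s' # replicate (count_list ps s) s @ filter (\<lambda>s'. s' \<noteq> s) ps) f"
      using Cons by simp
    also have "\<dots> = wderiv (replicate (count_list ps s) s @ s' # filter (\<lambda>s'. s' \<noteq> s) ps) f"
      using wderiv_replicate_swap[OF f sub s] Cons by simp
    finally show ?thesis using False by simp
  qed (use Cons in simp)
qed simp

section \<open>Sobolev norms on symmetric test functions\<close>

text \<open>
  The word of the differential operator that applies, for each \<open>i < k\<close>, the derivatives listed in \<open>J i\<close> to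
  the \<open>i\<close>-th variable.
\<close>

definition jword :: "nat \<Rightarrow> (nat \<Rightarrow> 'd list) \<Rightarrow> (nat \<times> 'd) list" where
  "jword k J = concat (map (\<lambda>i. map (Pair i) (J i)) [0..<k])"

lemma wderiv_jword: "foldr (\<lambda>i. foldr (pdiff_at i) (J i)) [0..<k] f = wderiv (jword k J) f"
proof -
  have 1: "foldr (pdiff_at i) js g = wderiv (map (Pair i) js) g" for i js and g :: "(nat \<Rightarrow> real^'a) \<Rightarrow> real"
    by (induction js) auto
  have "foldr (\<lambda>i. foldr (pdiff_at i) (J i)) is f = wderiv (concat (map (\<lambda>i. map (Pair i) (J i)) is)) f" for "is"
    by (induction "is") (auto simp: 1 wderiv_append)
  then show ?thesis by (simp add: jword_def)
qed

lemma set_jword: "set (jword k J) \<subseteq> coords k"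
  by (auto simp: jword_def)

lemma length_jword: "(\<And>i. i < k \<Longrightarrow> length (J i) \<le> l) \<Longrightarrow> length (jword k J) \<le> k * l"
  by (induction k) (force simp: jword_def)+

lemma sobolev_norm_pow_eq:
  "sobolev_norm_pow k \<tau> f = sqrt (\<Sum>J \<in> PiE {..<k} (\<lambda>_. {js. length js \<le> fst \<tau>}).
     LINT x|PiM {..<k} (\<lambda>_. lborel). (wderiv (jword k J) f x)\<^sup>2 * (\<Prod>i<k. snd \<tau> (x i)))"
  by (simp add: sobolev_norm_pow_def wderiv_jword)

lemma emeasure_pow_box_finite:
  "pow_box k \<rho> \<in> sets (PiM {..<k} (\<lambda>_. lborel))" "emeasure (PiM {..<k} (\<lambda>_. lborel)) (pow_box k \<rho>) < \<infinity>"
proof -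
  interpret product_sigma_finite "\<lambda>_ :: nat. lborel :: (real^'a) measure" by standard
  show "pow_box k \<rho> \<in> sets (PiM {..<k} (\<lambda>_. lborel))"
    unfolding pow_box_def by (rule sets_PiM_I_finite) auto
  have "emeasure lborel (cbox a b) \<noteq> \<infinity>" for a b :: "real^'a"
    using emeasure_lborel_cbox_finite[of a b] by simp
  then show "emeasure (PiM {..<k} (\<lambda>_. lborel)) (pow_box k \<rho>) < \<infinity>"
    unfolding pow_box_def by (subst emeasure_PiM) (auto simp: less_top[symmetric] ennreal_prod_eq_top)
qed

text \<open>
  The topology of the points is induced from the function space, whereas the product measure has the
  product sigma algebra on the extensional functions; the inclusion of the latter into the function space is
  measurable because each of its countably many components is.
\<close>

lemma measurable_pow:
  fixes h :: "(nat \<Rightarrow> real^'d) \<Rightarrow> real"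
  assumes "continuous_on (points k) h"
  shows "h \<in> borel_measurable (PiM {..<k} (\<lambda>_. lborel))"
proof -
  let ?M = "PiM {..<k} (\<lambda>_. lborel :: (real^'d) measure)"
  have sp: "space ?M = points k" by (simp add: space_PiM points_def)
  have "(\<lambda>x. x i) \<in> borel_measurable ?M" for i
  proof (cases "i < k")
    case True
    then have "(\<lambda>x. x i) \<in> measurable ?M lborel" by (intro measurable_component_singleton) simp
    then show ?thesis by simp
  next
    case False
    then have "(\<lambda>x. x i) \<in> borel_measurable ?M \<longleftrightarrow> (\<lambda>x. undefined :: real^'d) \<in> borel_measurable ?M"
      by (intro measurable_cong) (simp add: sp mem_points)
    then show ?thesis by simp
  qed
  then have "(\<lambda>x. x) \<in> measurable ?M (borel :: (nat \<Rightarrow> real^'d) measure)"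
    by (rule measurable_coordinatewise_then_product)
  then have "(\<lambda>x. x) \<in> measurable ?M (restrict_space borel (points k))"
    by (intro measurable_restrict_space2) (simp_all add: sp)
  from measurable_compose[OF this borel_measurable_continuous_on_restrict[OF assms]] show ?thesis .
qed

lemma integrable_pow:
  fixes h :: "(nat \<Rightarrow> real^'d) \<Rightarrow> real"
  assumes cont: "continuous_on (points k) h" and zero: "\<And>x. x \<notin> pow_box k \<rho> \<Longrightarrow> h x = 0"
  shows "integrable (PiM {..<k} (\<lambda>_. lborel)) h"
proof -
  have "continuous_on (pow_box k \<rho>) h"
    by (rule continuous_on_subset[OF cont]) (auto simp: mem_pow_box)
  then have "bounded (h ` pow_box k \<rho>)"
    by (intro compact_imp_bounded compact_continuous_image compact_pow_box)
  then obtain B where B: "\<And>x. x \<in> pow_box k \<rho> \<Longrightarrow> norm (h x) \<le> B" by (auto simp: bounded_iff)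
  show ?thesis
    by (rule integrableI_bounded_set[OF emeasure_pow_box_finite(1) measurable_pow[OF cont] emeasure_pow_box_finite(2), where B=B])
       (use B zero in auto)
qed

lemma continuous_weight_prod:
  assumes "\<tau> \<in> weights"
  shows "continuous_on A (\<lambda>x :: nat \<Rightarrow> real^'d. \<Prod>i<k. snd \<tau> (x i))"
proof (rule continuous_on_prod)
  fix i
  have "continuous_on A (\<lambda>x :: nat \<Rightarrow> real^'d. x i)"
    by (rule continuous_on_subset[OF continuous_on_product_coordinates]) simp
  from continuous_on_compose2[OF weightsD(3)[OF assms] this]
  show "continuous_on A (\<lambda>x. snd \<tau> (x i))" by simp
qed

lemma integrable_pow_fun:
  assumes f: "f \<in> pow_fun k \<rho>" and g: "g \<in> pow_fun k \<rho>'" and \<tau>: "\<tau> \<in> weights"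
    and ps: "set ps \<subseteq> coords k" and qs: "set qs \<subseteq> coords k"
  shows "integrable (PiM {..<k} (\<lambda>_. lborel)) (\<lambda>x. wderiv ps f x * wderiv qs g x * (\<Prod>i<k. snd \<tau> (x i)))"
proof (rule integrable_pow)
  show "continuous_on (points k) (\<lambda>x. wderiv ps f x * wderiv qs g x * (\<Prod>i<k. snd \<tau> (x i)))"
    by (intro continuous_on_mult smooth_pow_continuous pow_funD(1)[OF f] pow_funD(1)[OF g] ps qs continuous_weight_prod \<tau>)
  show "wderiv ps f x * wderiv qs g x * (\<Prod>i<k. snd \<tau> (x i)) = 0" if "x \<notin> pow_box k \<rho>" for x
    using pow_fun_wderiv_outside_box[OF f ps that] by simp
qed

text \<open>
  A compact support is bounded in all scalar coordinates by a common \<open>R\<close>.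
\<close>

lemma sym_test_funD:
  assumes "f \<in> sym_test_fun k"
  shows "\<exists>R. f \<in> pow_fun k (\<lambda>_. R)" "\<pi> permutes {..<k} \<Longrightarrow> x \<in> points k \<Longrightarrow> f (x \<circ> \<pi>) = f x"
proof -
  let ?K = "closure {x. f x \<noteq> 0}"
  have K: "compact ?K" and f: "smooth_pow k f" "\<And>x. x \<notin> points k \<Longrightarrow> f x = 0"
    using assms by (auto simp: sym_test_fun_def)
  show "\<pi> permutes {..<k} \<Longrightarrow> x \<in> points k \<Longrightarrow> f (x \<circ> \<pi>) = f x"
    using assms by (simp add: sym_test_fun_def)
  have "\<exists>B. \<forall>x\<in>?K. \<bar>crd s x\<bar> \<le> B" for s
  proof -
    have "continuous_on ?K (\<lambda>x. x (fst s))"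
      by (rule continuous_on_subset[OF continuous_on_product_coordinates]) simp
    then have "continuous_on ?K (crd s)"
      unfolding crd_def[abs_def] by (rule continuous_on_component)
    then have "bounded (crd s ` ?K)" by (intro compact_imp_bounded compact_continuous_image K)
    then show ?thesis by (auto simp: bounded_iff)
  qed
  then obtain B where B: "\<And>s x. x \<in> ?K \<Longrightarrow> \<bar>crd s x\<bar> \<le> B s" by metis
  define R where "R = (\<Sum>s\<in>coords k. \<bar>B s\<bar>)"
  have "f x = 0" if s: "s \<in> coords k" "R < \<bar>crd s x\<bar>" for s x
  proof (rule ccontr)
    assume "f x \<noteq> 0"
    then have "x \<in> ?K" using closure_subset[of "{x. f x \<noteq> 0}"] by blast
    then have "\<bar>crd s x\<bar> \<le> \<bar>B s\<bar>" using B by (meson abs_ge_self order_trans)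
    also have "\<dots> \<le> R" unfolding R_def using s by (intro member_le_sum) auto
    finally show False using s by simp
  qed
  then have "f \<in> pow_fun k (\<lambda>_. R)" using f unfolding pow_fun_def by blast
  then show "\<exists>R. f \<in> pow_fun k (\<lambda>_. R)" ..
qed

lemma sym_test_funI:
  assumes f: "f \<in> pow_fun k \<rho>" and sym: "\<And>\<pi> x. \<pi> permutes {..<k} \<Longrightarrow> x \<in> points k \<Longrightarrow> f (x \<circ> \<pi>) = f x"
  shows "f \<in> sym_test_fun k"
proof -
  have "f x = 0" if "x \<notin> pow_box k \<rho>" for x
    using pow_fun_wderiv_outside_box[OF f, of "[]" x] that by simp
  then have "{x. f x \<noteq> 0} \<subseteq> pow_box k \<rho>" by blast
  then have "compact (closure {x. f x \<noteq> 0})"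
    using compact_closure bounded_subset compact_pow_box closure_minimal compact_imp_closed
    by (metis closed_closure compact_Int_closed inf.absorb_iff2)
  then show ?thesis using sym pow_funD(1,2)[OF f] by (simp add: sym_test_fun_def)
qed

lemma pow_fun_common_radius:
  assumes "f \<in> pow_fun k (\<lambda>_. R)" "g \<in> pow_fun k (\<lambda>_. R')"
  shows "f \<in> pow_fun k (\<lambda>_. max R R')" "g \<in> pow_fun k (\<lambda>_. max R R')"
  using pow_fun_mono[OF assms(1)] pow_fun_mono[OF assms(2)] by auto

lemma subspace_sym_test_fun: "subspace (sym_test_fun k)"
  unfolding subspace_def
proof (intro conjI ballI allI)
  show "0 \<in> sym_test_fun k"
    by (rule sym_test_funI[OF subspace_0[OF subspace_pow_fun]]) simp
  fix f :: "(nat \<Rightarrow> real^'a) \<Rightarrow> real" assume f: "f \<in> sym_test_fun k"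
  then obtain R where R: "f \<in> pow_fun k (\<lambda>_. R)" using sym_test_funD(1) by blast
  show "c *\<^sub>R f \<in> sym_test_fun k" for c
    by (rule sym_test_funI[OF subspace_scale[OF subspace_pow_fun R]])
       (simp add: scaleR_fun_def sym_test_funD(2)[OF f])
  fix g :: "(nat \<Rightarrow> real^'a) \<Rightarrow> real" assume g: "g \<in> sym_test_fun k"
  then obtain R' where R': "g \<in> pow_fun k (\<lambda>_. R')" using sym_test_funD(1) by blast
  show "f + g \<in> sym_test_fun k"
    by (rule sym_test_funI[OF subspace_add[OF subspace_pow_fun pow_fun_common_radius[OF R R']]])
       (simp add: sym_test_funD(2)[OF f] sym_test_funD(2)[OF g])
qed

lemma weight_prod_nonneg: "\<tau> \<in> weights \<Longrightarrow> 0 \<le> (\<Prod>i<k. snd \<tau> (x i))"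
  by (intro prod_nonneg order_trans[OF zero_le_one weightsD(2)]) auto

lemma seminorm_sobolev_norm_pow:
  assumes \<tau>: "\<tau> \<in> weights"
  shows "seminorm_on (sym_test_fun k) (sobolev_norm_pow k \<tau>)"
  unfolding sobolev_norm_pow_eq[abs_def]
proof (rule l2_seminorm_on[where A="\<lambda>J. wderiv (jword k J)", OF subspace_sym_test_fun])
  fix J :: "nat \<Rightarrow> 'a list" and f g :: "(nat \<Rightarrow> real^'a) \<Rightarrow> real"
  assume f: "f \<in> sym_test_fun k" and g: "g \<in> sym_test_fun k"
  obtain R R' where R: "f \<in> pow_fun k (\<lambda>_. R)" "g \<in> pow_fun k (\<lambda>_. R')" using sym_test_funD(1) f g by blast
  show "wderiv (jword k J) (f + g) = wderiv (jword k J) f + wderiv (jword k J) g"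
    by (rule wderiv_add(1)[OF R set_jword])
  show "integrable (PiM {..<k} (\<lambda>_. lborel)) (\<lambda>x. wderiv (jword k J) f x * wderiv (jword k J) g x * (\<Prod>i<k. snd \<tau> (x i)))"
    by (rule integrable_pow_fun[OF R \<tau> set_jword set_jword])
next
  fix J :: "nat \<Rightarrow> 'a list" and f :: "(nat \<Rightarrow> real^'a) \<Rightarrow> real" and c
  assume f: "f \<in> sym_test_fun k"
  obtain R where R: "f \<in> pow_fun k (\<lambda>_. R)" using sym_test_funD(1) f by blast
  show "wderiv (jword k J) (c *\<^sub>R f) = c *\<^sub>R wderiv (jword k J) f"
    by (rule wderiv_scale(1)[OF R set_jword])
qed (rule weight_prod_nonneg[OF \<tau>])

lemma finite_word_families: "finite (PiE {..<k :: nat} (\<lambda>_. {js :: 'd::finite list. length js \<le> l}))"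
  by (intro finite_PiE finite_words) simp

lemma sobolev_norm_pow_mono:
  assumes \<tau>: "\<tau> \<in> weights" and \<sigma>: "\<sigma> \<in> weights" and le: "fst \<tau> \<le> fst \<sigma>" "\<And>x. snd \<tau> x \<le> snd \<sigma> x"
    and f: "f \<in> sym_test_fun k"
  shows "sobolev_norm_pow k \<tau> f \<le> sobolev_norm_pow k \<sigma> f"
  unfolding sobolev_norm_pow_eq
proof (rule l2_norm_mono[OF finite_word_families])
  obtain R where R: "f \<in> pow_fun k (\<lambda>_. R)" using sym_test_funD(1) f by blast
  show "PiE {..<k} (\<lambda>_. {js :: 'a list. length js \<le> fst \<tau>}) \<subseteq> PiE {..<k} (\<lambda>_. {js. length js \<le> fst \<sigma>})"
    by (rule PiE_mono) (use le(1) in auto)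
  show "0 \<le> (\<Prod>i<k. snd \<tau> (x i)) \<and> (\<Prod>i<k. snd \<tau> (x i)) \<le> (\<Prod>i<k. snd \<sigma> (x i))" for x
    using weight_prod_nonneg[OF \<tau>] order_trans[OF zero_le_one weightsD(2)[OF \<tau>]] le(2) by (auto intro!: prod_mono)
  show "integrable (PiM {..<k} (\<lambda>_. lborel)) (\<lambda>x. (wderiv (jword k J) f x)\<^sup>2 * (\<Prod>i<k. snd \<sigma> (x i)))" for J
    using integrable_pow_fun[OF R R \<sigma> set_jword[of k J] set_jword[of k J]] by (simp add: power2_eq_square)
qed

lemma sobolev_pow_directed:
  assumes "p \<in> sobolev_norm_pow k ` weights" "q \<in> sobolev_norm_pow k ` weights"
  shows "\<exists>r\<in>sobolev_norm_pow k ` weights. \<forall>f\<in>sym_test_fun k. p f \<le> r f \<and> q f \<le> r f"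
proof -
  obtain \<tau> \<sigma> where *: "\<tau> \<in> weights" "\<sigma> \<in> weights" "p = sobolev_norm_pow k \<tau>" "q = sobolev_norm_pow k \<sigma>" using assms by auto
  have "p f \<le> sobolev_norm_pow k (weight_join \<tau> \<sigma>) f \<and> q f \<le> sobolev_norm_pow k (weight_join \<tau> \<sigma>) f"
    if "f \<in> sym_test_fun k" for f
    unfolding * using weight_join[OF *(1,2)] sobolev_norm_pow_mono[OF *(1) weight_join(1)[OF *(1,2)] _ _ that]
      sobolev_norm_pow_mono[OF *(2) weight_join(1)[OF *(1,2)] _ _ that] by blast
  then show ?thesis using weight_join(1)[OF *(1,2)] by blast
qed

lemma sym_topology_seminorms:
  "sobolev_norm_pow k ` weights \<noteq> {}" 
  "p \<in> sobolev_norm_pow k ` weights \<Longrightarrow> seminorm_on (sym_test_fun k) p"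
  using weights_nonempty seminorm_sobolev_norm_pow by blast+

section \<open>Closeness with finitely many derivatives\<close>

lemma sum_fun_apply: "(\<Sum>i\<in>I. f i) x = (\<Sum>i\<in>I. (f i x :: 'b::comm_monoid_add))"
  by (induction I rule: infinite_finite_induct) auto

lemma linear_map_on_wderiv: "set ps \<subseteq> coords k \<Longrightarrow> linear_map_on (pow_fun k \<rho>) (wderiv ps)"
  unfolding linear_map_on_def using wderiv_add(1) wderiv_scale(1) by blast

text \<open>
  All derivatives of \<open>h\<close> of order at most \<open>m\<close> are bounded by \<open>d\<close>.
\<close>

definition deriv_small :: "nat \<Rightarrow> nat \<Rightarrow> real \<Rightarrow> ((nat \<Rightarrow> real^'d) \<Rightarrow> real) \<Rightarrow> bool" where
  "deriv_small k m d h \<longleftrightarrow> (\<forall>ps x. set ps \<subseteq> coords k \<and> length ps \<le> m \<longrightarrow> \<bar>wderiv ps h x\<bar> \<le> d)"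

lemma deriv_small_add:
  fixes f g :: "(nat \<Rightarrow> real^'d) \<Rightarrow> real"
  assumes "f \<in> pow_fun k \<rho>" "g \<in> pow_fun k \<rho>" "deriv_small k m d f" "deriv_small k m e g"
  shows "deriv_small k m (d + e) (f + g)"
  unfolding deriv_small_def
proof (intro allI impI)
  fix ps :: "(nat \<times> 'd) list" and x :: "nat \<Rightarrow> real^'d" assume ps: "set ps \<subseteq> coords k \<and> length ps \<le> m"
  then have "\<bar>wderiv ps f x\<bar> \<le> d" "\<bar>wderiv ps g x\<bar> \<le> e" using assms(3,4) unfolding deriv_small_def by blast+
  then show "\<bar>wderiv ps (f + g) x\<bar> \<le> d + e"
    using wderiv_add(1)[OF assms(1,2)] ps by simp
qed

lemma deriv_small_scale:
  fixes f :: "(nat \<Rightarrow> real^'d) \<Rightarrow> real"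
  assumes "f \<in> pow_fun k \<rho>" "deriv_small k m d f"
  shows "deriv_small k m (\<bar>c\<bar> * d) (c *\<^sub>R f)"
  unfolding deriv_small_def
proof (intro allI impI)
  fix ps :: "(nat \<times> 'd) list" and x :: "nat \<Rightarrow> real^'d" assume ps: "set ps \<subseteq> coords k \<and> length ps \<le> m"
  then have "\<bar>wderiv ps f x\<bar> \<le> d" using assms(2) unfolding deriv_small_def by blast
  then have "\<bar>c\<bar> * \<bar>wderiv ps f x\<bar> \<le> \<bar>c\<bar> * d" by (intro mult_left_mono) auto
  moreover have "wderiv ps (c *\<^sub>R f) x = c * wderiv ps f x"
    using wderiv_scale(1)[OF assms(1)] ps by (simp only: scaleR_fun_def real_scaleR_def)
  ultimately show "\<bar>wderiv ps (c *\<^sub>R f) x\<bar> \<le> \<bar>c\<bar> * d" by (simp add: abs_mult)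
qed

lemma deriv_small_mono: "deriv_small k m d f \<Longrightarrow> d \<le> e \<Longrightarrow> deriv_small k m e f"
  unfolding deriv_small_def by (meson order_trans)

lemma deriv_small_zero: "0 \<le> d \<Longrightarrow> deriv_small k m d 0"
  unfolding deriv_small_def
  using linear_map_onD(1)[OF linear_map_on_wderiv subspace_pow_fun] by (metis abs_zero zero_fun_apply)

text \<open>
  The functions that can be approximated from \<open>W\<close>, uniformly with all derivatives of each bounded order. The
  bound \<open>\<rho>\<close> on the supports is the same for all approximants, which makes the closure idempotent.
\<close>

definition smooth_closure :: "nat \<Rightarrow> (nat \<times> 'd \<Rightarrow> real) \<Rightarrow> ((nat \<Rightarrow> real^'d) \<Rightarrow> real) set \<Rightarrow> ((nat \<Rightarrow> real^'d) \<Rightarrow> real) set" where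
  "smooth_closure k \<rho> W = {f \<in> pow_fun k \<rho>. \<forall>m. \<forall>d>0. \<exists>g\<in>W. deriv_small k m d (f - g)}"

lemma smooth_closureD: "f \<in> smooth_closure k \<rho> W \<Longrightarrow> 0 < d \<Longrightarrow> \<exists>g\<in>W. deriv_small k m d (f - g)"
  by (simp add: smooth_closure_def)

lemma smooth_closure_incl:
  assumes "W \<subseteq> pow_fun k \<rho>"
  shows "W \<subseteq> smooth_closure k \<rho> W"
proof
  fix f assume f: "f \<in> W"
  have "deriv_small k m d (f - f)" if "0 < d" for m d using deriv_small_zero[of d k m] that by simp
  then show "f \<in> smooth_closure k \<rho> W" using f assms unfolding smooth_closure_def by blast
qed

lemma subspace_smooth_closure:
  assumes W: "subspace W" "W \<subseteq> pow_fun k \<rho>"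
  shows "subspace (smooth_closure k \<rho> W)"
  unfolding subspace_def
proof (intro conjI ballI allI)
  note V = subspace_pow_fun[of k \<rho>]
  show "0 \<in> smooth_closure k \<rho> W" using smooth_closure_incl[OF W(2)] subspace_0[OF W(1)] by blast
  fix f assume f: "f \<in> smooth_closure k \<rho> W"
  then have fV: "f \<in> pow_fun k \<rho>" by (simp add: smooth_closure_def)
  show "c *\<^sub>R f \<in> smooth_closure k \<rho> W" for c
    unfolding smooth_closure_def
  proof (intro CollectI conjI allI impI)
    show "c *\<^sub>R f \<in> pow_fun k \<rho>" using V fV by (rule subspace_scale)
    fix m and d :: real assume d: "0 < d"
    then obtain g where g: "g \<in> W" "deriv_small k m (d / (\<bar>c\<bar> + 1)) (f - g)"
      using smooth_closureD[OF f, of "d / (\<bar>c\<bar> + 1)" m] by auto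
    have "deriv_small k m (\<bar>c\<bar> * (d / (\<bar>c\<bar> + 1))) (c *\<^sub>R (f - g))"
      by (rule deriv_small_scale[OF subspace_diff[OF V fV] g(2)]) (use g W in blast)
    moreover have "\<bar>c\<bar> * (d / (\<bar>c\<bar> + 1)) \<le> (\<bar>c\<bar> + 1) * (d / (\<bar>c\<bar> + 1))" using d by (intro mult_right_mono) auto
    ultimately have "deriv_small k m d (c *\<^sub>R f - c *\<^sub>R g)"
      by (simp add: scaleR_diff_right deriv_small_mono)
    then show "\<exists>g\<in>W. deriv_small k m d (c *\<^sub>R f - g)" using subspace_scale[OF W(1) g(1)] by blast
  qed
  fix f' assume f': "f' \<in> smooth_closure k \<rho> W"
  then have fV': "f' \<in> pow_fun k \<rho>" by (simp add: smooth_closure_def)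
  show "f + f' \<in> smooth_closure k \<rho> W"
    unfolding smooth_closure_def
  proof (intro CollectI conjI allI impI)
    show "f + f' \<in> pow_fun k \<rho>" using V fV fV' by (rule subspace_add)
    fix m and d :: real assume d: "0 < d"
    then obtain g g' where g: "g \<in> W" "deriv_small k m (d / 2) (f - g)" "g' \<in> W" "deriv_small k m (d / 2) (f' - g')"
      using smooth_closureD[OF f, of "d / 2" m] smooth_closureD[OF f', of "d / 2" m] by auto
    have gV: "f - g \<in> pow_fun k \<rho>" "f' - g' \<in> pow_fun k \<rho>"
      using subspace_diff[OF V fV] subspace_diff[OF V fV'] g W(2) by blast+
    have "deriv_small k m d ((f + f') - (g + g'))"
      using deriv_small_add[OF gV g(2,4)] by (simp add: algebra_simps)
    then show "\<exists>g\<in>W. deriv_small k m d (f + f' - g)" using subspace_add[OF W(1) g(1,3)] by blast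
  qed
qed

lemma smooth_closure_trans:
  assumes W: "W \<subseteq> smooth_closure k \<rho> W'" and W': "W' \<subseteq> pow_fun k \<rho>" and f: "f \<in> smooth_closure k \<rho> W"
  shows "f \<in> smooth_closure k \<rho> W'"
  unfolding smooth_closure_def
proof (intro CollectI conjI allI impI)
  note V = subspace_pow_fun[of k \<rho>]
  show fV: "f \<in> pow_fun k \<rho>" using f by (simp add: smooth_closure_def)
  fix m and d :: real assume d: "0 < d"
  then obtain g where g: "g \<in> W" "deriv_small k m (d / 2) (f - g)"
    using smooth_closureD[OF f, of "d / 2" m] by auto
  then obtain h where h: "h \<in> W'" "deriv_small k m (d / 2) (g - h)"
    using smooth_closureD[of g k \<rho> W' "d / 2" m] W d by auto
  have gV: "g \<in> pow_fun k \<rho>" using g W by (auto simp: smooth_closure_def)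
  have hV: "h \<in> pow_fun k \<rho>" using h W' by blast
  have "deriv_small k m d (f - h)"
    using deriv_small_add[OF subspace_diff[OF V fV gV] subspace_diff[OF V gV hV] g(2) h(2)] by simp
  then show "\<exists>g\<in>W'. deriv_small k m d (f - g)" using h by blast
qed

section \<open>Approximation one coordinate at a time\<close>

text \<open>
  Freezing coordinate \<open>s\<close> of \<open>g\<close> at \<open>t\<close> and multiplying by a function of that coordinate: derivatives along \<open>s\<close> fall on
  the new factor, all others on \<open>g\<close>.
\<close>

lemma slice_product:
  fixes g :: "(nat \<Rightarrow> real^'d) \<Rightarrow> real"
  assumes g: "g \<in> pow_fun k \<rho>" and s: "s \<in> coords k" and \<psi>: "smooth1 \<psi>"
  shows "set ps \<subseteq> coords k \<Longrightarrow> wderiv ps (\<lambda>x. g (put s t x) * \<psi> (crd s x)) =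
      (\<lambda>x. wderiv (filter (\<lambda>s'. s' \<noteq> s) ps) g (put s t x) * (deriv ^^ count_list ps s) \<psi> (crd s x))"
    and "(\<And>u. \<rho>' s < \<bar>u\<bar> \<Longrightarrow> \<psi> u = 0) \<Longrightarrow> (\<And>s'. s' \<in> coords k \<Longrightarrow> s' \<noteq> s \<Longrightarrow> \<rho> s' \<le> \<rho>' s') \<Longrightarrow>
      (\<lambda>x. g (put s t x) * \<psi> (crd s x)) \<in> pow_fun k \<rho>'"
proof -
  let ?G = "\<lambda>ps x. wderiv (filter (\<lambda>s'. s' \<noteq> s) ps) g (put s t x) * (deriv ^^ count_list ps s) \<psi> (crd s x)"
  let ?h = "\<lambda>x. g (put s t x) * \<psi> (crd s x)"
  have sub: "set (filter (\<lambda>s'. s' \<noteq> s) ps) \<subseteq> coords k" if "set ps \<subseteq> coords k" for ps using that by auto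
  have G0: "?G [] = ?h" by simp
  have der: "((\<lambda>u. ?G ps (put s' u x)) has_real_derivative ?G (s' # ps) x) (at (crd s' x))"
    if *: "set ps \<subseteq> coords k" "s' \<in> coords k" "x \<in> points k" for ps s' x
  proof (cases "s' = s")
    case True
    have "((\<lambda>u. wderiv (filter (\<lambda>s'. s' \<noteq> s) ps) g (put s t x) * (deriv ^^ count_list ps s) \<psi> u) has_real_derivative
       wderiv (filter (\<lambda>s'. s' \<noteq> s) ps) g (put s t x) * (deriv ^^ Suc (count_list ps s)) \<psi> (crd s x)) (at (crd s x))"
      by (rule DERIV_cmult[OF smooth1_has_deriv[OF \<psi>]])
    then show ?thesis using True by (simp add: crd_put)
  next
    case False
    let ?y = "put s t x"
    have y: "?y \<in> points k" using s * put_in_points by blast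
    have c: "crd s' x = crd s' ?y" using False by (simp add: crd_put)
    have "((\<lambda>u. wderiv (filter (\<lambda>s'. s' \<noteq> s) ps) g (put s' u ?y)) has_real_derivative
       wderiv (s' # filter (\<lambda>s'. s' \<noteq> s) ps) g ?y) (at (crd s' x))"
      using smooth_pow_has_deriv[OF pow_funD(1)[OF g] sub[OF *(1)] *(2) y, of "crd s' ?y"] unfolding c put_crd .
    from DERIV_cmult_right[OF this, of "(deriv ^^ count_list ps s) \<psi> (crd s x)"]
    show ?thesis using False by (simp add: crd_put put_commute[of s' s])
  qed
  have zero: "?G ps x = 0" if "set ps \<subseteq> coords k" "x \<notin> points k" for ps x
    using pow_fun_wderiv_off_points[OF g sub[OF that(1)], of "put s t x"] put_in_points[OF s] that(2) by simp
  have cont: "continuous_on (points k) (?G ps)" if "set ps \<subseteq> coords k" for ps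
  proof (rule continuous_on_mult)
    have c: "continuous_on (points k) (put s t)"
      by (intro continuous_on_put continuous_on_const continuous_on_id)
    show "continuous_on (points k) (\<lambda>x. wderiv (filter (\<lambda>s'. s' \<noteq> s) ps) g (put s t x))"
      by (rule continuous_on_compose2[OF smooth_pow_continuous[OF pow_funD(1)[OF g] sub[OF that]] c])
         (use put_in_points[OF s] in auto)
    have "continuous_on (points k) (\<lambda>x. x (fst s))"
      by (rule continuous_on_subset[OF continuous_on_product_coordinates]) simp
    then have c': "continuous_on (points k) (crd s)"
      unfolding crd_def[abs_def] by (rule continuous_on_component)
    show "continuous_on (points k) (\<lambda>x. (deriv ^^ count_list ps s) \<psi> (crd s x))"
      by (rule continuous_on_compose2[OF smooth1_continuous[OF \<psi>, of UNIV] c']) simp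
  qed
  show "wderiv ps ?h = ?G ps" if "set ps \<subseteq> coords k"
    by (rule smooth_pow_iterated(1)[where G="?G", OF G0 der zero cont that])
  assume \<psi>0: "\<And>u. \<rho>' s < \<bar>u\<bar> \<Longrightarrow> \<psi> u = 0" and le: "\<And>s'. s' \<in> coords k \<Longrightarrow> s' \<noteq> s \<Longrightarrow> \<rho> s' \<le> \<rho>' s'"
  have "smooth_pow k ?h" by (rule smooth_pow_iterated(2)[where G="?G", OF G0 der zero cont])
  moreover have "?h x = 0" if "x \<notin> points k" for x using zero[of "[]" x] that by simp
  moreover have "?h x = 0" if "s' \<in> coords k" "\<rho>' s' < \<bar>crd s' x\<bar>" for s' x
  proof (cases "s' = s")
    case False
    then have "\<rho> s' < \<bar>crd s' (put s t x)\<bar>" using that le[of s'] by (simp add: crd_put)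
    then show ?thesis using pow_funD(3)[OF g that(1)] by simp
  qed (use that \<psi>0 in simp)
  ultimately show "?h \<in> pow_fun k \<rho>'" unfolding pow_fun_def by blast
qed

lemma pow_fun_words_bounded:
  fixes f :: "(nat \<Rightarrow> real^'d) \<Rightarrow> real"
  assumes f: "f \<in> pow_fun k \<rho>"
  obtains M where "0 \<le> M" "\<And>ps x. set ps \<subseteq> coords k \<Longrightarrow> length ps \<le> m \<Longrightarrow> \<bar>wderiv ps f x\<bar> \<le> M"
proof -
  let ?P = "{ps :: (nat \<times> 'd) list. set ps \<subseteq> coords k \<and> length ps \<le> m}"
  have fin: "finite ?P" by (rule finite_lists_length_le) simp
  define B where "B ps = (SOME B. \<forall>x. \<bar>wderiv ps f x\<bar> \<le> B)" for ps
  have B: "\<bar>wderiv ps f x\<bar> \<le> B ps" if "ps \<in> ?P" for ps x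
  proof -
    have "\<exists>B. \<forall>x. \<bar>wderiv ps f x\<bar> \<le> B"
      using pow_fun_wderiv_bounded[OF f, of ps] that by blast
    from someI_ex[OF this] show ?thesis unfolding B_def by blast
  qed
  show ?thesis
  proof (rule that[of "\<Sum>ps\<in>?P. \<bar>B ps\<bar>"])
    fix ps :: "(nat \<times> 'd) list" and x assume ps: "set ps \<subseteq> coords k" "length ps \<le> m"
    have "\<bar>wderiv ps f x\<bar> \<le> \<bar>B ps\<bar>" using B[of ps x] ps by (auto intro: order_trans)
    also have "\<dots> \<le> (\<Sum>ps\<in>?P. \<bar>B ps\<bar>)" using ps by (intro member_le_sum fin) auto
    finally show "\<bar>wderiv ps f x\<bar> \<le> (\<Sum>ps\<in>?P. \<bar>B ps\<bar>)" .
  qed (simp add: sum_nonneg)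
qed

lemma higher_deriv_along_coordinate:
  fixes f :: "(nat \<Rightarrow> real^'d) \<Rightarrow> real"
  assumes f: "f \<in> pow_fun k \<rho>" and s: "s \<in> coords k" and qs: "set qs \<subseteq> coords k" and x: "x \<in> points k"
  shows "(deriv ^^ a) (\<lambda>t. wderiv qs f (put s t x)) = (\<lambda>t. wderiv (replicate a s @ qs) f (put s t x))"
    and "smooth1 (\<lambda>t. wderiv qs f (put s t x))"
proof -
  have d: "((\<lambda>t. wderiv (replicate n s @ qs) f (put s t x)) has_real_derivative
      wderiv (replicate (Suc n) s @ qs) f (put s t x)) (at t)" for n t
  proof -
    have "set (replicate n s @ qs) \<subseteq> coords k" using qs s by (auto simp: set_replicate_conv_if)
    from smooth_pow_has_deriv[OF pow_funD(1)[OF f] this s x] show ?thesis by simp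
  qed
  from smooth1_iterated[of "\<lambda>n t. wderiv (replicate n s @ qs) f (put s t x)", OF _ d]
  show "(deriv ^^ a) (\<lambda>t. wderiv qs f (put s t x)) = (\<lambda>t. wderiv (replicate a s @ qs) f (put s t x))"
    "smooth1 (\<lambda>t. wderiv qs f (put s t x))" by simp_all
qed

text \<open>
  The one-dimensional approximation is applied to \<open>t \<mapsto> wderiv qs f (put s t x)\<close>, where \<open>qs\<close> consists of the letters of
  the word other than \<open>s\<close>; its bounds are uniform in \<open>qs\<close> and \<open>x\<close>.
\<close>

lemma approx_one_coordinate:
  fixes f :: "(nat \<Rightarrow> real^'d) \<Rightarrow> real"
  assumes f: "f \<in> pow_fun k \<rho>" and s: "s \<in> coords k" "0 < \<rho> s" and d: "0 < d"
  obtains \<psi> :: "nat \<Rightarrow> real \<Rightarrow> real" and N :: nat and t :: "nat \<Rightarrow> real" where "\<And>j. smooth1 (\<psi> j)" "\<And>j u. j < N \<Longrightarrow> \<rho> s + 1 < \<bar>u\<bar> \<Longrightarrow> \<psi> j u = 0"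
    "deriv_small k m d (f - (\<Sum>j<N. (\<lambda>x. f (put s (t j) x) * \<psi> j (crd s x))))"
proof -
  \<comment> \<open>up to \<open>m\<close> letters other than \<open>s\<close>, and up to \<open>m + 1\<close> letters \<open>s\<close>\<close>
  obtain M where M: "0 \<le> M" "\<And>ps x. set ps \<subseteq> coords k \<Longrightarrow> length ps \<le> 2 * m + 1 \<Longrightarrow> \<bar>wderiv ps f x\<bar> \<le> M"
    by (rule pow_fun_words_bounded[OF f]) blast
  obtain N :: nat and t :: "nat \<Rightarrow> real" and \<psi> :: "nat \<Rightarrow> real \<Rightarrow> real" where *: "\<And>j. smooth1 (\<psi> j)" "\<And>j u. j < N \<Longrightarrow> \<rho> s + 1 < \<bar>u\<bar> \<Longrightarrow> \<psi> j u = 0"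
    and approx: "\<forall>w a x. smooth1 w \<and> (\<forall>u. \<rho> s < \<bar>u\<bar> \<longrightarrow> w u = 0) \<and>
       (\<forall>b u. b \<le> Suc m \<longrightarrow> \<bar>(deriv ^^ b) w u\<bar> \<le> M) \<and> a \<le> m \<longrightarrow>
       \<bar>(deriv ^^ a) w x - (\<Sum>j<N. w (t j) * (deriv ^^ a) (\<psi> j) x)\<bar> \<le> d"
    by (rule smooth1_approx[where m=m, OF s(2) M(1) d]) blast
  let ?h = "\<lambda>j x. f (put s (t j) x) * \<psi> j (crd s x)"
  let ?\<rho> = "\<lambda>s'. if s' = s then \<rho> s + 1 else \<rho> s'"
  have h: "?h j \<in> pow_fun k ?\<rho>" if "j < N" for j
    by (rule slice_product(2)[OF f s(1) *(1)]) (use *(2)[OF that] in auto)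
  have f': "f \<in> pow_fun k ?\<rho>" by (rule pow_fun_mono[OF f]) auto
  note V = subspace_pow_fun[of k ?\<rho>]
  have "deriv_small k m d (f - (\<Sum>j<N. ?h j))"
    unfolding deriv_small_def
  proof (intro allI impI)
    fix ps :: "(nat \<times> 'd) list" and x :: "nat \<Rightarrow> real^'d" assume ps: "set ps \<subseteq> coords k \<and> length ps \<le> m"
    note L = linear_map_on_wderiv[of ps k ?\<rho>]
    have sum: "(\<Sum>j<N. ?h j) \<in> pow_fun k ?\<rho>" by (rule subspace_sum[OF V]) (use h in auto)
    have "wderiv ps (\<Sum>j<N. 1 *\<^sub>R ?h j) = (\<Sum>j<N. 1 *\<^sub>R wderiv ps (?h j))"
      by (rule linear_map_on_sum[OF L V]) (use h ps in auto)
    then have "wderiv ps (f - (\<Sum>j<N. ?h j)) = wderiv ps f - (\<Sum>j<N. wderiv ps (?h j))"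
      using linear_map_onD(4)[OF L V f' sum] ps by simp
    then have eq: "wderiv ps (f - (\<Sum>j<N. ?h j)) x = wderiv ps f x - (\<Sum>j<N. wderiv ps (?h j) x)"
      by (simp add: sum_fun_apply)
    let ?qs = "filter (\<lambda>s'. s' \<noteq> s) ps" and ?a = "count_list ps s"
    have qs: "set ?qs \<subseteq> coords k" using ps by auto
    show "\<bar>wderiv ps (f - (\<Sum>j<N. ?h j)) x\<bar> \<le> d"
    proof (cases "x \<in> points k")
      case False
      have "wderiv ps (?h j) x = 0" if "j < N" for j
        using pow_fun_wderiv_off_points[OF h[OF that] _ False, of ps] ps by blast
      moreover have "wderiv ps f x = 0" using pow_fun_wderiv_off_points[OF f _ False, of ps] ps by blast
      ultimately show ?thesis unfolding eq using d by simp
    next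
      case True
      let ?w = "\<lambda>u. wderiv ?qs f (put s u x)"
      note hd = higher_deriv_along_coordinate[OF f s(1) qs True]
      have len: "length ?qs \<le> m" "?a \<le> m" using ps length_filter_le[of "\<lambda>s'. s' \<noteq> s" ps] count_le_length[of ps s] by linarith+
      have "\<bar>(deriv ^^ ?a) ?w (crd s x) - (\<Sum>j<N. ?w (t j) * (deriv ^^ ?a) (\<psi> j) (crd s x))\<bar> \<le> d"
      proof (intro approx[rule_format] conjI allI impI hd(2) len(2))
        show "?w u = 0" if "\<rho> s < \<bar>u\<bar>" for u
          by (rule pow_fun_wderiv_outside[OF f s(1)]) (use that in \<open>simp add: crd_put\<close>)
        show "\<bar>(deriv ^^ b) ?w u\<bar> \<le> M" if "b \<le> Suc m" for b u
          unfolding hd(1) by (rule M(2)) (use that len(1) qs s(1) in \<open>auto simp: set_replicate_conv_if\<close>)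
      qed
      moreover have "(deriv ^^ ?a) ?w (crd s x) = wderiv ps f x"
        unfolding hd(1) using wderiv_collect[OF f _ s(1), of ps] ps by simp
      moreover have "wderiv ps (?h j) x = ?w (t j) * (deriv ^^ ?a) (\<psi> j) (crd s x)" for j
        using slice_product(1)[OF f s(1) *(1)] ps by simp
      ultimately show ?thesis unfolding eq by simp
    qed
  qed
  with * show ?thesis by (rule that)
qed

text \<open>
  Functions from which the coordinates in \<open>A\<close> have been split off as factors \<open>\<psi> s\<close> of one variable; the
  remaining factor \<open>v\<close> does not depend on these coordinates. The support may have grown by \<open>1\<close> in the
  coordinates of \<open>A\<close> only.
\<close>

definition split_funs :: "nat \<Rightarrow> real \<Rightarrow> (nat \<times> 'd) set \<Rightarrow> ((nat \<Rightarrow> real^'d) \<Rightarrow> real) set" where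
  "split_funs k R A = {g \<in> pow_fun k (\<lambda>s. if s \<in> A then R + 1 else R).
     \<exists>v \<psi>. (\<forall>s\<in>A. smooth1 (\<psi> s) \<and> (\<forall>u. R + 1 < \<bar>u\<bar> \<longrightarrow> \<psi> s u = 0)) \<and>
       (\<forall>x\<in>points k. g x = v x * (\<Prod>s\<in>A. \<psi> s (crd s x))) \<and>
       (\<forall>x\<in>points k. \<forall>s\<in>A. \<forall>t. v (put s t x) = v x)}"

lemma split_funs_pow_fun: "split_funs k R A \<subseteq> pow_fun k (\<lambda>_. R + 1)"
proof
  fix g assume "g \<in> split_funs k R A"
  then have g: "g \<in> pow_fun k (\<lambda>s. if s \<in> A then R + 1 else R)" by (simp add: split_funs_def)
  show "g \<in> pow_fun k (\<lambda>_. R + 1)" by (rule pow_fun_mono[OF g]) simp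
qed

lemma split_funs_step:
  fixes g :: "(nat \<Rightarrow> real^'d) \<Rightarrow> real"
  assumes g: "g \<in> split_funs k R A" and s: "s \<in> coords k" "s \<notin> A" and A: "finite A" "A \<subseteq> coords k" and R: "0 < R"
  shows "g \<in> smooth_closure k (\<lambda>_. R + 1) (span (split_funs k R (insert s A)))"
  unfolding smooth_closure_def
proof (intro CollectI conjI allI impI)
  show "g \<in> pow_fun k (\<lambda>_. R + 1)" using g split_funs_pow_fun by blast
  fix m and d :: real assume d: "0 < d"
  let ?\<rho> = "\<lambda>s. if s \<in> A then R + 1 else R"
  obtain v \<psi> where gp: "g \<in> pow_fun k ?\<rho>" and \<psi>: "\<And>s. s \<in> A \<Longrightarrow> smooth1 (\<psi> s)" "\<And>s u. s \<in> A \<Longrightarrow> R + 1 < \<bar>u\<bar> \<Longrightarrow> \<psi> s u = 0"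
    and geq: "\<And>x. x \<in> points k \<Longrightarrow> g x = v x * (\<Prod>s\<in>A. \<psi> s (crd s x))"
    and v: "\<And>x s t. x \<in> points k \<Longrightarrow> s \<in> A \<Longrightarrow> v (put s t x) = v x"
    using g unfolding split_funs_def by blast
  have \<rho>s: "?\<rho> s = R" "0 < ?\<rho> s" using s R by auto
  obtain N :: nat and t :: "nat \<Rightarrow> real" and \<phi> :: "nat \<Rightarrow> real \<Rightarrow> real" where \<phi>: "\<And>j. smooth1 (\<phi> j)" and \<phi>0: "\<And>j u. j < N \<Longrightarrow> ?\<rho> s + 1 < \<bar>u\<bar> \<Longrightarrow> \<phi> j u = 0"
    and small: "deriv_small k m d (g - (\<Sum>j<N. (\<lambda>x. g (put s (t j) x) * \<phi> j (crd s x))))"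
    by (rule approx_one_coordinate[where m=m, OF gp s(1) \<rho>s(2) d]) blast
  have "(\<lambda>x. g (put s (t j) x) * \<phi> j (crd s x)) \<in> split_funs k R (insert s A)" if j: "j < N" for j
    unfolding split_funs_def
  proof (intro CollectI conjI)
    show "(\<lambda>x. g (put s (t j) x) * \<phi> j (crd s x)) \<in> pow_fun k (\<lambda>s'. if s' \<in> insert s A then R + 1 else R)"
      by (rule slice_product(2)[OF gp s(1) \<phi>]) (use \<phi>0[OF j] \<rho>s(1) in auto)
    show "\<exists>v \<psi>. (\<forall>s\<in>insert s A. smooth1 (\<psi> s) \<and> (\<forall>u. R + 1 < \<bar>u\<bar> \<longrightarrow> \<psi> s u = 0)) \<and>
       (\<forall>x\<in>points k. g (put s (t j) x) * \<phi> j (crd s x) = v x * (\<Prod>s\<in>insert s A. \<psi> s (crd s x))) \<and>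
       (\<forall>x\<in>points k. \<forall>s\<in>insert s A. \<forall>t. v (put s t x) = v x)"
    proof (intro exI conjI ballI allI impI)
      fix s' assume s': "s' \<in> insert s A"
      show "smooth1 ((\<psi>(s := \<phi> j)) s')" using s' \<psi>(1)[of s'] \<phi> by auto
      show "(\<psi>(s := \<phi> j)) s' u = 0" if "R + 1 < \<bar>u\<bar>" for u using s' \<psi>(2)[of s' u] \<phi>0[OF j] that \<rho>s(1) by auto
    next
      fix x :: "nat \<Rightarrow> real^'d" assume x: "x \<in> points k"
      then have y: "put s (t j) x \<in> points k" using put_in_points[OF s(1)] by simp
      have "(\<Prod>s'\<in>A. \<psi> s' (crd s' (put s (t j) x))) = (\<Prod>s'\<in>A. (\<psi>(s := \<phi> j)) s' (crd s' x))"
        by (rule prod.cong) (use s(2) in \<open>auto simp: crd_put\<close>)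
      then show "g (put s (t j) x) * \<phi> j (crd s x) = v (put s (t j) x) * (\<Prod>s'\<in>insert s A. (\<psi>(s := \<phi> j)) s' (crd s' x))"
        using A(1) s(2) by (simp add: geq[OF y])
      fix s' u assume s': "s' \<in> insert s A"
      show "v (put s (t j) (put s' u x)) = v (put s (t j) x)"
      proof (cases "s' = s")
        case False
        then show ?thesis using s' v[OF y, of s' u] put_commute[of s s'] by auto
      qed simp
    qed
  qed
  then have "(\<Sum>j<N. (\<lambda>x. g (put s (t j) x) * \<phi> j (crd s x))) \<in> span (split_funs k R (insert s A))"
    by (intro span_sum span_base) simp
  with small show "\<exists>h\<in>span (split_funs k R (insert s A)). deriv_small k m d (g - h)" by blast
qed

lemma split_funs_dense:
  fixes f :: "(nat \<Rightarrow> real^'d) \<Rightarrow> real"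
  assumes f: "f \<in> pow_fun k (\<lambda>_. R)" and R: "0 < R" and A: "A \<subseteq> coords k"
  shows "f \<in> smooth_closure k (\<lambda>_. R + 1) (span (split_funs k R A))"
proof -
  have span_sub: "span (split_funs k R B) \<subseteq> pow_fun k (\<lambda>_. R + 1)" for B :: "(nat \<times> 'd) set"
    by (rule span_minimal[OF split_funs_pow_fun subspace_pow_fun])
  have "finite A" using A finite_subset by fastforce
  then show ?thesis using A
  proof (induction A)
    case empty
    have "f \<in> split_funs k R {}" using f by (auto simp: split_funs_def)
    then have "f \<in> span (split_funs k R {})" by (rule span_base)
    then show ?case using smooth_closure_incl[OF span_sub] by blast
  next
    case (insert s A)
    show ?case
    proof (rule smooth_closure_trans[OF _ span_sub insert.IH])
      show "span (split_funs k R A) \<subseteq> smooth_closure k (\<lambda>_. R + 1) (span (split_funs k R (insert s A)))"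
        by (rule span_minimal[OF _ subspace_smooth_closure[OF subspace_span span_sub]])
           (use split_funs_step insert R in blast)
    qed (use insert in simp)
  qed
qed

section \<open>Test functions of product form\<close>

lemma smooth_has_deriv:
  assumes "smooth f"
  shows "((\<lambda>t. foldr pdiff js f (x + t *\<^sub>R axis j 1)) has_real_derivative foldr pdiff (j # js) f x) (at 0)"
  using smoothD(2)[OF assms, of js x j] by (simp add: pdiff_def[of j] DERIV_deriv_iff_field_differentiable)

lemma smooth_iterated:
  assumes G0: "G [] = g"
    and der: "\<And>js j x. ((\<lambda>t. G js (x + t *\<^sub>R axis j 1)) has_real_derivative G (j # js) x) (at 0)"
    and cont: "\<And>js. continuous_on UNIV (G js)"
  shows "smooth g"
proof -
  have *: "foldr pdiff js g = G js" for js
  proof (induction js)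
    case (Cons j js)
    have "pdiff j (G js) x = G (j # js) x" for x
      using DERIV_imp_deriv[OF der[of js x j]] by (simp add: pdiff_def)
    then show ?case using Cons by auto
  qed (simp add: G0)
  show ?thesis using der cont unfolding smooth_def * field_differentiable_def by blast
qed

text \<open>
  Smooth functions with support in the cube of side \<open>2 r\<close> around the origin.
\<close>

definition test_box :: "real \<Rightarrow> (real^'d \<Rightarrow> real) set" where
  "test_box r = {\<xi>. smooth \<xi> \<and> (\<forall>y j. r < \<bar>y $ j\<bar> \<longrightarrow> \<xi> y = 0)}"

lemma test_box_test_fun: "test_box r \<subseteq> test_fun"
proof
  fix \<xi> :: "real^'d \<Rightarrow> real" assume \<xi>: "\<xi> \<in> test_box r"
  show "\<xi> \<in> test_fun"
  proof (rule test_funI[OF _ compact_cbox])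
    show "smooth \<xi>" using \<xi> by (simp add: test_box_def)
    fix y :: "real^'d" assume "y \<notin> cbox (\<chi> j. - r) (\<chi> j. r)"
    then obtain j where "\<not> (- r \<le> y $ j \<and> y $ j \<le> r)" by (auto simp: mem_box_cart)
    then have "r < \<bar>y $ j\<bar>" by linarith
    then show "\<xi> y = 0" using \<xi> unfolding test_box_def by blast
  qed
qed

lemma test_fun_test_box:
  assumes "\<xi> \<in> test_fun"
  obtains r where "\<xi> \<in> test_box r"
proof -
  have "bounded (closure {x. \<xi> x \<noteq> 0})" using test_funD(2)[OF assms] by (rule compact_imp_bounded)
  then obtain r where r: "\<And>x. x \<in> closure {x. \<xi> x \<noteq> 0} \<Longrightarrow> norm x \<le> r" by (auto simp: bounded_iff)
  have "\<xi> y = 0" if "r < \<bar>y $ j\<bar>" for y j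
  proof (rule ccontr)
    assume "\<xi> y \<noteq> 0"
    then have "norm y \<le> r" using r closure_subset[of "{x. \<xi> x \<noteq> 0}"] by blast
    then show False using that component_le_norm_cart[of y j] by simp
  qed
  then show ?thesis using that[of r] test_funD(1)[OF assms] unfolding test_box_def by blast
qed

lemma subspace_test_box: "subspace (test_box r)"
  unfolding subspace_def test_box_def
  by (auto simp: smooth_add smooth_scale scaleR_fun_def zero_fun_def[symmetric] dest: smooth_scale)
     (simp add: zero_fun_def smooth_const)

lemma smooth_coordinate_product:
  fixes \<psi> :: "'d::finite \<Rightarrow> real \<Rightarrow> real"
  assumes \<psi>: "\<And>j. smooth1 (\<psi> j)"
  shows "smooth (\<lambda>y :: real^'d. \<Prod>j\<in>UNIV. \<psi> j (y $ j))"
proof (rule smooth_iterated[where G="\<lambda>js y. \<Prod>j\<in>UNIV. (deriv ^^ count_list js j) (\<psi> j) (y $ j)"])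
  fix js and i :: 'd and x :: "real^'d"
  let ?F = "\<lambda>j. (deriv ^^ count_list js j) (\<psi> j)"
  let ?c = "\<Prod>j\<in>UNIV - {i}. ?F j (x $ j)"
  have eq: "(\<Prod>j\<in>UNIV. ?F j ((x + t *\<^sub>R axis i 1) $ j)) = ?F i (x $ i + t) * ?c" for t
  proof -
    have "(\<Prod>j\<in>UNIV - {i}. ?F j ((x + t *\<^sub>R axis i 1) $ j)) = ?c"
      by (rule prod.cong) (auto simp: axis_def)
    then show ?thesis by (subst prod.remove[of UNIV i]) (auto simp: axis_def)
  qed
  have "(?F i has_real_derivative (deriv ^^ Suc (count_list js i)) (\<psi> i) (x $ i)) (at (0 + x $ i))"
    using smooth1_has_deriv[OF \<psi>] by simp
  then have "((\<lambda>t. ?F i (t + x $ i)) has_real_derivative (deriv ^^ Suc (count_list js i)) (\<psi> i) (x $ i)) (at 0)"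
    by (simp only: DERIV_shift)
  from DERIV_cmult_right[OF this, of ?c]
  have "((\<lambda>t. \<Prod>j\<in>UNIV. ?F j ((x + t *\<^sub>R axis i 1) $ j)) has_real_derivative
      (deriv ^^ Suc (count_list js i)) (\<psi> i) (x $ i) * ?c) (at 0)"
    unfolding eq by (simp add: add.commute)
  also have "(deriv ^^ Suc (count_list js i)) (\<psi> i) (x $ i) * ?c
     = (\<Prod>j\<in>UNIV. (deriv ^^ count_list (i # js) j) (\<psi> j) (x $ j))"
  proof -
    have "?c = (\<Prod>j\<in>UNIV - {i}. (deriv ^^ count_list (i # js) j) (\<psi> j) (x $ j))"
      by (rule prod.cong) auto
    moreover have "(\<Prod>j\<in>UNIV. (deriv ^^ count_list (i # js) j) (\<psi> j) (x $ j)) =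
      (deriv ^^ count_list (i # js) i) (\<psi> i) (x $ i) * (\<Prod>j\<in>UNIV - {i}. (deriv ^^ count_list (i # js) j) (\<psi> j) (x $ j))"
      by (rule prod.remove) simp_all
    moreover have "count_list (i # js) i = Suc (count_list js i)" by simp
    ultimately show ?thesis by (simp only:)
  qed
  finally show "((\<lambda>t. \<Prod>j\<in>UNIV. ?F j ((x + t *\<^sub>R axis i 1) $ j)) has_real_derivative
    (\<Prod>j\<in>UNIV. (deriv ^^ count_list (i # js) j) (\<psi> j) (x $ j))) (at 0)" .
next
  fix js
  show "continuous_on UNIV (\<lambda>y :: real^'d. \<Prod>j\<in>UNIV. (deriv ^^ count_list js j) (\<psi> j) (y $ j))"
  proof (rule continuous_on_prod)
    fix j
    have "continuous_on UNIV (\<lambda>y :: real^'d. y $ j)" by (intro continuous_intros)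
    from continuous_on_compose2[OF smooth1_continuous[OF \<psi>, of UNIV] this]
    show "continuous_on UNIV (\<lambda>y :: real^'d. (deriv ^^ count_list js j) (\<psi> j) (y $ j))" by simp
  qed
qed simp

section \<open>Elementary tensors\<close>

text \<open>
  The elementary tensor with the factors \<open>\<xi> 0, \<dots>, \<xi> (k - 1)\<close>.
\<close>

definition tens :: "nat \<Rightarrow> (nat \<Rightarrow> real^'d \<Rightarrow> real) \<Rightarrow> (nat \<Rightarrow> real^'d) \<Rightarrow> real" where
  "tens k \<xi> x = (if x \<in> points k then \<Prod>i<k. \<xi> i (x i) else 0)"

lemma tensor_pow_tens: "tensor_pow k \<xi> = tens k (\<lambda>_. \<xi>)"
  by (rule ext) (simp add: tensor_pow_def tens_def)

text \<open>
  The directions in which a word differentiates the \<open>i\<close>-th variable.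
\<close>

definition word_at :: "nat \<Rightarrow> (nat \<times> 'd) list \<Rightarrow> 'd list" where
  "word_at i ps = map snd (filter (\<lambda>p. fst p = i) ps)"

lemma tens_derivs:
  fixes \<xi> :: "nat \<Rightarrow> real^'d \<Rightarrow> real"
  assumes \<xi>: "\<And>i. i < k \<Longrightarrow> smooth (\<xi> i)"
  shows "set ps \<subseteq> coords k \<Longrightarrow> wderiv ps (tens k \<xi>) = tens k (\<lambda>i. foldr pdiff (word_at i ps) (\<xi> i))"
    and "smooth_pow k (tens k \<xi>)"
proof -
  let ?w = "\<lambda>ps i. foldr pdiff (word_at i ps) (\<xi> i)"
  let ?G = "\<lambda>ps. tens k (?w ps)"
  have G0: "?G [] = tens k \<xi>" by (simp add: word_at_def)
  have der: "((\<lambda>t. ?G ps (put s t x)) has_real_derivative ?G (s # ps) x) (at (crd s x))"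
    if *: "set ps \<subseteq> coords k" "s \<in> coords k" "x \<in> points k" for ps s x
  proof -
    obtain i j where s: "s = (i, j)" "i < k" using *(2) by auto
    let ?c = "\<Prod>l\<in>{..<k} - {i}. ?w ps l (x l)"
    have eq: "?G ps (put s t x) = ?w ps i (x i + (t - crd s x) *\<^sub>R axis j 1) * ?c" for t
    proof -
      have "put s t x \<in> points k" using * put_in_points by blast
      then have "?G ps (put s t x) = (\<Prod>l<k. ?w ps l (put s t x l))" by (simp add: tens_def)
      also have "\<dots> = ?w ps i (put s t x i) * (\<Prod>l\<in>{..<k} - {i}. ?w ps l (put s t x l))"
        by (rule prod.remove) (use s in auto)
      also have "(\<Prod>l\<in>{..<k} - {i}. ?w ps l (put s t x l)) = ?c"
        by (rule prod.cong) (auto simp: put_def s)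
      also have "put s t x i = x i + (t - crd s x) *\<^sub>R axis j 1" by (simp add: put_def s crd_def)
      finally show ?thesis .
    qed
    have "((\<lambda>t. ?w ps i (x i + t *\<^sub>R axis j 1)) has_real_derivative foldr pdiff (j # word_at i ps) (\<xi> i) (x i)) (at (crd s x + (- crd s x)))"
      using smooth_has_deriv[OF \<xi>[OF s(2)]] by simp
    then have "((\<lambda>t. ?w ps i (x i + (t + (- crd s x)) *\<^sub>R axis j 1)) has_real_derivative foldr pdiff (j # word_at i ps) (\<xi> i) (x i)) (at (crd s x))"
      by (simp only: DERIV_shift)
    from DERIV_cmult_right[OF this, of ?c]
    have "((\<lambda>t. ?G ps (put s t x)) has_real_derivative foldr pdiff (j # word_at i ps) (\<xi> i) (x i) * ?c) (at (crd s x))"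
      unfolding eq by simp
    also have "foldr pdiff (j # word_at i ps) (\<xi> i) (x i) * ?c = ?G (s # ps) x"
    proof -
      have "?c = (\<Prod>l\<in>{..<k} - {i}. ?w (s # ps) l (x l))"
        by (rule prod.cong) (auto simp: word_at_def s)
      moreover have "?w (s # ps) i (x i) = foldr pdiff (j # word_at i ps) (\<xi> i) (x i)"
        by (simp add: word_at_def s)
      moreover have "(\<Prod>l<k. ?w (s # ps) l (x l)) = ?w (s # ps) i (x i) * (\<Prod>l\<in>{..<k} - {i}. ?w (s # ps) l (x l))"
        by (rule prod.remove) (use s in auto)
      ultimately show ?thesis using *(3) by (simp only: tens_def if_True)
    qed
    finally show ?thesis .
  qed
  have zero: "?G ps x = 0" if "set ps \<subseteq> coords k" "x \<notin> points k" for ps x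
    using that by (simp add: tens_def)
  have cont: "continuous_on (points k) (?G ps)" if "set ps \<subseteq> coords k" for ps
  proof -
    have "continuous_on (points k) (\<lambda>x. \<Prod>i<k. ?w ps i (x i))"
    proof (rule continuous_on_prod)
      fix i assume i: "i \<in> {..<k}"
      have "continuous_on (points k) (\<lambda>x :: nat \<Rightarrow> real^'d. x i)"
        by (rule continuous_on_subset[OF continuous_on_product_coordinates]) simp
      from continuous_on_compose2[OF smoothD(1)[OF \<xi>] this] i
      show "continuous_on (points k) (\<lambda>x. ?w ps i (x i))" by simp
    qed
    then show ?thesis by (rule continuous_on_eq) (simp add: tens_def)
  qed
  show "smooth_pow k (tens k \<xi>)" by (rule smooth_pow_iterated(2)[where G="?G", OF G0 der zero cont])
  show "wderiv ps (tens k \<xi>) = ?G ps" if "set ps \<subseteq> coords k"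
    by (rule smooth_pow_iterated(1)[where G="?G", OF G0 der zero cont that])
qed

lemma tens_pow_fun:
  assumes \<xi>: "\<And>i. i < k \<Longrightarrow> \<xi> i \<in> test_box r"
  shows "tens k \<xi> \<in> pow_fun k (\<lambda>_. r)"
proof -
  have "tens k \<xi> x = 0" if s: "s \<in> coords k" "r < \<bar>crd s x\<bar>" for s x
  proof -
    have "\<xi> (fst s) \<in> test_box r" using \<xi> s by auto
    then have "\<xi> (fst s) (x (fst s)) = 0" using s(2) unfolding test_box_def crd_def by blast
    then show ?thesis using s by (auto simp: tens_def intro!: prod_zero)
  qed
  moreover have "smooth_pow k (tens k \<xi>)" by (rule tens_derivs(2)) (use \<xi> in \<open>auto simp: test_box_def\<close>)
  moreover have "tens k \<xi> x = 0" if "x \<notin> points k" for x using that by (simp add: tens_def)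
  ultimately show ?thesis unfolding pow_fun_def by blast
qed

lemma constant_of_put_invariant:
  fixes v :: "(nat \<Rightarrow> real^'d) \<Rightarrow> real"
  assumes v: "\<And>x s t. x \<in> points k \<Longrightarrow> s \<in> coords k \<Longrightarrow> v (put s t x) = v x"
  obtains c where "\<And>x. x \<in> points k \<Longrightarrow> v x = c"
proof -
  define clear where "clear A x = (\<lambda>i. if i < k then (\<chi> j. if (i, j) \<in> A then 0 else x i $ j) else undefined)"
    for A and x :: "nat \<Rightarrow> real^'d"
  have pts: "clear A x \<in> points k" for A x by (simp add: clear_def mem_points)
  have inv: "v (clear A x) = v x" if A: "finite A" "A \<subseteq> coords k" and x: "x \<in> points k" for A x
    using A
  proof (induction A)
    case empty
    have "clear {} x = x" using x by (auto simp: clear_def mem_points vec_eq_iff fun_eq_iff)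
    then show ?case by simp
  next
    case (insert s A)
    have "clear (insert s A) x = put s 0 (clear A x)"
      using insert by (cases s) (auto simp: clear_def put_def axis_def vec_eq_iff fun_eq_iff)
    then show ?case using insert v[OF pts] by simp
  qed
  have all: "clear (coords k) x = clear (coords k) (\<lambda>_. 0)" for x by (simp add: clear_def fun_eq_iff)
  have "v x = v (clear (coords k) (\<lambda>_. 0))" if "x \<in> points k" for x
    using inv[OF _ subset_refl that] all[of x] by simp
  then show ?thesis by (rule that)
qed

text \<open>
  A function from which every coordinate has been split off is a multiple of an elementary tensor. The set
  \<open>A\<close> is a variable, equated to the set of all coordinates, so that automation treats it as opaque.
\<close>

lemma split_funs_all:
  fixes g :: "(nat \<Rightarrow> real^'d) \<Rightarrow> real"
  assumes g: "g \<in> split_funs k R A" and A: "A = coords k"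
  obtains c \<xi> where "\<And>i. i < k \<Longrightarrow> \<xi> i \<in> test_box (R + 1)" "g = c *\<^sub>R tens k \<xi>"
proof -
  have gp: "g \<in> pow_fun k (\<lambda>_. R + 1)" using g split_funs_pow_fun by blast
  obtain v \<psi> where \<psi>: "\<And>s. s \<in> A \<Longrightarrow> smooth1 (\<psi> s)" "\<And>s u. s \<in> A \<Longrightarrow> R + 1 < \<bar>u\<bar> \<Longrightarrow> \<psi> s u = 0"
    and geq: "\<And>x. x \<in> points k \<Longrightarrow> g x = v x * (\<Prod>s\<in>A. \<psi> s (crd s x))"
    and v: "\<And>x s t. x \<in> points k \<Longrightarrow> s \<in> A \<Longrightarrow> v (put s t x) = v x"
    using g unfolding split_funs_def by blast
  note \<psi> = \<psi>[unfolded A] and geq = geq[unfolded A] and v = v[unfolded A]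
  obtain c where c: "\<And>x. x \<in> points k \<Longrightarrow> v x = c" by (rule constant_of_put_invariant[of k v]) (use v in auto)
  define \<xi> where "\<xi> i y = (\<Prod>j\<in>UNIV. \<psi> (i, j) (y $ j))" for i and y :: "real^'d"
  show ?thesis
  proof (rule that[of \<xi> c])
    fix i assume i: "i < k"
    have "smooth (\<xi> i)" unfolding \<xi>_def[abs_def] by (rule smooth_coordinate_product) (use \<psi>(1) i in auto)
    moreover have "\<xi> i y = 0" if "R + 1 < \<bar>y $ j\<bar>" for y j
      using \<psi>(2)[of "(i, j)" "y $ j"] that i by (auto simp: \<xi>_def intro!: prod_zero)
    ultimately show "\<xi> i \<in> test_box (R + 1)" unfolding test_box_def by blast
  next
    have "g x = c * tens k \<xi> x" for x
    proof (cases "x \<in> points k")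
      case True
      have "(\<Prod>s\<in>coords k. \<psi> s (crd s x)) = (\<Prod>i<k. \<xi> i (x i))"
        by (simp add: \<xi>_def prod.cartesian_product crd_def case_prod_beta)
      then show ?thesis using True by (simp add: geq c tens_def)
    qed (simp add: tens_def pow_funD(2)[OF gp])
    then show "g = c *\<^sub>R tens k \<xi>" by (simp add: scaleR_fun_def fun_eq_iff)
  qed
qed

section \<open>Symmetrization\<close>

text \<open>
  The word that \<open>ps\<close> becomes when \<open>f \<circ> (\<lambda>x. x \<circ> \<pi>)\<close> is differentiated along \<open>ps\<close> by the chain rule.
\<close>

definition perm_word :: "(nat \<Rightarrow> nat) \<Rightarrow> (nat \<times> 'd) list \<Rightarrow> (nat \<times> 'd) list" where
  "perm_word \<pi> ps = map (\<lambda>p. (inv \<pi> (fst p), snd p)) ps"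

lemma perm_point: "\<pi> permutes {..<k} \<Longrightarrow> x \<circ> \<pi> \<in> points k \<longleftrightarrow> x \<in> points k"
  by (simp add: mem_points permutes_not_in)

lemma set_perm_word:
  assumes "\<pi> permutes {..<k}" "set ps \<subseteq> coords k"
  shows "set (perm_word \<pi> ps) \<subseteq> coords k"
proof -
  have "inv \<pi> i < k" if "i < k" for i
    using permutes_in_image[OF permutes_inv[OF assms(1)], of i] that by simp
  then show ?thesis using assms(2) by (auto simp: perm_word_def)
qed

lemma put_perm:
  assumes "\<pi> permutes {..<k}"
  shows "put s t x \<circ> \<pi> = put (inv \<pi> (fst s), snd s) t (x \<circ> \<pi>)"
proof
  fix l
  have "\<pi> l = fst s \<longleftrightarrow> l = inv \<pi> (fst s)" using permutes_inv_eq[OF assms, of "fst s" l] by auto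
  moreover have "\<pi> (inv \<pi> (fst s)) = fst s" by (rule permutes_inverses(1)[OF assms])
  ultimately show "(put s t x \<circ> \<pi>) l = put (inv \<pi> (fst s), snd s) t (x \<circ> \<pi>) l"
    by (auto simp: put_def)
qed

lemma crd_perm: "\<pi> permutes {..<k} \<Longrightarrow> crd (inv \<pi> (fst s), snd s) (x \<circ> \<pi>) = crd s x"
  by (simp add: crd_def permutes_inverses(1))

lemma perm_derivs:
  fixes f :: "(nat \<Rightarrow> real^'d) \<Rightarrow> real"
  assumes f: "f \<in> pow_fun k (\<lambda>_. r)" and \<pi>: "\<pi> permutes {..<k}"
  shows "set ps \<subseteq> coords k \<Longrightarrow> wderiv ps (\<lambda>x. f (x \<circ> \<pi>)) = (\<lambda>x. wderiv (perm_word \<pi> ps) f (x \<circ> \<pi>))"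
    and "(\<lambda>x. f (x \<circ> \<pi>)) \<in> pow_fun k (\<lambda>_. r)"
proof -
  let ?G = "\<lambda>ps x. wderiv (perm_word \<pi> ps) f (x \<circ> \<pi>)"
  have G0: "?G [] = (\<lambda>x. f (x \<circ> \<pi>))" by (simp add: perm_word_def)
  have der: "((\<lambda>t. ?G ps (put s t x)) has_real_derivative ?G (s # ps) x) (at (crd s x))"
    if *: "set ps \<subseteq> coords k" "s \<in> coords k" "x \<in> points k" for ps s x
  proof -
    let ?s = "(inv \<pi> (fst s), snd s)"
    have s: "?s \<in> coords k" using set_perm_word[OF \<pi>, of "[s]"] *(2) by (simp add: perm_word_def)
    have x: "x \<circ> \<pi> \<in> points k" using perm_point[OF \<pi>] *(3) by blast
    note smooth_pow_has_deriv[OF pow_funD(1)[OF f] set_perm_word[OF \<pi> *(1)] s x, of "crd ?s (x \<circ> \<pi>)", unfolded put_crd]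
    then show ?thesis unfolding crd_perm[OF \<pi>] put_perm[OF \<pi>] by (simp add: perm_word_def)
  qed
  have zero: "?G ps x = 0" if "set ps \<subseteq> coords k" "x \<notin> points k" for ps x
    using pow_fun_wderiv_off_points[OF f set_perm_word[OF \<pi> that(1)]] perm_point[OF \<pi>] that(2) by blast
  have cont: "continuous_on (points k) (?G ps)" if "set ps \<subseteq> coords k" for ps
  proof -
    have "continuous_on (points k) (\<lambda>x :: nat \<Rightarrow> real^'d. x \<circ> \<pi>)"
    proof (rule continuous_on_coordinatewise_then_product)
      show "continuous_on (points k) (\<lambda>x :: nat \<Rightarrow> real^'d. (x \<circ> \<pi>) i)" for i
        unfolding comp_apply by (rule continuous_on_subset[OF continuous_on_product_coordinates]) simp
    qed
    from continuous_on_compose2[OF smooth_pow_continuous[OF pow_funD(1)[OF f] set_perm_word[OF \<pi> that]] this]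
    show ?thesis using perm_point[OF \<pi>] by blast
  qed
  show "wderiv ps (\<lambda>x. f (x \<circ> \<pi>)) = ?G ps" if "set ps \<subseteq> coords k"
    by (rule smooth_pow_iterated(1)[where G="?G", OF G0 der zero cont that])
  have "smooth_pow k (\<lambda>x. f (x \<circ> \<pi>))" by (rule smooth_pow_iterated(2)[where G="?G", OF G0 der zero cont])
  moreover have "f (x \<circ> \<pi>) = 0" if "x \<notin> points k" for x
    using pow_funD(2)[OF f] perm_point[OF \<pi>] that by blast
  moreover have "f (x \<circ> \<pi>) = 0" if "s \<in> coords k" "r < \<bar>crd s x\<bar>" for s x
  proof (rule pow_funD(3)[OF f])
    show "(inv \<pi> (fst s), snd s) \<in> coords k" using set_perm_word[OF \<pi>, of "[s]"] that(1) by (simp add: perm_word_def)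
    show "r < \<bar>crd (inv \<pi> (fst s), snd s) (x \<circ> \<pi>)\<bar>" unfolding crd_perm[OF \<pi>] by (rule that(2))
  qed
  ultimately show "(\<lambda>x. f (x \<circ> \<pi>)) \<in> pow_fun k (\<lambda>_. r)" unfolding pow_fun_def by blast
qed

text \<open>
  The average over all permutations of the variables.
\<close>

definition sym_avg :: "nat \<Rightarrow> ((nat \<Rightarrow> real^'d) \<Rightarrow> real) \<Rightarrow> (nat \<Rightarrow> real^'d) \<Rightarrow> real" where
  "sym_avg k f = (\<Sum>\<pi>\<in>{\<pi>. \<pi> permutes {..<k}}. (1 / fact k) *\<^sub>R (\<lambda>x. f (x \<circ> \<pi>)))"

lemma sym_avg_apply: "sym_avg k f x = (\<Sum>\<pi>\<in>{\<pi>. \<pi> permutes {..<k}}. f (x \<circ> \<pi>)) / fact k"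
  by (simp add: sym_avg_def sum_fun_apply scaleR_fun_def sum_divide_distrib)

lemma card_perms: "card {\<pi>. \<pi> permutes {..<k}} = fact k"
  by (rule card_permutations) auto

lemma linear_sym_avg: "linear (sym_avg k)"
proof (rule linearI)
  show "sym_avg k (f + g) = sym_avg k f + sym_avg k g" for f g
    by (rule ext) (simp add: sym_avg_apply sum.distrib add_divide_distrib)
  show "sym_avg k (c *\<^sub>R f) = c *\<^sub>R sym_avg k f" for c f
    by (rule ext) (simp add: sym_avg_apply scaleR_fun_def sum_distrib_left)
qed

lemma sym_avg_deriv_small:
  fixes h :: "(nat \<Rightarrow> real^'d) \<Rightarrow> real"
  assumes h: "h \<in> pow_fun k (\<lambda>_. r)" and small: "deriv_small k m d h"
  shows "deriv_small k m d (sym_avg k h)"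
  unfolding deriv_small_def
proof (intro allI impI)
  fix ps :: "(nat \<times> 'd) list" and x :: "nat \<Rightarrow> real^'d" assume ps: "set ps \<subseteq> coords k \<and> length ps \<le> m"
  let ?P = "{\<pi>. \<pi> permutes {..<k}}"
  have "wderiv ps (sym_avg k h) = (\<Sum>\<pi>\<in>?P. (1 / fact k) *\<^sub>R wderiv ps (\<lambda>x. h (x \<circ> \<pi>)))"
    unfolding sym_avg_def
    by (rule linear_map_on_sum[OF linear_map_on_wderiv subspace_pow_fun]) (use ps perm_derivs(2)[OF h] in auto)
  also have "\<dots> = (\<Sum>\<pi>\<in>?P. (1 / fact k) *\<^sub>R (\<lambda>x. wderiv (perm_word \<pi> ps) h (x \<circ> \<pi>)))"
    by (rule sum.cong) (use ps perm_derivs(1)[OF h] in auto)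
  finally have "wderiv ps (sym_avg k h) x = (\<Sum>\<pi>\<in>?P. wderiv (perm_word \<pi> ps) h (x \<circ> \<pi>)) / fact k"
    by (simp add: sum_fun_apply scaleR_fun_def sum_divide_distrib)
  moreover have "\<bar>\<Sum>\<pi>\<in>?P. wderiv (perm_word \<pi> ps) h (x \<circ> \<pi>)\<bar> \<le> (\<Sum>\<pi>\<in>?P. d)"
  proof (rule order_trans[OF sum_abs sum_mono])
    fix \<pi> assume "\<pi> \<in> ?P"
    then have "set (perm_word \<pi> ps) \<subseteq> coords k" using ps by (intro set_perm_word) auto
    moreover have "length (perm_word \<pi> ps) \<le> m" using ps by (simp add: perm_word_def)
    ultimately show "\<bar>wderiv (perm_word \<pi> ps) h (x \<circ> \<pi>)\<bar> \<le> d" using small unfolding deriv_small_def by blast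
  qed
  ultimately show "\<bar>wderiv ps (sym_avg k h) x\<bar> \<le> d" by (simp add: card_perms abs_divide pos_divide_le_eq mult.commute)
qed

lemma sym_avg_sym:
  assumes "f \<in> sym_test_fun k"
  shows "sym_avg k f = f"
proof
  fix x
  have "f (x \<circ> \<pi>) = f x" if "\<pi> permutes {..<k}" for \<pi>
    using sym_test_funD(2)[OF assms that, of x] perm_point[OF that, of x] assms
    by (cases "x \<in> points k") (auto simp: sym_test_fun_def)
  then have "(\<Sum>\<pi>\<in>{\<pi>. \<pi> permutes {..<k}}. f (x \<circ> \<pi>)) = (\<Sum>\<pi>\<in>{\<pi>. \<pi> permutes {..<k}}. f x)"
    by (intro sum.cong) auto
  then show "sym_avg k f x = f x" by (simp add: sym_avg_apply card_perms)
qed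

section \<open>Polarization\<close>

lemma alternating_superset_sum:
  assumes U: "finite U" and T: "T \<subseteq> U"
  shows "(\<Sum>S\<in>{S. T \<subseteq> S \<and> S \<subseteq> U}. (-1) ^ (card U + card S)) = (if T = U then 1 else 0 :: real)"
proof (cases "T = U")
  case True
  then have "{S. T \<subseteq> S \<and> S \<subseteq> U} = {U}" by auto
  then show ?thesis using True by (simp add: power_add[symmetric] flip: mult_2)
next
  case False
  then obtain u where u: "u \<in> U" "u \<notin> T" using T by blast
  let ?A = "{S. T \<subseteq> S \<and> S \<subseteq> U}"
  let ?f = "\<lambda>S. (-1 :: real) ^ (card U + card S)"
  \<comment> \<open>toggling membership of \<open>u\<close> is an involution that reverses the sign\<close>
  define t where "t S = (if u \<in> S then S - {u} else insert u S)" for S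
  have tt: "t (t S) = S" for S by (auto simp: t_def)
  have tA: "t S \<in> ?A" if "S \<in> ?A" for S using that u by (auto simp: t_def)
  have neg: "?f (t S) = - ?f S" if "S \<in> ?A" for S
  proof (cases "u \<in> S")
    case True
    have "finite S" using that U finite_subset by blast
    then have "card U + card S = Suc (card U + card (S - {u}))" using card.remove[OF _ True] by simp
    then have "?f S = - ?f (S - {u})" by (simp only: power_Suc)
    then show ?thesis using True by (simp only: t_def if_True minus_minus)
  next
    case False
    have "finite S" using that U finite_subset by blast
    then show ?thesis using False by (simp add: t_def)
  qed
  have "sum ?f ?A = (\<Sum>S\<in>?A. ?f (t S))"
    by (rule sum.reindex_bij_witness[where i=t and j=t]) (simp_all only: tt tA)
  also have "\<dots> = (\<Sum>S\<in>?A. - ?f S)" by (rule sum.cong) (use neg in auto)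
  finally show ?thesis using False by (simp add: sum_negf)
qed

text \<open>
  Ryser's formula for the permanent. Expanding the product on the right yields all maps \<open>h\<close> from the indices
  to themselves; the alternating sum over the sets \<open>S\<close> that contain the image of \<open>h\<close> keeps the surjective
  ones.
\<close>

lemma permanent_polarization:
  fixes a :: "nat \<Rightarrow> nat \<Rightarrow> real"
  shows "(\<Sum>\<pi>\<in>{\<pi>. \<pi> permutes {..<k}}. \<Prod>i<k. a (\<pi> i) i)
     = (\<Sum>S\<in>Pow {..<k}. (-1) ^ (k + card S) * (\<Prod>i<k. \<Sum>s\<in>S. a s i))"
proof -
  let ?U = "{..<k}"
  let ?H = "PiE ?U (\<lambda>_. ?U)"
  let ?P = "\<lambda>h. \<Prod>i<k. a (h i) i"
  have finH: "finite ?H" by (intro finite_PiE) auto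
  have "(\<Sum>S\<in>Pow ?U. (-1) ^ (k + card S) * (\<Prod>i<k. \<Sum>s\<in>S. a s i))
      = (\<Sum>S\<in>Pow ?U. \<Sum>h\<in>?H. if h ` ?U \<subseteq> S then (-1) ^ (k + card S) * ?P h else 0)"
  proof (rule sum.cong[OF refl])
    fix S assume S: "S \<in> Pow ?U"
    then have fin: "finite S" using finite_subset by auto
    have "(\<Prod>i<k. \<Sum>s\<in>S. a s i) = (\<Sum>h\<in>PiE ?U (\<lambda>_. S). ?P h)"
      by (subst prod_sum_PiE) (use fin in auto)
    also have "PiE ?U (\<lambda>_. S) = {h \<in> ?H. h ` ?U \<subseteq> S}"
      using S by (auto simp: PiE_iff extensional_def)
    finally show "(-1) ^ (k + card S) * (\<Prod>i<k. \<Sum>s\<in>S. a s i)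
       = (\<Sum>h\<in>?H. if h ` ?U \<subseteq> S then (-1) ^ (k + card S) * ?P h else 0)"
      by (simp add: sum.inter_filter[OF finH] sum_distrib_left if_distrib cong: if_cong)
  qed
  also have "\<dots> = (\<Sum>h\<in>?H. \<Sum>S\<in>Pow ?U. if h ` ?U \<subseteq> S then (-1) ^ (k + card S) * ?P h else 0)"
    by (rule sum.swap)
  also have "\<dots> = (\<Sum>h\<in>?H. if h ` ?U = ?U then ?P h else 0)"
  proof (rule sum.cong[OF refl])
    fix h assume h: "h \<in> ?H"
    have "(\<Sum>S\<in>Pow ?U. if h ` ?U \<subseteq> S then (-1) ^ (k + card S) * ?P h else 0)
       = (\<Sum>S\<in>{S \<in> Pow ?U. h ` ?U \<subseteq> S}. (-1) ^ (k + card S) * ?P h)"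
      by (rule sum.inter_filter[symmetric]) simp
    also have "\<dots> = (\<Sum>S\<in>{S. h ` ?U \<subseteq> S \<and> S \<subseteq> ?U}. (-1) ^ (card ?U + card S)) * ?P h"
      by (simp add: sum_distrib_right Pow_def conj_commute)
    also have "\<dots> = (if h ` ?U = ?U then ?P h else 0)"
      by (subst alternating_superset_sum) (use h in auto)
    finally show "(\<Sum>S\<in>Pow ?U. if h ` ?U \<subseteq> S then (-1) ^ (k + card S) * ?P h else 0) = (if h ` ?U = ?U then ?P h else 0)" .
  qed
  also have "\<dots> = (\<Sum>h\<in>{h \<in> ?H. h ` ?U = ?U}. ?P h)" by (rule sum.inter_filter[symmetric, OF finH])
  also have "\<dots> = (\<Sum>\<pi>\<in>{\<pi>. \<pi> permutes ?U}. ?P \<pi>)"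
  proof (rule sum.reindex_bij_witness[where j="\<lambda>h i. if i < k then h i else i" and i="\<lambda>\<pi>. restrict \<pi> ?U"])
    fix h assume h: "h \<in> {h \<in> ?H. h ` ?U = ?U}"
    then show "restrict (\<lambda>i. if i < k then h i else i) ?U = h" by (auto simp: PiE_iff extensional_def)
    have "inj_on h ?U" using h by (intro eq_card_imp_inj_on) auto
    then have "bij_betw (\<lambda>i. if i < k then h i else i) ?U ?U"
      using h by (auto simp: bij_betw_def inj_on_def image_def)
    then have "(\<lambda>i. if i < k then h i else i) permutes ?U" by (rule bij_imp_permutes) simp
    then show "(\<lambda>i. if i < k then h i else i) \<in> {\<pi>. \<pi> permutes ?U}" by simp
    show "?P (\<lambda>i. if i < k then h i else i) = ?P h" by (rule prod.cong) auto
  next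
    fix \<pi> assume \<pi>: "\<pi> \<in> {\<pi>. \<pi> permutes ?U}"
    then show "(\<lambda>i. if i < k then restrict \<pi> ?U i else i) = \<pi>" by (auto simp: permutes_not_in)
    have "restrict \<pi> ?U ` ?U = ?U" using permutes_image[of \<pi> ?U] \<pi> by simp
    moreover have "restrict \<pi> ?U \<in> ?H" using permutes_in_image[of \<pi> ?U] \<pi> by auto
    ultimately show "restrict \<pi> ?U \<in> {h \<in> ?H. h ` ?U = ?U}" by blast
  qed
  finally show ?thesis by simp
qed

lemma sym_avg_tens:
  fixes \<xi> :: "nat \<Rightarrow> real^'d \<Rightarrow> real"
  shows "sym_avg k (tens k \<xi>) = (\<Sum>S\<in>Pow {..<k}. ((-1) ^ (k + card S) / fact k) *\<^sub>R tensor_pow k (\<Sum>s\<in>S. \<xi> s))"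
proof
  fix x
  let ?P = "{\<pi>. \<pi> permutes {..<k}}"
  show "sym_avg k (tens k \<xi>) x = (\<Sum>S\<in>Pow {..<k}. ((-1) ^ (k + card S) / fact k) *\<^sub>R tensor_pow k (\<Sum>s\<in>S. \<xi> s)) x"
  proof (cases "x \<in> points k")
    case True
    have "(\<Sum>\<pi>\<in>?P. tens k \<xi> (x \<circ> \<pi>)) = (\<Sum>\<pi>\<in>?P. \<Prod>i<k. \<xi> i (x (\<pi> i)))"
      by (rule sum.cong) (use True perm_point in \<open>auto simp: tens_def\<close>)
    also have "\<dots> = (\<Sum>\<pi>\<in>?P. \<Prod>i<k. \<xi> i (x (inv \<pi> i)))" by (rule sum_permutations_inverse)
    also have "\<dots> = (\<Sum>\<pi>\<in>?P. \<Prod>i<k. \<xi> (\<pi> i) (x i))"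
    proof (rule sum.cong[OF refl])
      fix \<pi> assume "\<pi> \<in> ?P"
      then have \<pi>: "\<pi> permutes {..<k}" by simp
      have "(\<Prod>i<k. \<xi> i (x (inv \<pi> i))) = (\<Prod>i<k. \<xi> (\<pi> i) (x (inv \<pi> (\<pi> i))))"
        using prod.permute[OF \<pi>, of "\<lambda>i. \<xi> i (x (inv \<pi> i))"] by simp
      then show "(\<Prod>i<k. \<xi> i (x (inv \<pi> i))) = (\<Prod>i<k. \<xi> (\<pi> i) (x i))"
        by (simp add: permutes_inverses(2)[OF \<pi>])
    qed
    also have "\<dots> = (\<Sum>S\<in>Pow {..<k}. (-1) ^ (k + card S) * (\<Prod>i<k. \<Sum>s\<in>S. \<xi> s (x i)))"
      by (rule permanent_polarization)
    finally show ?thesis using True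
      by (simp add: sym_avg_apply sum_fun_apply scaleR_fun_def tensor_pow_def sum_divide_distrib)
  next
    case False
    then have "tens k \<xi> (x \<circ> \<pi>) = 0" if "\<pi> permutes {..<k}" for \<pi> using perm_point[OF that] by (auto simp: tens_def)
    then show ?thesis using False
      by (simp add: sym_avg_apply sum_fun_apply scaleR_fun_def tensor_pow_def)
  qed
qed

lemma tensor_pow_sym_test_fun:
  assumes "\<xi> \<in> test_fun"
  shows "tensor_pow k \<xi> \<in> sym_test_fun k"
proof -
  obtain r where r: "\<xi> \<in> test_box r" by (rule test_fun_test_box[OF assms])
  show ?thesis
  proof (rule sym_test_funI)
    show "tensor_pow k \<xi> \<in> pow_fun k (\<lambda>_. r)" unfolding tensor_pow_tens by (rule tens_pow_fun) (rule r)
    fix \<pi> and x :: "nat \<Rightarrow> real^'a" assume *: "\<pi> permutes {..<k}" "x \<in> points k"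
    then have "x \<circ> \<pi> \<in> points k" using perm_point by blast
    moreover have "(\<Prod>i<k. \<xi> ((x \<circ> \<pi>) i)) = (\<Prod>i<k. \<xi> (x i))"
      using prod.permute[OF *(1), of "\<lambda>i. \<xi> (x i)"] by (simp add: comp_def)
    ultimately show "tensor_pow k \<xi> (x \<circ> \<pi>) = tensor_pow k \<xi> x" using *(2) by (simp add: tensor_pow_def)
  qed
qed

text \<open>
  Symmetrization preserves closeness and fixes \<open>f\<close>, and it maps elementary tensors into the span of the
  tensor powers.
\<close>

lemma tensor_pow_dense_smooth:
  fixes f :: "(nat \<Rightarrow> real^'d) \<Rightarrow> real"
  assumes f: "f \<in> sym_test_fun k"
  obtains r where "f \<in> pow_fun k (\<lambda>_. r)"
    "\<And>m d. 0 < d \<Longrightarrow> \<exists>g\<in>span (tensor_pow k ` test_box r). g \<in> pow_fun k (\<lambda>_. r) \<and> deriv_small k m d (f - g)"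
proof -
  obtain R0 where "f \<in> pow_fun k (\<lambda>_. R0)" using sym_test_funD(1)[OF f] by blast
  then have fR: "f \<in> pow_fun k (\<lambda>_. max R0 1)" (is "f \<in> pow_fun k (\<lambda>_. ?R)") by (rule pow_fun_mono) simp
  then have "f \<in> smooth_closure k (\<lambda>_. ?R + 1) (span (split_funs k ?R (coords k)))"
    by (rule split_funs_dense) auto
  note cl = this
  let ?r = "?R + 1"
  have fr: "f \<in> pow_fun k (\<lambda>_. ?r)" using cl by (simp add: smooth_closure_def)
  have box: "tensor_pow k ` test_box ?r \<subseteq> pow_fun k (\<lambda>_. ?r)"
    unfolding tensor_pow_tens by (auto intro!: tens_pow_fun)
  have avg: "sym_avg k g \<in> span (tensor_pow k ` test_box ?r)" if g: "g \<in> split_funs k ?R (coords k)" for g :: "(nat \<Rightarrow> real^'d) \<Rightarrow> real"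
  proof -
    obtain c \<xi> where \<xi>: "\<And>i. i < k \<Longrightarrow> \<xi> i \<in> test_box ?r" and eq: "g = c *\<^sub>R tens k \<xi>"
      by (rule split_funs_all[OF g refl]) blast
    have "(\<Sum>s\<in>S. \<xi> s) \<in> test_box ?r" if "S \<in> Pow {..<k}" for S
      by (rule subspace_sum[OF subspace_test_box]) (use that \<xi> in auto)
    then have "sym_avg k (tens k \<xi>) \<in> span (tensor_pow k ` test_box ?r)"
      unfolding sym_avg_tens by (intro span_sum span_scale span_base imageI)
    then show ?thesis unfolding eq linear_scale[OF linear_sym_avg] by (rule span_scale)
  qed
  have avg_span: "sym_avg k g \<in> span (tensor_pow k ` test_box ?r)" if "g \<in> span (split_funs k ?R (coords k))" for g :: "(nat \<Rightarrow> real^'d) \<Rightarrow> real"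
  proof -
    let ?W = "split_funs k ?R (coords k) :: ((nat \<Rightarrow> real^'d) \<Rightarrow> real) set"
    have "sym_avg k ` span ?W = span (sym_avg k ` ?W)"
      using linear_span_image[OF linear_sym_avg] by metis
    moreover have "sym_avg k ` ?W \<subseteq> span (tensor_pow k ` test_box ?r)"
      by (intro image_subsetI avg)
    then have "span (sym_avg k ` ?W) \<subseteq> span (tensor_pow k ` test_box ?r)"
      by (rule span_minimal[OF _ subspace_span])
    ultimately show ?thesis using that by blast
  qed
  show ?thesis
  proof (rule that[OF fr])
    fix m and d :: real assume "0 < d"
    then obtain g where g: "g \<in> span (split_funs k ?R (coords k))" "deriv_small k m d (f - g)"
      using smooth_closureD[OF cl] by blast
    have gr: "g \<in> pow_fun k (\<lambda>_. ?r)"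
      using g(1) span_minimal[OF split_funs_pow_fun subspace_pow_fun, of k ?R] by blast
    have "sym_avg k (f - g) = f - sym_avg k g"
      by (simp add: linear_diff[OF linear_sym_avg] sym_avg_sym[OF f])
    then have "deriv_small k m d (f - sym_avg k g)"
      using sym_avg_deriv_small[OF subspace_diff[OF subspace_pow_fun fr gr] g(2)] by simp
    moreover have "sym_avg k g \<in> pow_fun k (\<lambda>_. ?r)"
      using avg_span[OF g(1)] span_minimal[OF box subspace_pow_fun] by blast
    ultimately show "\<exists>g\<in>span (tensor_pow k ` test_box ?r). g \<in> pow_fun k (\<lambda>_. ?r) \<and> deriv_small k m d (f - g)"
      using avg_span[OF g(1)] by blast
  qed
qed

section \<open>Density in the Sobolev norms\<close>

lemma sobolev_norm_pow_small:
  fixes \<tau> :: "nat \<times> (real^'d \<Rightarrow> real)"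
  assumes \<tau>: "\<tau> \<in> weights"
  obtains K where "0 \<le> K" "\<And>h d. h \<in> pow_fun k (\<lambda>_. r) \<Longrightarrow> 0 \<le> d \<Longrightarrow> deriv_small k (k * fst \<tau>) d h \<Longrightarrow> sobolev_norm_pow k \<tau> h \<le> K * d"
proof -
  let ?M = "PiM {..<k} (\<lambda>_. lborel :: (real^'d) measure)"
  let ?box = "pow_box k (\<lambda>_. r) :: (nat \<Rightarrow> real^'d) set"
  let ?W = "\<lambda>x :: nat \<Rightarrow> real^'d. \<Prod>i<k. snd \<tau> (x i)"
  let ?J = "PiE {..<k} (\<lambda>_. {js :: 'd list. length js \<le> fst \<tau>})"
  have "bounded (?W ` ?box)"
    by (intro compact_imp_bounded compact_continuous_image compact_pow_box continuous_weight_prod \<tau>)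
  then obtain B0 where B0: "\<And>x. x \<in> ?box \<Longrightarrow> \<bar>?W x\<bar> \<le> B0" by (auto simp: bounded_iff)
  define B where "B = max B0 0"
  have B: "0 \<le> B" "\<And>x. x \<in> ?box \<Longrightarrow> ?W x \<le> B" using B0 by (force simp: B_def)+
  let ?K = "sqrt (real (card ?J) * (B * measure ?M ?box))"
  show ?thesis
  proof (rule that[of ?K])
    show "0 \<le> ?K" using B(1) by simp
    fix h :: "(nat \<Rightarrow> real^'d) \<Rightarrow> real" and d :: real assume h: "h \<in> pow_fun k (\<lambda>_. r)" and d: "0 \<le> d" and small: "deriv_small k (k * fst \<tau>) d h"
    have "(LINT x|?M. (wderiv (jword k J) h x)\<^sup>2 * ?W x) \<le> d\<^sup>2 * B * measure ?M ?box" if J: "J \<in> ?J" for J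
    proof -
      have len: "length (jword k J) \<le> k * fst \<tau>" by (rule length_jword) (use J in \<open>auto simp: PiE_iff\<close>)
      have int: "integrable ?M (indicator ?box :: _ \<Rightarrow> real)"
        by (rule integrable_real_indicator) (use emeasure_pow_box_finite[of k "\<lambda>_. r"] in simp_all)
      have "(LINT x|?M. (wderiv (jword k J) h x)\<^sup>2 * ?W x) \<le> (LINT x|?M. (d\<^sup>2 * B) * indicator ?box x)"
      proof (rule integral_mono'[OF integrable_mult_right[OF int]])
        fix x
        show "0 \<le> d\<^sup>2 * B * indicator ?box x" using B(1) by simp
        show "(wderiv (jword k J) h x)\<^sup>2 * ?W x \<le> d\<^sup>2 * B * indicator ?box x"
        proof (cases "x \<in> ?box")
          case True
          have "\<bar>wderiv (jword k J) h x\<bar> \<le> d" using small set_jword[of k J] len unfolding deriv_small_def by blast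
          then have "(wderiv (jword k J) h x)\<^sup>2 \<le> d\<^sup>2" using power_mono[of "\<bar>wderiv (jword k J) h x\<bar>" d 2] by simp
          then have "(wderiv (jword k J) h x)\<^sup>2 * ?W x \<le> d\<^sup>2 * B"
            by (intro mult_mono B(2)[OF True] weight_prod_nonneg[OF \<tau>]) auto
          then show ?thesis using True by simp
        next
          case False
          then show ?thesis using pow_fun_wderiv_outside_box[OF h set_jword False, of J] by simp
        qed
      qed
      then show ?thesis by (simp add: sets.Int_space_eq2[OF emeasure_pow_box_finite(1)])
    qed
    then have "(\<Sum>J\<in>?J. LINT x|?M. (wderiv (jword k J) h x)\<^sup>2 * ?W x) \<le> (\<Sum>J\<in>?J. d\<^sup>2 * B * measure ?M ?box)"
      by (rule sum_mono)
    also have "\<dots> = (real (card ?J) * (B * measure ?M ?box)) * d\<^sup>2" by simp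
    finally have "sobolev_norm_pow k \<tau> h \<le> sqrt ((real (card ?J) * (B * measure ?M ?box)) * d\<^sup>2)"
      unfolding sobolev_norm_pow_eq by (rule real_sqrt_le_mono)
    then show "sobolev_norm_pow k \<tau> h \<le> ?K * d" using d by (simp add: real_sqrt_mult)
  qed
qed

lemma tensor_pow_dense:
  fixes f :: "(nat \<Rightarrow> real^'d) \<Rightarrow> real"
  assumes f: "f \<in> sym_test_fun k" and \<tau>: "\<tau> \<in> weights" and e: "0 < e"
  shows "\<exists>g\<in>span (tensor_pow k ` test_fun). sobolev_norm_pow k \<tau> (f - g) < e"
proof -
  obtain r where fr: "f \<in> pow_fun k (\<lambda>_. r)"
    and dense: "\<And>m d. 0 < d \<Longrightarrow> \<exists>g\<in>span (tensor_pow k ` test_box r). g \<in> pow_fun k (\<lambda>_. r) \<and> deriv_small k m d (f - g)"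
    by (rule tensor_pow_dense_smooth[OF f]) blast
  obtain K where K: "0 \<le> K" "\<And>h d. h \<in> pow_fun k (\<lambda>_. r) \<Longrightarrow> 0 \<le> d \<Longrightarrow> deriv_small k (k * fst \<tau>) d h \<Longrightarrow> sobolev_norm_pow k \<tau> h \<le> K * d"
    by (rule sobolev_norm_pow_small[OF \<tau>, of k r]) blast
  let ?d = "e / (K + 1)"
  have d: "0 < ?d" using K(1) e by simp
  obtain g where g: "g \<in> span (tensor_pow k ` test_box r)" "g \<in> pow_fun k (\<lambda>_. r)" "deriv_small k (k * fst \<tau>) ?d (f - g)"
    using dense[OF d] by blast
  have "sobolev_norm_pow k \<tau> (f - g) \<le> K * ?d"
    by (rule K(2)[OF subspace_diff[OF subspace_pow_fun fr g(2)] less_imp_le[OF d] g(3)])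
  also have "\<dots> < e" using K(1) e by (simp add: field_simps)
  finally have "sobolev_norm_pow k \<tau> (f - g) < e" .
  moreover have "g \<in> span (tensor_pow k ` test_fun)"
    using g(1) span_mono[OF image_mono[OF test_box_test_fun, of "tensor_pow k"]] by blast
  ultimately show ?thesis by blast
qed

section \<open>Tensor powers of distributions\<close>

lemma dual_sym_bound:
  assumes "F \<in> topological_dual (sym_test_fun k) (sym_topology k)"
  obtains \<tau> C where "\<tau> \<in> weights" "0 \<le> C" "\<And>f. f \<in> sym_test_fun k \<Longrightarrow> \<bar>F f\<bar> \<le> C * sobolev_norm_pow k \<tau> f"
proof -
  have F: "linear_map_on (sym_test_fun k) F" "continuous_map (seminorm_topology (sym_test_fun k) (sobolev_norm_pow k ` weights)) euclideanreal F"
    using assms by (auto simp: topological_dual_def sym_topology_def)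
  obtain p C where "p \<in> sobolev_norm_pow k ` weights" "0 \<le> C" "\<And>f. f \<in> sym_test_fun k \<Longrightarrow> \<bar>F f\<bar> \<le> C * p f"
    by (rule linear_bound_of_continuous[OF subspace_sym_test_fun sym_topology_seminorms sobolev_pow_directed F]) blast+
  then show ?thesis using that by auto
qed

text \<open>
  The density of the span of the tensor powers, in its dual form.
\<close>

lemma dual_sym_eq_0:
  assumes F: "F \<in> topological_dual (sym_test_fun k) (sym_topology k)"
    and 0: "\<And>\<xi>. \<xi> \<in> test_fun \<Longrightarrow> F (tensor_pow k \<xi>) = 0"
  shows "F f = 0"
proof (cases "f \<in> sym_test_fun k")
  case f: True
  note V = subspace_sym_test_fun[of k]
  have lin: "linear_map_on (sym_test_fun k) F" using F by (simp add: topological_dual_def)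
  note L = linear_map_onD[OF lin V]
  obtain \<tau> C where \<tau>: "\<tau> \<in> weights" and C: "0 \<le> C" and bd: "\<And>f. f \<in> sym_test_fun k \<Longrightarrow> \<bar>F f\<bar> \<le> C * sobolev_norm_pow k \<tau> f"
    by (rule dual_sym_bound[OF F]) blast
  have "subspace {g \<in> sym_test_fun k. F g = 0}"
    using V L unfolding subspace_def by auto
  moreover have "tensor_pow k ` test_fun \<subseteq> {g \<in> sym_test_fun k. F g = 0}"
    using tensor_pow_sym_test_fun 0 by blast
  ultimately have span: "span (tensor_pow k ` test_fun) \<subseteq> {g \<in> sym_test_fun k. F g = 0}"
    by (intro span_minimal)
  have "\<bar>F f\<bar> \<le> 0 + e" if e: "0 < e" for e
  proof -
    obtain g where g: "g \<in> span (tensor_pow k ` test_fun)" "sobolev_norm_pow k \<tau> (f - g) < e / (C + 1)"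
      using tensor_pow_dense[OF f \<tau>, of "e / (C + 1)"] e C by auto
    have gV: "g \<in> sym_test_fun k" "F g = 0" using g(1) span by auto
    have "\<bar>F f\<bar> = \<bar>F (f - g)\<bar>" using L(4)[OF f gV(1)] gV(2) by simp
    also have "\<dots> \<le> C * sobolev_norm_pow k \<tau> (f - g)" by (rule bd[OF subspace_diff[OF V f gV(1)]])
    also have "\<dots> \<le> C * (e / (C + 1))" using g(2) C by (intro mult_left_mono) auto
    also have "\<dots> \<le> e" using C e by (simp add: field_simps)
    finally show ?thesis by simp
  qed
  then have "\<bar>F f\<bar> \<le> 0" by (rule field_le_epsilon)
  then show ?thesis by simp
qed (use F in \<open>simp add: topological_dual_def\<close>)

text \<open>
  The inner product belonging to the Sobolev norm.
\<close>

definition sobolev_inner :: "nat \<times> (real^'d \<Rightarrow> real) \<Rightarrow> (real^'d \<Rightarrow> real) \<Rightarrow> (real^'d \<Rightarrow> real) \<Rightarrow> real" where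
  "sobolev_inner \<tau> \<xi> \<eta> = (\<Sum>js | length js \<le> fst \<tau>. LINT x|lborel. foldr pdiff js \<xi> x * foldr pdiff js \<eta> x * snd \<tau> x)"

lemma kernel_integral:
  fixes u :: "'j \<Rightarrow> 'i \<Rightarrow> 'x \<Rightarrow> real"
  assumes int: "\<And>J i j. J \<in> I \<Longrightarrow> i \<in> T \<Longrightarrow> j \<in> T \<Longrightarrow> integrable M (\<lambda>x. u J i x * u J j x * w x)"
  shows "(\<Sum>J\<in>I. LINT x|M. (\<Sum>i\<in>T. \<Sum>j\<in>T. m i j * (u J i x * u J j x * w x)))
     = (\<Sum>i\<in>T. \<Sum>j\<in>T. m i j * (\<Sum>J\<in>I. LINT x|M. u J i x * u J j x * w x))"
    and "J \<in> I \<Longrightarrow> integrable M (\<lambda>x. \<Sum>i\<in>T. \<Sum>j\<in>T. m i j * (u J i x * u J j x * w x))"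
proof -
  have i1: "integrable M (\<lambda>x. m i j * (u J i x * u J j x * w x))" if "J \<in> I" "i \<in> T" "j \<in> T" for J i j
    using int[OF that] by simp
  show "J \<in> I \<Longrightarrow> integrable M (\<lambda>x. \<Sum>i\<in>T. \<Sum>j\<in>T. m i j * (u J i x * u J j x * w x))"
    by (intro Bochner_Integration.integrable_sum i1)
  have "(LINT x|M. (\<Sum>i\<in>T. \<Sum>j\<in>T. m i j * (u J i x * u J j x * w x)))
     = (\<Sum>i\<in>T. \<Sum>j\<in>T. m i j * (LINT x|M. u J i x * u J j x * w x))" if J: "J \<in> I" for J
  proof -
    have "(LINT x|M. (\<Sum>i\<in>T. \<Sum>j\<in>T. m i j * (u J i x * u J j x * w x)))
       = (\<Sum>i\<in>T. LINT x|M. (\<Sum>j\<in>T. m i j * (u J i x * u J j x * w x)))"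
      by (rule Bochner_Integration.integral_sum) (intro Bochner_Integration.integrable_sum i1 J)
    also have "\<dots> = (\<Sum>i\<in>T. \<Sum>j\<in>T. LINT x|M. m i j * (u J i x * u J j x * w x))"
      by (rule sum.cong[OF refl], rule Bochner_Integration.integral_sum) (intro i1 J)
    finally show ?thesis by simp
  qed
  then have "(\<Sum>J\<in>I. LINT x|M. (\<Sum>i\<in>T. \<Sum>j\<in>T. m i j * (u J i x * u J j x * w x)))
     = (\<Sum>J\<in>I. \<Sum>i\<in>T. \<Sum>j\<in>T. m i j * (LINT x|M. u J i x * u J j x * w x))"
    by (intro sum.cong refl)
  also have "\<dots> = (\<Sum>i\<in>T. \<Sum>j\<in>T. \<Sum>J\<in>I. m i j * (LINT x|M. u J i x * u J j x * w x))"
    by (subst sum.swap) (intro sum.cong refl sum.swap)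
  finally show "(\<Sum>J\<in>I. LINT x|M. (\<Sum>i\<in>T. \<Sum>j\<in>T. m i j * (u J i x * u J j x * w x)))
     = (\<Sum>i\<in>T. \<Sum>j\<in>T. m i j * (\<Sum>J\<in>I. LINT x|M. u J i x * u J j x * w x))"
    by (simp add: sum_distrib_left)
qed

lemma square_sum_kernel: "(\<Sum>i\<in>T. b i * (v i :: real))\<^sup>2 * w = (\<Sum>i\<in>T. \<Sum>j\<in>T. (b i * b j) * (v i * v j * w))"
proof -
  have "(\<Sum>i\<in>T. b i * v i)\<^sup>2 * w = (\<Sum>i\<in>T. \<Sum>j\<in>T. (b i * v i) * (b j * v j)) * w"
    by (simp only: power2_eq_square sum_product)
  also have "\<dots> = (\<Sum>i\<in>T. \<Sum>j\<in>T. (b i * v i) * (b j * v j) * w)" by (simp only: sum_distrib_right)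
  also have "\<dots> = (\<Sum>i\<in>T. \<Sum>j\<in>T. (b i * b j) * (v i * v j * w))"
    by (intro sum.cong refl) (simp add: mult_ac)
  finally show ?thesis .
qed

text \<open>
  Let \<open>q\<close> be a Gram matrix, written as an integral. If the matrix \<open>D q i j - a i * a j\<close> is positive semidefinite,
  then so is the matrix of the entrywise powers \<open>D\<^sup>k (q i j)\<^sup>k - (a i * a j)\<^sup>k\<close>. This is a case of the Schur product theorem; the
  integral form of \<open>q\<close> lets the induction hypothesis be applied under the integral sign, with the
  coefficients \<open>c i * u J i x\<close>.
\<close>

lemma gram_power_bound:
  fixes u :: "'j \<Rightarrow> 'i \<Rightarrow> 'x \<Rightarrow> real" and a :: "'i \<Rightarrow> real"
  assumes int: "\<And>J i j. J \<in> I \<Longrightarrow> i \<in> T \<Longrightarrow> j \<in> T \<Longrightarrow> integrable M (\<lambda>x. u J i x * u J j x * w x)"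
    and w: "\<And>x. 0 \<le> w x" and D: "0 \<le> D"
    and q: "\<And>i j. q i j = (\<Sum>J\<in>I. LINT x|M. u J i x * u J j x * w x)"
    and hyp: "\<And>c. (\<Sum>i\<in>T. c i * a i)\<^sup>2 \<le> D * (\<Sum>i\<in>T. \<Sum>j\<in>T. (c i * c j) * q i j)"
  shows "(\<Sum>i\<in>T. c i * a i ^ k)\<^sup>2 \<le> D ^ k * (\<Sum>i\<in>T. \<Sum>j\<in>T. (c i * c j) * q i j ^ k)"
proof (induction k arbitrary: c)
  case 0
  show ?case by (simp add: power2_eq_square sum_product)
next
  case (Suc k)
  let ?b = "\<lambda>i. c i * a i ^ k"
  let ?m = "\<lambda>i j. (c i * c j) * q i j ^ k"
  have "(\<Sum>i\<in>T. c i * a i ^ Suc k)\<^sup>2 = (\<Sum>i\<in>T. ?b i * a i)\<^sup>2" by (simp add: mult_ac)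
  also have "\<dots> \<le> D * (\<Sum>i\<in>T. \<Sum>j\<in>T. (?b i * ?b j) * q i j)" by (rule hyp)
  finally have first: "(\<Sum>i\<in>T. c i * a i ^ Suc k)\<^sup>2 \<le> D * (\<Sum>i\<in>T. \<Sum>j\<in>T. (?b i * ?b j) * q i j)" .
  have "(\<Sum>i\<in>T. \<Sum>j\<in>T. (?b i * ?b j) * q i j)
      = (\<Sum>J\<in>I. LINT x|M. (\<Sum>i\<in>T. \<Sum>j\<in>T. (?b i * ?b j) * (u J i x * u J j x * w x)))"
    unfolding q by (rule kernel_integral(1)[OF int, symmetric])
  also have "\<dots> \<le> (\<Sum>J\<in>I. LINT x|M. D ^ k * (\<Sum>i\<in>T. \<Sum>j\<in>T. ?m i j * (u J i x * u J j x * w x)))"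
  proof (intro sum_mono integral_mono integrable_mult_right kernel_integral(2)[OF int])
    fix J x assume "J \<in> I"
    have "(\<Sum>i\<in>T. \<Sum>j\<in>T. (?b i * ?b j) * (u J i x * u J j x * w x)) = (\<Sum>i\<in>T. (c i * u J i x) * a i ^ k)\<^sup>2 * w x"
      by (subst square_sum_kernel[symmetric]) (simp add: mult_ac)
    also have "\<dots> \<le> D ^ k * (\<Sum>i\<in>T. \<Sum>j\<in>T. ((c i * u J i x) * (c j * u J j x)) * q i j ^ k) * w x"
      by (rule mult_right_mono[OF Suc.IH w])
    also have "\<dots> = D ^ k * (\<Sum>i\<in>T. \<Sum>j\<in>T. ?m i j * (u J i x * u J j x * w x))"
      by (simp add: sum_distrib_left sum_distrib_right mult_ac)
    finally show "(\<Sum>i\<in>T. \<Sum>j\<in>T. (?b i * ?b j) * (u J i x * u J j x * w x)) \<le> D ^ k * (\<Sum>i\<in>T. \<Sum>j\<in>T. ?m i j * (u J i x * u J j x * w x))" .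
  qed
  also have "(\<Sum>J\<in>I. LINT x|M. D ^ k * (\<Sum>i\<in>T. \<Sum>j\<in>T. ?m i j * (u J i x * u J j x * w x)))
      = D ^ k * (\<Sum>i\<in>T. \<Sum>j\<in>T. ?m i j * q i j)"
    unfolding q by (simp add: sum_distrib_left[symmetric] kernel_integral(1)[OF int])
  also have "(\<Sum>i\<in>T. \<Sum>j\<in>T. ?m i j * q i j) = (\<Sum>i\<in>T. \<Sum>j\<in>T. (c i * c j) * q i j ^ Suc k)"
    by (simp add: mult_ac)
  finally have "(\<Sum>i\<in>T. \<Sum>j\<in>T. (?b i * ?b j) * q i j) \<le> D ^ k * (\<Sum>i\<in>T. \<Sum>j\<in>T. (c i * c j) * q i j ^ Suc k)" .
  from order_trans[OF first mult_left_mono[OF this D]] show ?case by (simp only: power_Suc mult.assoc)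
qed

lemma sobolev_norm_sum:
  fixes \<xi> :: "'i \<Rightarrow> real^'d \<Rightarrow> real"
  assumes \<tau>: "\<tau> \<in> weights" and \<xi>: "\<And>i. i \<in> T \<Longrightarrow> \<xi> i \<in> test_fun"
  shows "(sobolev_norm \<tau> (\<Sum>i\<in>T. c i *\<^sub>R \<xi> i))\<^sup>2 = (\<Sum>i\<in>T. \<Sum>j\<in>T. (c i * c j) * sobolev_inner \<tau> (\<xi> i) (\<xi> j))"
proof -
  let ?f = "\<Sum>i\<in>T. c i *\<^sub>R \<xi> i"
  let ?I = "{js :: 'd list. length js \<le> fst \<tau>}"
  have lin: "linear_map_on test_fun (foldr pdiff js)" for js :: "'d list"
    unfolding linear_map_on_def using foldr_pdiff_add foldr_pdiff_scale test_funD(1) by blast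
  have "foldr pdiff js ?f = (\<Sum>i\<in>T. c i *\<^sub>R foldr pdiff js (\<xi> i))" for js
    by (rule linear_map_on_sum[OF lin subspace_test_fun \<xi>])
  then have D: "foldr pdiff js ?f x = (\<Sum>i\<in>T. c i * foldr pdiff js (\<xi> i) x)" for js x
    by (simp add: sum_fun_apply scaleR_fun_def)
  have "(sobolev_norm \<tau> ?f)\<^sup>2 = (\<Sum>js\<in>?I. LINT x|lborel. (foldr pdiff js ?f x)\<^sup>2 * snd \<tau> x)"
    unfolding sobolev_norm_def
    by (rule real_sqrt_pow2, intro sum_nonneg Bochner_Integration.integral_nonneg mult_nonneg_nonneg)
       (use order_trans[OF zero_le_one weightsD(2)[OF \<tau>]] in auto)
  also have "\<dots> = (\<Sum>js\<in>?I. LINT x|lborel. (\<Sum>i\<in>T. \<Sum>j\<in>T. (c i * c j) * (foldr pdiff js (\<xi> i) x * foldr pdiff js (\<xi> j) x * snd \<tau> x)))"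
    unfolding D square_sum_kernel ..
  also have "\<dots> = (\<Sum>i\<in>T. \<Sum>j\<in>T. (c i * c j) * sobolev_inner \<tau> (\<xi> i) (\<xi> j))"
    unfolding sobolev_inner_def by (rule kernel_integral(1)) (use \<xi> \<tau> integrable_test_fun_derivs in blast)
  finally show ?thesis .
qed

lemma word_at_jword: "i < k \<Longrightarrow> word_at i (jword k J) = J i"
proof -
  have app: "word_at i (ps @ qs) = word_at i ps @ word_at i qs" for ps qs :: "(nat \<times> 'a) list" by (simp add: word_at_def)
  have one: "word_at i (map (Pair l) js) = (if l = i then js else [])" for l and js :: "'a list"
    by (induction js) (auto simp: word_at_def)
  have "word_at i (jword k J) = (if i < k then J i else [])"
  proof (induction k)
    case (Suc k)
    have "jword (Suc k) J = jword k J @ map (Pair k) (J k)" by (simp add: jword_def)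
    then show ?case using Suc by (simp add: app one)
  qed (simp add: jword_def word_at_def)
  then show "i < k \<Longrightarrow> word_at i (jword k J) = J i" by simp
qed

text \<open>
  The tensor power of the Hilbert space: the inner product of \<open>\<xi>\<^sup>\<otimes>\<^sup>k\<close> and \<open>\<eta>\<^sup>\<otimes>\<^sup>k\<close> is the \<open>k\<close>-th power of that of
  \<open>\<xi>\<close> and \<open>\<eta>\<close>.
\<close>

lemma sobolev_norm_pow_sum:
  fixes \<xi> :: "'i \<Rightarrow> real^'d \<Rightarrow> real"
  assumes \<tau>: "\<tau> \<in> weights" and \<xi>: "\<And>i. i \<in> T \<Longrightarrow> \<xi> i \<in> test_fun"
  shows "(sobolev_norm_pow k \<tau> (\<Sum>i\<in>T. c i *\<^sub>R tensor_pow k (\<xi> i)))\<^sup>2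
     = (\<Sum>i\<in>T. \<Sum>j\<in>T. (c i * c j) * sobolev_inner \<tau> (\<xi> i) (\<xi> j) ^ k)"
proof -
  interpret product_sigma_finite "\<lambda>_ :: nat. lborel :: (real^'d) measure" by standard
  let ?f = "\<Sum>i\<in>T. c i *\<^sub>R tensor_pow k (\<xi> i)"
  let ?M = "PiM {..<k} (\<lambda>_. lborel :: (real^'d) measure)"
  let ?L = "{js :: 'd list. length js \<le> fst \<tau>}"
  let ?I = "PiE {..<k} (\<lambda>_. ?L)"
  let ?W = "\<lambda>x :: nat \<Rightarrow> real^'d. \<Prod>m<k. snd \<tau> (x m)"
  let ?D = "\<lambda>J i. wderiv (jword k J) (tensor_pow k (\<xi> i))"
  let ?g = "\<lambda>js i j y. foldr pdiff js (\<xi> i) y * foldr pdiff js (\<xi> j) y * snd \<tau> y"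
  have lin: "linear_map_on (sym_test_fun k) (wderiv (jword k J))" for J :: "nat \<Rightarrow> 'd list"
    unfolding linear_map_on_def
  proof (intro conjI ballI allI)
    fix f g :: "(nat \<Rightarrow> real^'d) \<Rightarrow> real" assume f: "f \<in> sym_test_fun k" and g: "g \<in> sym_test_fun k"
    obtain R R' where R: "f \<in> pow_fun k (\<lambda>_. R)" "g \<in> pow_fun k (\<lambda>_. R')" using sym_test_funD(1) f g by blast
    show "wderiv (jword k J) (f + g) = wderiv (jword k J) f + wderiv (jword k J) g" by (rule wderiv_add(1)[OF R set_jword])
    show "wderiv (jword k J) (c *\<^sub>R f) = c *\<^sub>R wderiv (jword k J) f" for c by (rule wderiv_scale(1)[OF R(1) set_jword])
  qed
  have "wderiv (jword k J) ?f = (\<Sum>i\<in>T. c i *\<^sub>R ?D J i)" for J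
    by (rule linear_map_on_sum[OF lin subspace_sym_test_fun tensor_pow_sym_test_fun[OF \<xi>]])
  then have D: "wderiv (jword k J) ?f x = (\<Sum>i\<in>T. c i * ?D J i x)" for J x
    by (simp add: sum_fun_apply scaleR_fun_def)
  have Dp: "?D J i x = (\<Prod>m<k. foldr pdiff (J m) (\<xi> i) (x m))" if "i \<in> T" "x \<in> points k" for J i x
  proof -
    have "?D J i = tens k (\<lambda>m. foldr pdiff (word_at m (jword k J)) (\<xi> i))"
      unfolding tensor_pow_tens by (rule tens_derivs(1)[OF test_funD(1)[OF \<xi>[OF that(1)]] set_jword])
    then show ?thesis using that(2) by (simp add: tens_def word_at_jword)
  qed
  have sp: "x \<in> space ?M \<Longrightarrow> x \<in> points k" for x by (simp add: space_PiM points_def)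
  have DD: "?D J i x * ?D J j x * ?W x = (\<Prod>m<k. ?g (J m) i j (x m))" if "i \<in> T" "j \<in> T" "x \<in> space ?M" for J i j x
    using that sp by (simp add: Dp prod.distrib)
  have gint: "integrable lborel (?g js i j)" if "i \<in> T" "j \<in> T" for js i j
    using \<xi> that \<tau> integrable_test_fun_derivs by blast
  have int: "integrable ?M (\<lambda>x. ?D J i x * ?D J j x * ?W x)" if "i \<in> T" "j \<in> T" for J i j
  proof -
    have "integrable ?M (\<lambda>x. \<Prod>m<k. ?g (J m) i j (x m))"
      by (rule product_integrable_prod) (use gint that in auto)
    then show ?thesis using DD[OF that] by (subst Bochner_Integration.integrable_cong[OF refl]) auto
  qed
  have q: "(\<Sum>J\<in>?I. LINT x|?M. ?D J i x * ?D J j x * ?W x) = sobolev_inner \<tau> (\<xi> i) (\<xi> j) ^ k" if "i \<in> T" "j \<in> T" for i j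
  proof -
    have "(LINT x|?M. ?D J i x * ?D J j x * ?W x) = (\<Prod>m<k. LINT y|lborel. ?g (J m) i j y)" for J
    proof -
      have "(LINT x|?M. ?D J i x * ?D J j x * ?W x) = (LINT x|?M. (\<Prod>m<k. ?g (J m) i j (x m)))"
        by (rule Bochner_Integration.integral_cong[OF refl DD[OF that]])
      also have "\<dots> = (\<Prod>m<k. LINT y|lborel. ?g (J m) i j y)"
        by (rule product_integral_prod) (use gint that in auto)
      finally show ?thesis .
    qed
    then have "(\<Sum>J\<in>?I. LINT x|?M. ?D J i x * ?D J j x * ?W x) = (\<Sum>J\<in>?I. \<Prod>m<k. LINT y|lborel. ?g (J m) i j y)"
      by simp
    also have "\<dots> = (\<Prod>m<k. \<Sum>js\<in>?L. LINT y|lborel. ?g js i j y)"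
      by (rule prod_sum_PiE[symmetric]) (auto simp: finite_words)
    also have "\<dots> = sobolev_inner \<tau> (\<xi> i) (\<xi> j) ^ k" by (simp add: sobolev_inner_def)
    finally show ?thesis .
  qed
  have "(sobolev_norm_pow k \<tau> ?f)\<^sup>2 = (\<Sum>J\<in>?I. LINT x|?M. (wderiv (jword k J) ?f x)\<^sup>2 * ?W x)"
    unfolding sobolev_norm_pow_eq
    by (rule real_sqrt_pow2, intro sum_nonneg Bochner_Integration.integral_nonneg mult_nonneg_nonneg weight_prod_nonneg[OF \<tau>])
       auto
  also have "\<dots> = (\<Sum>J\<in>?I. LINT x|?M. (\<Sum>i\<in>T. \<Sum>j\<in>T. (c i * c j) * (?D J i x * ?D J j x * ?W x)))"
    unfolding D square_sum_kernel ..
  also have "\<dots> = (\<Sum>i\<in>T. \<Sum>j\<in>T. (c i * c j) * (\<Sum>J\<in>?I. LINT x|?M. ?D J i x * ?D J j x * ?W x))"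
    by (rule kernel_integral(1)) (rule int)
  also have "\<dots> = (\<Sum>i\<in>T. \<Sum>j\<in>T. (c i * c j) * sobolev_inner \<tau> (\<xi> i) (\<xi> j) ^ k)"
    by (intro sum.cong refl) (simp add: q)
  finally show ?thesis .
qed

lemma tensor_power_bound:
  fixes \<xi> :: "'i \<Rightarrow> real^'d \<Rightarrow> real"
  assumes \<omega>: "linear_map_on test_fun \<omega>" and \<tau>: "\<tau> \<in> weights" and C: "0 \<le> C"
    and bd: "\<And>f. f \<in> test_fun \<Longrightarrow> \<bar>\<omega> f\<bar> \<le> C * sobolev_norm \<tau> f"
    and \<xi>: "\<And>i. i \<in> T \<Longrightarrow> \<xi> i \<in> test_fun"
  shows "\<bar>\<Sum>i\<in>T. c i * \<omega> (\<xi> i) ^ k\<bar> \<le> C ^ k * sobolev_norm_pow k \<tau> (\<Sum>i\<in>T. c i *\<^sub>R tensor_pow k (\<xi> i))"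
proof -
  note V = subspace_test_fun
  have hyp: "(\<Sum>i\<in>T. c i * \<omega> (\<xi> i))\<^sup>2 \<le> C\<^sup>2 * (\<Sum>i\<in>T. \<Sum>j\<in>T. (c i * c j) * sobolev_inner \<tau> (\<xi> i) (\<xi> j))" for c
  proof -
    let ?f = "\<Sum>i\<in>T. c i *\<^sub>R \<xi> i"
    have f: "?f \<in> test_fun" by (intro subspace_sum[OF V] subspace_scale[OF V] \<xi>)
    have "(\<Sum>i\<in>T. c i * \<omega> (\<xi> i)) = \<omega> ?f" using linear_map_on_sum[OF \<omega> V \<xi>, where c=c] by simp
    then have "(\<Sum>i\<in>T. c i * \<omega> (\<xi> i))\<^sup>2 \<le> (C * sobolev_norm \<tau> ?f)\<^sup>2"
      using power_mono[OF bd[OF f], of 2] by simp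
    then show ?thesis by (simp add: power_mult_distrib sobolev_norm_sum[OF \<tau> \<xi>])
  qed
  have "(\<Sum>i\<in>T. c i * \<omega> (\<xi> i) ^ k)\<^sup>2 \<le> (C\<^sup>2) ^ k * (\<Sum>i\<in>T. \<Sum>j\<in>T. (c i * c j) * sobolev_inner \<tau> (\<xi> i) (\<xi> j) ^ k)"
  proof (rule gram_power_bound[where I="{js :: 'd list. length js \<le> fst \<tau>}" and M=lborel and w="snd \<tau>"
        and u="\<lambda>js i. foldr pdiff js (\<xi> i)" and a="\<lambda>i. \<omega> (\<xi> i)" and q="\<lambda>i j. sobolev_inner \<tau> (\<xi> i) (\<xi> j)"])
    show "0 \<le> snd \<tau> x" for x by (rule order_trans[OF zero_le_one weightsD(2)[OF \<tau>]])
    show "sobolev_inner \<tau> (\<xi> i) (\<xi> j) = (\<Sum>js | length js \<le> fst \<tau>. LINT x|lborel. foldr pdiff js (\<xi> i) x * foldr pdiff js (\<xi> j) x * snd \<tau> x)" for i j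
      by (simp add: sobolev_inner_def)
    show "(\<Sum>i\<in>T. c i * \<omega> (\<xi> i))\<^sup>2 \<le> C\<^sup>2 * (\<Sum>i\<in>T. \<Sum>j\<in>T. (c i * c j) * sobolev_inner \<tau> (\<xi> i) (\<xi> j))" for c by (rule hyp)
    show "integrable lborel (\<lambda>x. foldr pdiff js (\<xi> i) x * foldr pdiff js (\<xi> j) x * snd \<tau> x)" if "i \<in> T" "j \<in> T" for js i j
      by (rule integrable_test_fun_derivs[OF \<xi>[OF that(1)] \<xi>[OF that(2)] \<tau>])
  qed simp
  also have "\<dots> = (C ^ k * sobolev_norm_pow k \<tau> (\<Sum>i\<in>T. c i *\<^sub>R tensor_pow k (\<xi> i)))\<^sup>2"
    by (simp add: power_mult_distrib sobolev_norm_pow_sum[OF \<tau> \<xi>] power_mult[symmetric] mult.commute)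
  finally have "\<bar>\<Sum>i\<in>T. c i * \<omega> (\<xi> i) ^ k\<bar>\<^sup>2 \<le> (C ^ k * sobolev_norm_pow k \<tau> (\<Sum>i\<in>T. c i *\<^sub>R tensor_pow k (\<xi> i)))\<^sup>2"
    by simp
  moreover have "0 \<le> C ^ k * sobolev_norm_pow k \<tau> (\<Sum>i\<in>T. c i *\<^sub>R tensor_pow k (\<xi> i))"
  proof (rule mult_nonneg_nonneg)
    show "0 \<le> sobolev_norm_pow k \<tau> (\<Sum>i\<in>T. c i *\<^sub>R tensor_pow k (\<xi> i))"
      by (rule seminorm_onD(2)[OF seminorm_sobolev_norm_pow[OF \<tau>] subspace_sym_test_fun])
         (intro subspace_sum[OF subspace_sym_test_fun] subspace_scale[OF subspace_sym_test_fun] tensor_pow_sym_test_fun \<xi>)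
  qed (use C in simp)
  ultimately show ?thesis by (rule power2_le_imp_le)
qed

lemma distr_pow_exists:
  fixes \<omega> :: "(real^'d \<Rightarrow> real) \<Rightarrow> real"
  assumes \<omega>: "\<omega> \<in> distributions"
  shows "\<exists>F. F \<in> topological_dual (sym_test_fun k) (sym_topology k) \<and> (\<forall>\<xi>\<in>test_fun. F (tensor_pow k \<xi>) = \<omega> \<xi> ^ k)"
proof -
  obtain \<tau> C where \<tau>: "\<tau> \<in> weights" and C: "0 \<le> C" and bd: "\<And>f. f \<in> test_fun \<Longrightarrow> \<bar>\<omega> f\<bar> \<le> C * sobolev_norm \<tau> f"
    by (rule distribution_bound[OF \<omega>]) blast
  let ?E = "(\<lambda>\<xi>. (tensor_pow k \<xi>, \<omega> \<xi> ^ k)) ` test_fun"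
  let ?p = "sobolev_norm_pow k \<tau>"
  note V = subspace_sym_test_fun[of k]
  have repr: "v \<in> sym_test_fun k \<and> \<bar>r\<bar> \<le> C ^ k * ?p v" if "(v, r) \<in> span ?E" for v r
  proof -
    obtain t c where t: "finite t" "t \<subseteq> ?E" "(v, r) = (\<Sum>a\<in>t. c a *\<^sub>R a)"
      using \<open>(v, r) \<in> span ?E\<close> unfolding span_explicit by blast
    have "\<forall>a\<in>t. \<exists>\<xi>\<in>test_fun. a = (tensor_pow k \<xi>, \<omega> \<xi> ^ k)" using t(2) by blast
    then obtain \<xi> where \<xi>: "\<And>a. a \<in> t \<Longrightarrow> \<xi> a \<in> test_fun" "\<And>a. a \<in> t \<Longrightarrow> a = (tensor_pow k (\<xi> a), \<omega> (\<xi> a) ^ k)"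
      by metis
    have v: "v = (\<Sum>a\<in>t. c a *\<^sub>R tensor_pow k (\<xi> a))"
    proof -
      have "v = (\<Sum>a\<in>t. fst (c a *\<^sub>R a))" using arg_cong[OF t(3), of fst] by (simp add: fst_sum)
      also have "\<dots> = (\<Sum>a\<in>t. c a *\<^sub>R tensor_pow k (\<xi> a))"
        by (rule sum.cong[OF refl]) (subst (2) \<xi>(2), auto)
      finally show ?thesis .
    qed
    have r: "r = (\<Sum>a\<in>t. c a * \<omega> (\<xi> a) ^ k)"
    proof -
      have "r = (\<Sum>a\<in>t. snd (c a *\<^sub>R a))" using arg_cong[OF t(3), of snd] by (simp add: snd_sum)
      also have "\<dots> = (\<Sum>a\<in>t. c a * \<omega> (\<xi> a) ^ k)"
        by (rule sum.cong[OF refl]) (subst (2) \<xi>(2), auto)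
      finally show ?thesis .
    qed
    have "v \<in> sym_test_fun k"
      unfolding v by (intro subspace_sum[OF V] subspace_scale[OF V] tensor_pow_sym_test_fun \<xi>(1))
    moreover have "\<bar>r\<bar> \<le> C ^ k * ?p v"
      unfolding v r by (rule tensor_power_bound[OF distributionD(1)[OF \<omega>] \<tau> C bd \<xi>(1)])
    ultimately show ?thesis ..
  qed
  have dense: "\<exists>(v, r)\<in>span ?E. ?p (f - v) < e" if f: "f \<in> sym_test_fun k" and e: "0 < e" for f e
  proof -
    obtain g where g: "g \<in> span (tensor_pow k ` test_fun)" "?p (f - g) < e"
      using tensor_pow_dense[OF f \<tau> e] by blast
    have "linear (fst :: ((nat \<Rightarrow> real^'d) \<Rightarrow> real) \<times> real \<Rightarrow> _)" by (rule linearI) auto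
    then have "span (fst ` ?E) = fst ` span ?E" using linear_span_image by blast
    moreover have "fst ` ?E = tensor_pow k ` test_fun" by (simp add: image_image)
    ultimately have "g \<in> fst ` span ?E" using g(1) by simp
    then show ?thesis using g(2) by force
  qed
  obtain F where F: "linear_map_on (sym_test_fun k) F" "\<And>f. f \<in> sym_test_fun k \<Longrightarrow> \<bar>F f\<bar> \<le> C ^ k * ?p f"
    "\<And>v r. (v, r) \<in> span ?E \<Longrightarrow> F v = r" "\<And>f. f \<notin> sym_test_fun k \<Longrightarrow> F f = 0"
    by (rule linear_extension_by_density[OF V seminorm_sobolev_norm_pow[OF \<tau>] subspace_span[of ?E], of "C ^ k"])
       (use repr dense C in auto)
  have "continuous_map (sym_topology k) euclideanreal F"
    unfolding sym_topology_def
    by (rule linear_continuous_of_bound[OF V _ seminorm_sobolev_norm_pow[OF \<tau>] F(1,2)]) (use \<tau> in simp)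
  then have "F \<in> topological_dual (sym_test_fun k) (sym_topology k)"
    using F(1,4) by (simp add: topological_dual_def)
  moreover have "F (tensor_pow k \<xi>) = \<omega> \<xi> ^ k" if "\<xi> \<in> test_fun" for \<xi>
    by (rule F(3)) (use that in \<open>auto intro: span_base\<close>)
  ultimately show ?thesis by blast
qed

lemma dual_diff:
  assumes "F \<in> topological_dual V X" "G \<in> topological_dual V X"
  shows "(\<lambda>f. F f - G f) \<in> topological_dual V X"
  using assms by (auto simp: topological_dual_def linear_map_on_def algebra_simps intro!: continuous_map_diff)

text \<open>
  The definite description in the definition of \<open>\<omega>\<^sup>\<otimes>\<^sup>k\<close> is justified.
\<close>

lemma distr_pow:
  assumes "\<omega> \<in> distributions"
  shows "distr_pow k \<omega> \<in> topological_dual (sym_test_fun k) (sym_topology k)"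
    and "\<xi> \<in> test_fun \<Longrightarrow> distr_pow k \<omega> (tensor_pow k \<xi>) = \<omega> \<xi> ^ k"
proof -
  let ?P = "\<lambda>F. F \<in> topological_dual (sym_test_fun k) (sym_topology k) \<and> (\<forall>\<xi>\<in>test_fun. F (tensor_pow k \<xi>) = \<omega> \<xi> ^ k)"
  have "\<exists>!F. ?P F"
  proof (rule ex_ex1I[OF distr_pow_exists[OF assms]])
    fix F G assume F: "?P F" and G: "?P G"
    have "F f - G f = 0" for f
      by (rule dual_sym_eq_0[of "\<lambda>f. F f - G f"]) (use F G dual_diff in auto)
    then show "F = G" by (simp add: fun_eq_iff)
  qed
  from theI'[OF this] have "?P (distr_pow k \<omega>)" unfolding distr_pow_def .
  then show "distr_pow k \<omega> \<in> topological_dual (sym_test_fun k) (sym_topology k)"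
    "\<xi> \<in> test_fun \<Longrightarrow> distr_pow k \<omega> (tensor_pow k \<xi>) = \<omega> \<xi> ^ k" by blast+
qed

section \<open>Polynomials\<close>

lemma distr_pow_linear:
  assumes "\<omega> \<in> distributions"
  shows "linear_map_on (sym_test_fun k) (distr_pow k \<omega>)"
  using distr_pow(1)[OF assms] by (simp add: topological_dual_def)

lemma distr_pow_zero: "\<omega> \<in> distributions \<Longrightarrow> distr_pow k \<omega> 0 = 0"
  by (rule linear_map_onD(1)[OF distr_pow_linear subspace_sym_test_fun])

lemma coeff_seqsD:
  assumes "f \<in> coeff_seqs" shows "f k \<in> sym_test_fun k" "finite {k. f k \<noteq> 0}"
  using assms by (auto simp: coeff_seqs_def)

lemma subspace_coeff_seqs: "subspace coeff_seqs"
  unfolding subspace_def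
proof (intro conjI ballI allI)
  show "0 \<in> coeff_seqs" by (simp add: coeff_seqs_def subspace_0[OF subspace_sym_test_fun])
  fix f :: "nat \<Rightarrow> (nat \<Rightarrow> real^'d) \<Rightarrow> real" assume f: "f \<in> coeff_seqs"
  show "c *\<^sub>R f \<in> coeff_seqs" for c
  proof -
    have "{k. (c *\<^sub>R f) k \<noteq> 0} \<subseteq> {k. f k \<noteq> 0}" by (auto simp: scaleR_fun_def[of c f])
    then have "finite {k. (c *\<^sub>R f) k \<noteq> 0}" by (rule finite_subset) (rule coeff_seqsD(2)[OF f])
    moreover have "(c *\<^sub>R f) k \<in> sym_test_fun k" for k
      unfolding scaleR_fun_def[of c f] by (rule subspace_scale[OF subspace_sym_test_fun coeff_seqsD(1)[OF f]])
    ultimately show ?thesis unfolding coeff_seqs_def by blast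
  qed
  fix g :: "nat \<Rightarrow> (nat \<Rightarrow> real^'d) \<Rightarrow> real" assume g: "g \<in> coeff_seqs"
  have "{k. (f + g) k \<noteq> 0} \<subseteq> {k. f k \<noteq> 0} \<union> {k. g k \<noteq> 0}" by auto
  then have "finite {k. (f + g) k \<noteq> 0}"
    using finite_subset[OF _ finite_UnI[OF coeff_seqsD(2)[OF f] coeff_seqsD(2)[OF g]]] by blast
  then show "f + g \<in> coeff_seqs"
    unfolding coeff_seqs_def plus_fun_apply[of f g]
    using subspace_add[OF subspace_sym_test_fun coeff_seqsD(1)[OF f] coeff_seqsD(1)[OF g]] by blast
qed

lemma poly_of_coeffs_superset:
  assumes "\<omega> \<in> distributions" "finite K" "{k. f k \<noteq> 0} \<subseteq> K"
  shows "poly_of_coeffs f \<omega> = (\<Sum>k\<in>K. distr_pow k \<omega> (f k))"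
proof -
  have "(\<Sum>k | f k \<noteq> 0. distr_pow k \<omega> (f k)) = (\<Sum>k\<in>K. distr_pow k \<omega> (f k))"
    by (rule sum.mono_neutral_left[OF assms(2,3)]) (use distr_pow_zero[OF assms(1)] in auto)
  then show ?thesis using assms(1) by (simp add: poly_of_coeffs_def)
qed

lemma poly_of_coeffs_linear: "linear_map_on coeff_seqs poly_of_coeffs"
  unfolding linear_map_on_def
proof (intro conjI ballI allI ext)
  fix f g :: "nat \<Rightarrow> (nat \<Rightarrow> real^'d) \<Rightarrow> real" and \<omega> assume f: "f \<in> coeff_seqs" and g: "g \<in> coeff_seqs"
  show "poly_of_coeffs (f + g) \<omega> = (poly_of_coeffs f + poly_of_coeffs g) \<omega>"
  proof (cases "\<omega> \<in> distributions")
    case True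
    let ?K = "{k. f k \<noteq> 0} \<union> {k. g k \<noteq> 0}"
    have fin: "finite ?K" using coeff_seqsD(2) f g by blast
    have "poly_of_coeffs (f + g) \<omega> = (\<Sum>k\<in>?K. distr_pow k \<omega> ((f + g) k))"
      by (rule poly_of_coeffs_superset[OF True fin]) auto
    also have "\<dots> = (\<Sum>k\<in>?K. distr_pow k \<omega> (f k) + distr_pow k \<omega> (g k))"
      using linear_map_onD(2)[OF distr_pow_linear[OF True] subspace_sym_test_fun coeff_seqsD(1)[OF f] coeff_seqsD(1)[OF g]]
      by (intro sum.cong refl) (simp only: plus_fun_apply[of f g])
    also have "\<dots> = poly_of_coeffs f \<omega> + poly_of_coeffs g \<omega>"
      by (simp add: sum.distrib poly_of_coeffs_superset[OF True fin, of f] poly_of_coeffs_superset[OF True fin, of g])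
    finally show ?thesis by simp
  qed (simp add: poly_of_coeffs_def)
next
  fix f :: "nat \<Rightarrow> (nat \<Rightarrow> real^'d) \<Rightarrow> real" and c :: real and \<omega> assume f: "f \<in> coeff_seqs"
  show "poly_of_coeffs (c *\<^sub>R f) \<omega> = (c *\<^sub>R poly_of_coeffs f) \<omega>"
  proof (cases "\<omega> \<in> distributions")
    case True
    let ?K = "{k. f k \<noteq> 0}"
    have fin: "finite ?K" using coeff_seqsD(2) f by blast
    have "poly_of_coeffs (c *\<^sub>R f) \<omega> = (\<Sum>k\<in>?K. distr_pow k \<omega> ((c *\<^sub>R f) k))"
      by (rule poly_of_coeffs_superset[OF True fin]) (auto simp: scaleR_fun_def[of c f])
    also have "\<dots> = (\<Sum>k\<in>?K. c * distr_pow k \<omega> (f k))"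
      using linear_map_onD(3)[OF distr_pow_linear[OF True] subspace_sym_test_fun coeff_seqsD(1)[OF f]]
      by (intro sum.cong refl) (simp add: scaleR_fun_def[of c f])
    also have "\<dots> = c * poly_of_coeffs f \<omega>"
      by (simp add: sum_distrib_left poly_of_coeffs_superset[OF True fin, of f])
    finally show ?thesis by (simp add: scaleR_fun_def)
  qed (simp add: poly_of_coeffs_def scaleR_fun_def)
qed

lemma subspace_polynomials: "subspace polynomials"
proof -
  note P = linear_map_onD[OF poly_of_coeffs_linear subspace_coeff_seqs]
  show ?thesis
    unfolding subspace_def polynomials_def
  proof (intro conjI ballI allI)
    show "0 \<in> poly_of_coeffs ` coeff_seqs" using P(1) subspace_0[OF subspace_coeff_seqs] by (metis imageI)
    fix p :: "((real^'a \<Rightarrow> real) \<Rightarrow> real) \<Rightarrow> real" assume p: "p \<in> poly_of_coeffs ` coeff_seqs"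
    then obtain f where f: "f \<in> coeff_seqs" "p = poly_of_coeffs f" by blast
    show "c *\<^sub>R p \<in> poly_of_coeffs ` coeff_seqs" for c
      using P(3)[OF f(1), of c] subspace_scale[OF subspace_coeff_seqs f(1), of c] unfolding f(2) by (metis imageI)
    fix q :: "((real^'a \<Rightarrow> real) \<Rightarrow> real) \<Rightarrow> real" assume "q \<in> poly_of_coeffs ` coeff_seqs"
    then obtain g where g: "g \<in> coeff_seqs" "q = poly_of_coeffs g" by blast
    show "p + q \<in> poly_of_coeffs ` coeff_seqs"
      using P(2)[OF f(1) g(1)] subspace_add[OF subspace_coeff_seqs f(1) g(1)] unfolding f(2) g(2) by (metis imageI)
  qed
qed

lemma polynomials_off_distributions: "P \<in> polynomials \<Longrightarrow> \<omega> \<notin> distributions \<Longrightarrow> P \<omega> = 0"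
  by (auto simp: polynomials_def poly_of_coeffs_def)

lemma single_coeff_linear: "linear_map_on V (single_coeff k)"
  by (auto simp: linear_map_on_def single_coeff_def fun_eq_iff scaleR_fun_def)

lemma single_coeff_in:
  assumes "g \<in> sym_test_fun k"
  shows "single_coeff k g \<in> coeff_seqs"
proof -
  have "{m. single_coeff k g m \<noteq> 0} \<subseteq> {k}" by (auto simp: single_coeff_def)
  then have "finite {m. single_coeff k g m \<noteq> 0}" by (rule finite_subset) simp
  moreover have "single_coeff k g m \<in> sym_test_fun m" for m
    by (cases "m = k") (simp_all add: single_coeff_def assms subspace_0[OF subspace_sym_test_fun])
  ultimately show ?thesis by (simp add: coeff_seqs_def)
qed

lemma poly_single_coeff:
  assumes "\<omega> \<in> distributions"
  shows "poly_of_coeffs (single_coeff k g) \<omega> = distr_pow k \<omega> g"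
proof -
  have "poly_of_coeffs (single_coeff k g) \<omega> = (\<Sum>m\<in>{k}. distr_pow m \<omega> (single_coeff k g m))"
    by (rule poly_of_coeffs_superset[OF assms]) (auto simp: single_coeff_def)
  then show ?thesis by (simp add: single_coeff_def)
qed

text \<open>
  The seminorms that define the topology of the direct sum.
\<close>

abbreviation coeff_seminorms :: "((nat \<Rightarrow> (nat \<Rightarrow> real^'d) \<Rightarrow> real) \<Rightarrow> real) set" where
  "coeff_seminorms \<equiv> {p. seminorm_on coeff_seqs p \<and>
     (\<forall>k. continuous_map (sym_topology k) euclideanreal (\<lambda>g. p (single_coeff k g)))}"

lemma coeff_seminorms_nonempty: "coeff_seminorms \<noteq> {}"
proof -
  have "(\<lambda>_. 0) \<in> coeff_seminorms" by (simp add: seminorm_on_def)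
  then show ?thesis by blast
qed

lemma topspace_coeff_topology: "topspace coeff_topology = coeff_seqs"
  unfolding coeff_topology_def
  by (rule topspace_seminorm_topology_nonempty[OF subspace_coeff_seqs coeff_seminorms_nonempty]) blast

lemma single_coeff_continuous: "continuous_map (sym_topology k) coeff_topology (single_coeff k)"
  unfolding coeff_topology_def sym_topology_def
proof (rule linear_continuous_seminorm_topologies[OF subspace_sym_test_fun sym_topology_seminorms sobolev_pow_directed subspace_coeff_seqs])
  show "{p. seminorm_on coeff_seqs p \<and> (\<forall>k. continuous_map (seminorm_topology (sym_test_fun k) (sobolev_norm_pow k ` weights)) euclideanreal (\<lambda>g. p (single_coeff k g)))} \<noteq> {}"
    using coeff_seminorms_nonempty unfolding sym_topology_def .
qed (use single_coeff_linear single_coeff_in in auto)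

lemma topspace_polynomial_topology:
  "topspace polynomial_topology = (polynomials :: (((real^'d \<Rightarrow> real) \<Rightarrow> real) \<Rightarrow> real) set)"
proof
  let ?X = "polynomial_topology :: (((real^'d \<Rightarrow> real) \<Rightarrow> real) \<Rightarrow> real) topology"
  let ?A = "{f :: nat \<Rightarrow> (nat \<Rightarrow> real^'d) \<Rightarrow> real. f \<in> coeff_seqs \<and> poly_of_coeffs f \<in> polynomials}"
  have "openin ?X (topspace ?X)" by simp
  then show "topspace ?X \<subseteq> polynomials" unfolding openin_polynomial_topology by blast
  have "?A = topspace coeff_topology"
    by (auto simp: topspace_coeff_topology polynomials_def)
  then have "openin coeff_topology ?A" by (simp only: openin_topspace)
  then have "openin ?X polynomials" unfolding openin_polynomial_topology by blast
  then show "polynomials \<subseteq> topspace ?X" by (rule openin_subset)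
qed

lemma poly_of_coeffs_continuous: "continuous_map coeff_topology polynomial_topology poly_of_coeffs"
  unfolding continuous_map_def topspace_polynomial_topology topspace_coeff_topology
  by (auto simp: openin_polynomial_topology polynomials_def)

text \<open>
  The absolute value of the evaluation is itself one of the seminorms of the direct sum, by continuity of
  each \<open>\<omega>\<^sup>\<otimes>\<^sup>k\<close>.
\<close>

lemma evaluation_continuous:
  assumes \<omega>: "\<omega> \<in> distributions"
  shows "continuous_map polynomial_topology euclideanreal (\<lambda>P. P \<omega>)"
proof -
  have lin: "linear_map_on coeff_seqs (\<lambda>f. poly_of_coeffs f \<omega>)"
    using poly_of_coeffs_linear unfolding linear_map_on_def by (auto simp: scaleR_fun_def)
  have "seminorm_on coeff_seqs (\<lambda>f. \<bar>poly_of_coeffs f \<omega>\<bar>)"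
    using lin unfolding seminorm_on_def linear_map_on_def by (auto simp: abs_mult)
  moreover have "continuous_map (sym_topology k) euclideanreal (\<lambda>g. \<bar>distr_pow k \<omega> g\<bar>)" for k
    using distr_pow(1)[OF \<omega>, of k] by (auto simp: topological_dual_def intro!: continuous_map_real_abs)
  ultimately have sn: "seminorm_on coeff_seqs (\<lambda>f. \<bar>poly_of_coeffs f \<omega>\<bar>)"
    "(\<lambda>f. \<bar>poly_of_coeffs f \<omega>\<bar>) \<in> coeff_seminorms"
    by (simp_all add: poly_single_coeff[OF \<omega>])
  have cont: "continuous_map coeff_topology euclideanreal (\<lambda>f. poly_of_coeffs f \<omega>)"
    unfolding coeff_topology_def
    by (rule linear_continuous_of_bound[OF subspace_coeff_seqs sn(2,1) lin, of 1]) simp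
  show ?thesis
    unfolding continuous_map_def topspace_polynomial_topology openin_polynomial_topology
  proof (intro conjI allI impI)
    fix U :: "real set" assume U: "openin euclideanreal U"
    have "{f \<in> coeff_seqs. poly_of_coeffs f \<in> {P \<in> polynomials. P \<omega> \<in> U}} = {f \<in> coeff_seqs. poly_of_coeffs f \<omega> \<in> U}"
      by (auto simp: polynomials_def)
    then show "openin coeff_topology {f \<in> coeff_seqs. poly_of_coeffs f \<in> {P \<in> polynomials. P \<omega> \<in> U}}"
      using openin_continuous_map_preimage[OF cont U] by (simp only: topspace_coeff_topology)
  qed auto
qed

section \<open>Shift-invariant operators on powers of linear functionals\<close>

text \<open>
  The polynomial \<open>\<omega> \<mapsto> \<langle>\<omega>, \<xi>\<rangle>\<^sup>n\<close>.
\<close>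

definition power_poly :: "(real^'d \<Rightarrow> real) \<Rightarrow> nat \<Rightarrow> ((real^'d \<Rightarrow> real) \<Rightarrow> real) \<Rightarrow> real" where
  "power_poly \<xi> n = poly_of_coeffs (single_coeff n (tensor_pow n \<xi>))"

lemma power_poly_apply:
  assumes "\<xi> \<in> test_fun"
  shows "power_poly \<xi> n \<omega> = (if \<omega> \<in> distributions then \<omega> \<xi> ^ n else 0)"
proof (cases "\<omega> \<in> distributions")
  case True
  then show ?thesis
    using poly_single_coeff[OF True, of n "tensor_pow n \<xi>"] distr_pow(2)[OF True assms, of n] by (simp add: power_poly_def)
qed (simp add: power_poly_def poly_of_coeffs_def)

lemma sum_scaleR_apply: "(\<Sum>i\<in>I. c i *\<^sub>R f i) x = (\<Sum>i\<in>I. c i * (f i x :: real))"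
  by (simp add: sum_fun_apply scaleR_fun_def)

lemma power_poly_sum_apply:
  assumes "\<xi> \<in> test_fun"
  shows "(\<Sum>i\<in>I. c i *\<^sub>R power_poly \<xi> (m i)) \<omega> = (if \<omega> \<in> distributions then \<Sum>i\<in>I. c i * \<omega> \<xi> ^ m i else 0)"
  by (simp add: sum_scaleR_apply power_poly_apply[OF assms])

lemma power_poly_in: "\<xi> \<in> test_fun \<Longrightarrow> power_poly \<xi> n \<in> polynomials"
  unfolding power_poly_def polynomials_def using single_coeff_in tensor_pow_sym_test_fun by blast

lemma shift_power_poly:
  assumes \<xi>: "\<xi> \<in> test_fun" and \<zeta>: "\<zeta> \<in> distributions"
  shows "shift \<zeta> (power_poly \<xi> n) = (\<Sum>i\<le>n. (real (n choose i) * \<zeta> \<xi> ^ (n - i)) *\<^sub>R power_poly \<xi> i)"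
proof
  fix \<omega>
  show "shift \<zeta> (power_poly \<xi> n) \<omega> = (\<Sum>i\<le>n. (real (n choose i) * \<zeta> \<xi> ^ (n - i)) *\<^sub>R power_poly \<xi> i) \<omega>"
  proof (cases "\<omega> \<in> distributions")
    case True
    then have "shift \<zeta> (power_poly \<xi> n) \<omega> = (\<omega> \<xi> + \<zeta> \<xi>) ^ n"
      using add_distributions[OF True \<zeta>] by (simp add: shift_def power_poly_apply[OF \<xi>])
    also have "\<dots> = (\<Sum>i\<le>n. real (n choose i) * \<omega> \<xi> ^ i * \<zeta> \<xi> ^ (n - i))"
      by (rule binomial_ring)
    finally show ?thesis using True
      by (simp add: sum_fun_apply scaleR_fun_def power_poly_apply[OF \<xi>] mult_ac)
  qed (simp add: shift_def sum_fun_apply scaleR_fun_def power_poly_apply[OF \<xi>])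
qed

lemma shift_invariantD:
  assumes "T \<in> shift_invariant"
  shows "P \<in> polynomials \<Longrightarrow> T P \<in> polynomials" "linear_map_on polynomials T"
    "continuous_map polynomial_topology polynomial_topology T"
    "\<zeta> \<in> distributions \<Longrightarrow> P \<in> polynomials \<Longrightarrow> T (shift \<zeta> P) = shift \<zeta> (T P)"
  using assms unfolding shift_invariant_def polynomial_operators_def by auto

text \<open>
  Evaluating at \<open>\<omega>\<close> is shifting by \<open>\<omega>\<close> and evaluating at \<open>0\<close>, and \<open>T\<close> commutes with the shift.
\<close>

lemma shift_invariant_power_poly:
  assumes T: "T \<in> shift_invariant" and \<xi>: "\<xi> \<in> test_fun"
  shows "T (power_poly \<xi> n) = (\<Sum>i\<le>n. (real (n choose i) * T (power_poly \<xi> i) 0) *\<^sub>R power_poly \<xi> (n - i))"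
proof
  fix \<omega>
  note D = shift_invariantD[OF T]
  show "T (power_poly \<xi> n) \<omega> = (\<Sum>i\<le>n. (real (n choose i) * T (power_poly \<xi> i) 0) *\<^sub>R power_poly \<xi> (n - i)) \<omega>"
  proof (cases "\<omega> \<in> distributions")
    case True
    have "T (power_poly \<xi> n) \<omega> = shift \<omega> (T (power_poly \<xi> n)) 0"
      by (simp add: shift_def zero_distributions)
    also have "\<dots> = T (shift \<omega> (power_poly \<xi> n)) 0" using D(4)[OF True power_poly_in[OF \<xi>]] by simp
    also have "T (shift \<omega> (power_poly \<xi> n)) = (\<Sum>i\<le>n. (real (n choose i) * \<omega> \<xi> ^ (n - i)) *\<^sub>R T (power_poly \<xi> i))"
      unfolding shift_power_poly[OF \<xi> True]
      by (rule linear_map_on_sum[OF D(2) subspace_polynomials power_poly_in[OF \<xi>]])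
    finally have "T (power_poly \<xi> n) \<omega> = (\<Sum>i\<le>n. (real (n choose i) * \<omega> \<xi> ^ (n - i)) * T (power_poly \<xi> i) 0)"
      by (simp only: sum_scaleR_apply)
    also have "\<dots> = (\<Sum>i\<le>n. (real (n choose i) * T (power_poly \<xi> i) 0) * \<omega> \<xi> ^ (n - i))"
      by (intro sum.cong refl) (simp only: mult_ac)
    also have "\<dots> = (\<Sum>i\<le>n. (real (n choose i) * T (power_poly \<xi> i) 0) *\<^sub>R power_poly \<xi> (n - i)) \<omega>"
      unfolding power_poly_sum_apply[OF \<xi>] if_P[OF True] ..
    finally show ?thesis .
  next
    case False
    show ?thesis
      unfolding power_poly_sum_apply[OF \<xi>] if_not_P[OF False]
      by (rule polynomials_off_distributions[OF D(1)[OF power_poly_in[OF \<xi>]] False])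
  qed
qed

lemma shift_invariant_commute_power_poly:
  assumes S: "S \<in> shift_invariant" and T: "T \<in> shift_invariant" and \<xi>: "\<xi> \<in> test_fun"
  shows "S (T (power_poly \<xi> n)) = T (S (power_poly \<xi> n))"
proof -
  let ?s = "\<lambda>i. S (power_poly \<xi> i) 0" and ?t = "\<lambda>i. T (power_poly \<xi> i) 0"
  have at0: "U (V (power_poly \<xi> n)) 0 = (\<Sum>i\<le>n. real (n choose i) * V (power_poly \<xi> i) 0 * U (power_poly \<xi> (n - i)) 0)"
    if U: "U \<in> shift_invariant" and V: "V \<in> shift_invariant" for U V n
  proof -
    have "U (V (power_poly \<xi> n)) = (\<Sum>i\<le>n. (real (n choose i) * V (power_poly \<xi> i) 0) *\<^sub>R U (power_poly \<xi> (n - i)))"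
      unfolding shift_invariant_power_poly[OF V \<xi>, of n]
      by (rule linear_map_on_sum[OF shift_invariantD(2)[OF U] subspace_polynomials power_poly_in[OF \<xi>]])
    then show ?thesis by (simp only: sum_scaleR_apply)
  qed
  \<comment> \<open>the binomial convolution of the two sequences of values at \<open>0\<close> is commutative\<close>
  have eq0: "S (T (power_poly \<xi> n)) 0 = T (S (power_poly \<xi> n)) 0" for n
  proof -
    have "S (T (power_poly \<xi> n)) 0 = (\<Sum>i\<le>n. real (n choose i) * ?t i * ?s (n - i))" by (rule at0[OF S T])
    also have "\<dots> = (\<Sum>i\<le>n. real (n choose (n - i)) * ?t (n - i) * ?s (n - (n - i)))"
      by (rule sum.reindex_bij_witness[where i="\<lambda>i. n - i" and j="\<lambda>i. n - i"]) auto
    also have "\<dots> = (\<Sum>i\<le>n. real (n choose i) * ?s i * ?t (n - i))"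
      by (rule sum.cong) (auto simp: binomial_symmetric[symmetric] mult_ac)
    also have "\<dots> = T (S (power_poly \<xi> n)) 0" by (rule at0[OF T S, symmetric])
    finally show ?thesis .
  qed
  show ?thesis
  proof
    fix \<omega>
    show "S (T (power_poly \<xi> n)) \<omega> = T (S (power_poly \<xi> n)) \<omega>"
    proof (cases "\<omega> \<in> distributions")
      case True
      have move: "U (V (power_poly \<xi> n)) \<omega> = (\<Sum>i\<le>n. (real (n choose i) * \<omega> \<xi> ^ (n - i)) * U (V (power_poly \<xi> i)) 0)"
        if U: "U \<in> shift_invariant" and V: "V \<in> shift_invariant" for U V
      proof -
        note DU = shift_invariantD[OF U] and DV = shift_invariantD[OF V]
        have "U (V (power_poly \<xi> n)) \<omega> = shift \<omega> (U (V (power_poly \<xi> n))) 0"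
          by (simp add: shift_def zero_distributions)
        also have "\<dots> = U (V (shift \<omega> (power_poly \<xi> n))) 0"
          by (simp add: DU(4)[OF True] DV(4)[OF True] DV(1) power_poly_in[OF \<xi>])
        also have "V (shift \<omega> (power_poly \<xi> n)) = (\<Sum>i\<le>n. (real (n choose i) * \<omega> \<xi> ^ (n - i)) *\<^sub>R V (power_poly \<xi> i))"
          unfolding shift_power_poly[OF \<xi> True]
          by (rule linear_map_on_sum[OF DV(2) subspace_polynomials power_poly_in[OF \<xi>]])
        also have "U \<dots> = (\<Sum>i\<le>n. (real (n choose i) * \<omega> \<xi> ^ (n - i)) *\<^sub>R U (V (power_poly \<xi> i)))"
          by (rule linear_map_on_sum[OF DU(2) subspace_polynomials DV(1)[OF power_poly_in[OF \<xi>]]])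
        finally show ?thesis by (simp only: sum_scaleR_apply)
      qed
      show ?thesis unfolding move[OF S T] move[OF T S] eq0 ..
    next
      case False
      then show ?thesis
        using polynomials_off_distributions shift_invariantD(1)[OF S] shift_invariantD(1)[OF T] power_poly_in[OF \<xi>] by metis
    qed
  qed
qed

lemma polynomial_coeff_decomposition:
  assumes f: "f \<in> coeff_seqs"
  shows "poly_of_coeffs f = (\<Sum>k | f k \<noteq> 0. poly_of_coeffs (single_coeff k (f k)))"
proof
  fix \<omega>
  show "poly_of_coeffs f \<omega> = (\<Sum>k | f k \<noteq> 0. poly_of_coeffs (single_coeff k (f k))) \<omega>"
    by (cases "\<omega> \<in> distributions")
       (simp_all add: sum_fun_apply poly_single_coeff poly_of_coeffs_superset[OF _ coeff_seqsD(2)[OF f]], simp add: poly_of_coeffs_def)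
qed

theorem corollary4p10:
  fixes S T :: "(((real^'d \<Rightarrow> real) \<Rightarrow> real) \<Rightarrow> real) \<Rightarrow> (((real^'d \<Rightarrow> real) \<Rightarrow> real) \<Rightarrow> real)"
  assumes "S \<in> shift_invariant" and "T \<in> shift_invariant"
  shows "\<forall>P\<in>polynomials. S (T P) = T (S P)"
proof
  fix P :: "((real^'d \<Rightarrow> real) \<Rightarrow> real) \<Rightarrow> real" assume "P \<in> polynomials"
  then obtain f where f: "f \<in> coeff_seqs" "P = poly_of_coeffs f" by (auto simp: polynomials_def)
  note DS = shift_invariantD[OF assms(1)] and DT = shift_invariantD[OF assms(2)]
  let ?Q = "\<lambda>k g. poly_of_coeffs (single_coeff k g)"
  have Q: "?Q k g \<in> polynomials" if "g \<in> sym_test_fun k" for k and g :: "(nat \<Rightarrow> real^'d) \<Rightarrow> real"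
    using that single_coeff_in by (auto simp: polynomials_def)
  have comp_cont: "continuous_map polynomial_topology polynomial_topology (\<lambda>P. U (V P))"
    and comp_lin: "linear_map_on polynomials (\<lambda>P. U (V P))"
    if U: "U \<in> shift_invariant" and V: "V \<in> shift_invariant" for U V :: "(((real^'d \<Rightarrow> real) \<Rightarrow> real) \<Rightarrow> real) \<Rightarrow> (((real^'d \<Rightarrow> real) \<Rightarrow> real) \<Rightarrow> real)"
  proof -
    note DU = shift_invariantD[OF U] and DV = shift_invariantD[OF V]
    show "continuous_map polynomial_topology polynomial_topology (\<lambda>P. U (V P))"
      using continuous_map_compose[OF DV(3) DU(3)] by (simp add: comp_def)
    show "linear_map_on polynomials (\<lambda>P. U (V P))"
      using DU(2) DV(1,2) unfolding linear_map_on_def by auto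
  qed
  have single: "S (T (?Q k g)) = T (S (?Q k g))" if g: "g \<in> sym_test_fun k" for k g
  proof
    fix \<omega>
    show "S (T (?Q k g)) \<omega> = T (S (?Q k g)) \<omega>"
    proof (cases "\<omega> \<in> distributions")
      case True
      \<comment> \<open>the value at \<open>\<omega>\<close> as a functional of the coefficient, set to \<open>0\<close> off the test functions as members
        of the dual are\<close>
      define F where "F U V g = (if g \<in> sym_test_fun k then U (V (?Q k g)) \<omega> else 0)"
        for U V :: "(((real^'d \<Rightarrow> real) \<Rightarrow> real) \<Rightarrow> real) \<Rightarrow> (((real^'d \<Rightarrow> real) \<Rightarrow> real) \<Rightarrow> real)" and g
      have F: "F U V \<in> topological_dual (sym_test_fun k) (sym_topology k)"
        if U: "U \<in> shift_invariant" and V: "V \<in> shift_invariant" for U V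
      proof -
        have top: "topspace (sym_topology k) = (sym_test_fun k :: ((nat \<Rightarrow> real^'d) \<Rightarrow> real) set)"
          unfolding sym_topology_def by (rule topspace_seminorm_topology_nonempty[OF subspace_sym_test_fun sym_topology_seminorms])
        have "continuous_map (sym_topology k) euclideanreal (\<lambda>g. U (V (?Q k g)) \<omega>)"
          using continuous_map_compose[OF continuous_map_compose[OF continuous_map_compose[OF single_coeff_continuous poly_of_coeffs_continuous]
            comp_cont[OF U V]] evaluation_continuous[OF True]] by (simp add: comp_def)
        then have "continuous_map (sym_topology k) euclideanreal (F U V)"
          by (rule continuous_map_eq) (simp add: F_def top)
        moreover have "linear_map_on (sym_test_fun k) (F U V)"
          unfolding linear_map_on_def
        proof (intro conjI ballI allI)
          note L = linear_map_onD[OF comp_lin[OF U V] subspace_polynomials]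
            and P = linear_map_onD[OF poly_of_coeffs_linear subspace_coeff_seqs]
            and C = linear_map_onD[OF single_coeff_linear subspace_sym_test_fun]
          fix g h :: "(nat \<Rightarrow> real^'d) \<Rightarrow> real" assume g: "g \<in> sym_test_fun k" and h: "h \<in> sym_test_fun k"
          have "U (V (?Q k (g + h))) = U (V (?Q k g)) + U (V (?Q k h))"
            using C(2)[OF g h] P(2)[OF single_coeff_in[OF g] single_coeff_in[OF h]] L(2)[OF Q[OF g] Q[OF h]] by metis
          then show "F U V (g + h) = F U V g + F U V h"
            using g h subspace_add[OF subspace_sym_test_fun g h] by (simp add: F_def)
          have "U (V (?Q k (c *\<^sub>R g))) = c *\<^sub>R U (V (?Q k g))" for c
            using C(3)[OF g, of k c] P(3)[OF single_coeff_in[OF g], of c] L(3)[OF Q[OF g], of c] by metis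
          then show "F U V (c *\<^sub>R g) = c *\<^sub>R F U V g" for c
            using g subspace_scale[OF subspace_sym_test_fun g, of c] unfolding F_def by (simp add: scaleR_fun_def)
        qed
        ultimately show ?thesis by (simp add: topological_dual_def F_def)
      qed
      have "F S T g - F T S g = 0"
      proof (rule dual_sym_eq_0[OF dual_diff[OF F[OF assms] F[OF assms(2,1)]]])
        fix \<xi> :: "real^'d \<Rightarrow> real" assume \<xi>: "\<xi> \<in> test_fun"
        show "F S T (tensor_pow k \<xi>) - F T S (tensor_pow k \<xi>) = 0"
          using shift_invariant_commute_power_poly[OF assms \<xi>, of k] tensor_pow_sym_test_fun[OF \<xi>, of k]
          by (simp add: F_def power_poly_def)
      qed
      then show ?thesis using g by (simp add: F_def)
    next
      case False
      then show ?thesis using polynomials_off_distributions DS(1) DT(1) Q[OF g] by metis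
    qed
  qed
  have dec: "P = (\<Sum>k | f k \<noteq> 0. 1 *\<^sub>R ?Q k (f k))"
    using polynomial_coeff_decomposition[OF f(1)] f(2) by simp
  have U: "U (V P) = (\<Sum>k | f k \<noteq> 0. 1 *\<^sub>R U (V (?Q k (f k))))"
    if "U \<in> shift_invariant" "V \<in> shift_invariant" for U V :: "(((real^'d \<Rightarrow> real) \<Rightarrow> real) \<Rightarrow> real) \<Rightarrow> (((real^'d \<Rightarrow> real) \<Rightarrow> real) \<Rightarrow> real)"
    unfolding dec by (rule linear_map_on_sum[OF comp_lin[OF that] subspace_polynomials Q[OF coeff_seqsD(1)[OF f(1)]]])
  show "S (T P) = T (S P)"
    unfolding U[OF assms] U[OF assms(2,1)] by (simp add: single coeff_seqsD(1)[OF f(1)])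
qed

end
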